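(* For every $m\in\mathbb N=\{0,1,2,\dots\}$ there exists a constant $C=C(m)\ge1$ such that for every $k\in\mathbb Z$, every axisymmetric domain $\breve\Omega\subset\mathbb R^3$ with meridian domain $\Omega\subset\mathbb R_+\times\mathbb R$, and every $w\in L^2_1(\Omega)$, $$ C^{-1}\,|w|^2_{H^m_{\perp(k)}(\Omega)}\;\le\;|w|^2_{W^m_{(k)}(\Omega)}+|w|^2_{X^m_{(k)}(\Omega)}\;\le\;C\,|w|^2_{H^m_{\perp(k)}(\Omega)}, $$ where $$ |w|^2_{W^m_{(k)}(\Omega)}=\sum_{\ell=0}^{\min\{|k|,m\}}\Big\|\partial_r^{m-\ell}\Big(\tfrac{|k|}{r}\Big)^{\ell}w\Big\|^2_{L^2_1(\Omega)},\qquad |w|^2_{X^m_{(k)}(\Omega)}=\sum_{1\le\ell\le(m-|k|)/2}\Big\|\partial_r^{m-|k|-2\ell}\Big(\tfrac1r\partial_r\Big)^{\ell}\Big(\tfrac1r\Big)^{|k|}w\Big\|^2_{L^2_1(\Omega)} . $$ In particular $C$ depends neither on $k$ nor on $\Omega$. The same result holds if $\Omega\subset\mathbb R_+$ is the meridian domain of a 2D axisymmetric domain $\breve\Omega\subset\mathbb R^2$.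
   Context: Functions are complex valued; $\mathbb R_+=(0,\infty)$. An axisymmetric domain $\breve\Omega\subset\mathbb R^3$ is a domain invariant under all rotations around the $z$-axis; its meridian domain is $\Omega=\{(r,z): r>0,\ (r,0,z)\in\breve\Omega\}$. Cylindrical coordinates: $x=r\cos\theta$, $y=r\sin\theta$, $z$. (Whether points of the axis $\{r=0\}$ are included in $\breve\Omega$ is immaterial.) $L^2_1(\Omega)$ is the space of measurable functions with $\|v\|^2_{L^2_1(\Omega)}=2\pi\int_\Omega|v(r,z)|^2\,r\,dr\,dz<\infty$. For functions on $\breve\Omega$, the transversal seminorm is $$|\breve u|^2_{H^m_\perp(\breve\Omega)}=\sum_{\alpha_1+\alpha_2=m}\|\partial_x^{\alpha_1}\partial_y^{\alpha_2}\breve u\|^2_{L^2(\breve\Omega)}.$$ For $w\in L^2_1(\Omega)$ set $\breve w_k(x,y,z)=e^{ik\theta}w(r,z)$ and $|w|_{H^m_{\perp(k)}(\Omega)}:=|\breve w_k|_{H^m_\perp(\breve\Omega)}$. Seminorms take values in $[0,+\infty]$, being $+\infty$ when a required distributional derivative is not in the corresponding $L^2$ space. Conventions: $(|k|/r)^0\equiv1$ for all $k$, including $k=0$; empty sums are $0$; in products of operators the rightmost acts first (e.g. $\partial_r^{m-\ell}(|k|/r)^\ell w=\partial_r^{m-\ell}[(|k|/r)^\ell w]$). In the 2D case, $\breve\Omega\subset\mathbb R^2$ is a domain invariant under rotations around the origin, $\Omega=\{r>0:(r,0)\in\breve\Omega\}$ is an interval, the variable $z$ is absent, $\|v\|^2_{L^2_1(\Omega)}=2\pi\int_\Omega|v|^2r\,dr$,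 and $|w|^2_{H^m_{\perp(k)}(\Omega)}=\sum_{\alpha_1+\alpha_2=m}\|\partial_x^{\alpha_1}\partial_y^{\alpha_2}(e^{ik\theta}w(r))\|^2_{L^2(\breve\Omega)}$. *)

theory Defs
  imports "HOL-Analysis.Analysis"
begin

section \<open>Test functions and distributions\<close>

primrec C_diff :: "nat \<Rightarrow> ('a::euclidean_space \<Rightarrow> 'b::real_normed_vector) \<Rightarrow> bool" where
  "C_diff 0 f = continuous_on UNIV f"
| "C_diff (Suc n) f = ((\<forall>x. f differentiable (at x)) \<and>
     (\<forall>b\<in>Basis. C_diff n (\<lambda>x. frechet_derivative f (at x) b)))"

definition smooth :: "('a::euclidean_space \<Rightarrow> 'b::real_normed_vector) \<Rightarrow> bool" where
  "smooth f \<longleftrightarrow> (\<forall>n. C_diff n f)"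

definition test_fun :: "'a::euclidean_space set \<Rightarrow> ('a \<Rightarrow> complex) set" where
  "test_fun U = {\<phi>. smooth \<phi> \<and> compact (closure {x. \<phi> x \<noteq> 0}) \<and> closure {x. \<phi> x \<noteq> 0} \<subseteq> U}"

text \<open>A distribution on an open set \<open>U\<close> is represented by a functional on functions of
  which only the values on \<open>test_fun U\<close> matter. All functionals used below arise from locally
  integrable functions by differentiation and by multiplication with functions that are smooth on
  \<open>U\<close>. The pairing is bilinear, without complex conjugation.\<close>

type_synonym 'a distr = "('a \<Rightarrow> complex) \<Rightarrow> complex"

definition distr_of :: "'a::euclidean_space set \<Rightarrow> ('a \<Rightarrow> complex) \<Rightarrow> 'a distr" where
  "distr_of U f = (\<lambda>\<phi>. LINT x:U|lebesgue. f x * \<phi> x)"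

definition dderiv :: "'a::euclidean_space \<Rightarrow> 'a distr \<Rightarrow> 'a distr" where
  "dderiv b T = (\<lambda>\<phi>. - T (\<lambda>x. frechet_derivative \<phi> (at x) b))"

definition dmult :: "('a::euclidean_space \<Rightarrow> real) \<Rightarrow> 'a distr \<Rightarrow> 'a distr" where
  "dmult g T = (\<lambda>\<phi>. T (\<lambda>x. complex_of_real (g x) * \<phi> x))"


section \<open>Weighted square-integrable functions and distributions\<close>

definition L2norm_sq :: "('a::euclidean_space \<Rightarrow> real) \<Rightarrow> 'a set \<Rightarrow> ('a \<Rightarrow> complex) \<Rightarrow> ennreal" where
  "L2norm_sq \<omega> U f = (\<integral>\<^sup>+x\<in>U. ennreal (\<omega> x * (cmod (f x))\<^sup>2) \<partial>lebesgue)"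

definition L2_space :: "('a::euclidean_space \<Rightarrow> real) \<Rightarrow> 'a set \<Rightarrow> ('a \<Rightarrow> complex) set" where
  "L2_space \<omega> U = {f. f \<in> borel_measurable (lebesgue_on U) \<and> L2norm_sq \<omega> U f < \<infinity>}"

text \<open>The squared norm of a distribution. If the distribution is a function in the weighted
  space, that function is unique almost everywhere, so the infimum is just its squared norm;
  otherwise the infimum is over the empty set, that is, \<open>\<infinity>\<close>.  (For the weights used below, which
  are continuous and positive on \<open>U\<close>, members of \<open>L2_space \<omega> U\<close> are locally integrable on \<open>U\<close>.)\<close>

definition distr_L2norm_sq :: "('a::euclidean_space \<Rightarrow> real) \<Rightarrow> 'a set \<Rightarrow> 'a distr \<Rightarrow> ennreal" where
  "distr_L2norm_sq \<omega> U T =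
     (INF f\<in>{f \<in> L2_space \<omega> U. \<forall>\<phi>\<in>test_fun U. T \<phi> = distr_of U f \<phi>}. L2norm_sq \<omega> U f)"


section \<open>The transversal seminorm\<close>

definition Hperp_sq :: "'a::euclidean_space \<Rightarrow> 'a \<Rightarrow> 'a set \<Rightarrow> nat \<Rightarrow> ('a \<Rightarrow> complex) \<Rightarrow> ennreal" where
  "Hperp_sq ex ey U m u =
     (\<Sum>(a1, a2)\<in>{(a1, a2). a1 + a2 = m}.
        distr_L2norm_sq (\<lambda>_. 1) U ((dderiv ex ^^ a1) ((dderiv ey ^^ a2) (distr_of U u))))"


section \<open>The weighted seminorms on the meridian domain\<close>

text \<open>To treat the three- and two-dimensional cases together, \<open>\<rho>\<close> is the function giving the
  coordinate \<open>r\<close> and \<open>e\<close> is the unit vector of the \<open>r\<close>-direction.\<close>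

definition L21_space :: "('a::euclidean_space \<Rightarrow> real) \<Rightarrow> 'a set \<Rightarrow> ('a \<Rightarrow> complex) set" where
  "L21_space \<rho> \<Omega> = L2_space (\<lambda>p. 2 * pi * \<rho> p) \<Omega>"

definition distr_L21norm_sq :: "('a::euclidean_space \<Rightarrow> real) \<Rightarrow> 'a set \<Rightarrow> 'a distr \<Rightarrow> ennreal" where
  "distr_L21norm_sq \<rho> \<Omega> T = distr_L2norm_sq (\<lambda>p. 2 * pi * \<rho> p) \<Omega> T"

definition W_sq :: "('a::euclidean_space \<Rightarrow> real) \<Rightarrow> 'a \<Rightarrow> 'a set \<Rightarrow> nat \<Rightarrow> int \<Rightarrow> ('a \<Rightarrow> complex) \<Rightarrow> ennreal"
  where
  "W_sq \<rho> e \<Omega> m k w =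
     (\<Sum>l = 0..min (nat \<bar>k\<bar>) m.
        distr_L21norm_sq \<rho> \<Omega>
          ((dderiv e ^^ (m - l)) (dmult (\<lambda>p. (real_of_int \<bar>k\<bar> / \<rho> p) ^ l) (distr_of \<Omega> w))))"

definition X_sq :: "('a::euclidean_space \<Rightarrow> real) \<Rightarrow> 'a \<Rightarrow> 'a set \<Rightarrow> nat \<Rightarrow> int \<Rightarrow> ('a \<Rightarrow> complex) \<Rightarrow> ennreal"
  where
  "X_sq \<rho> e \<Omega> m k w =
     (\<Sum>l | 1 \<le> l \<and> real l \<le> (real m - real_of_int \<bar>k\<bar>) / 2.
        distr_L21norm_sq \<rho> \<Omega>
          ((dderiv e ^^ (m - nat \<bar>k\<bar> - 2 * l))
            (((\<lambda>T. dmult (\<lambda>p. 1 / \<rho> p) (dderiv e T)) ^^ l)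
              (dmult (\<lambda>p. (1 / \<rho> p) ^ nat \<bar>k\<bar>) (distr_of \<Omega> w)))))"


section \<open>Axisymmetric domains\<close>

definition is_domain :: "'a::euclidean_space set \<Rightarrow> bool" where
  "is_domain U \<longleftrightarrow> open U \<and> connected U \<and> U \<noteq> {}"

definition axisymmetric3 :: "(real \<times> real \<times> real) set \<Rightarrow> bool" where
  "axisymmetric3 U \<longleftrightarrow>
     (\<forall>t. (\<lambda>(x, y, z). (x * cos t - y * sin t, x * sin t + y * cos t, z)) ` U = U)"

definition axisymmetric2 :: "(real \<times> real) set \<Rightarrow> bool" where
  "axisymmetric2 U \<longleftrightarrow>
     (\<forall>t. (\<lambda>(x, y). (x * cos t - y * sin t, x * sin t + y * cos t)) ` U = U)"

definition meridian3 :: "(real \<times> real \<times> real) set \<Rightarrow> (real \<times> real) set" where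
  "meridian3 U = {(r, z). r > 0 \<and> (r, 0, z) \<in> U}"

definition meridian2 :: "(real \<times> real) set \<Rightarrow> real set" where
  "meridian2 U = {r. r > 0 \<and> (r, 0) \<in> U}"

text \<open>The functions \<open>e\<^sup>i\<^sup>k\<^sup>\<theta> w\<close>; their values on the axis \<open>x = y = 0\<close>, a null set, are
  irrelevant.\<close>

definition lift3 :: "int \<Rightarrow> (real \<times> real \<Rightarrow> complex) \<Rightarrow> real \<times> real \<times> real \<Rightarrow> complex" where
  "lift3 k w = (\<lambda>(x, y, z). cis (real_of_int k * Arg (Complex x y)) * w (sqrt (x\<^sup>2 + y\<^sup>2), z))"

definition lift2 :: "int \<Rightarrow> (real \<Rightarrow> complex) \<Rightarrow> real \<times> real \<Rightarrow> complex" where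
  "lift2 k w = (\<lambda>(x, y). cis (real_of_int k * Arg (Complex x y)) * w (sqrt (x\<^sup>2 + y\<^sup>2)))"


section \<open>The seminorms in three and two dimensions\<close>

text \<open>\<open>Hperpk3_sq\<close> and \<open>Hperpk2_sq\<close> are computed on the axisymmetric domain \<open>U\<close> itself, the others
  on its meridian domain \<open>\<Omega>\<close>.\<close>

definition Hperpk3_sq :: "(real \<times> real \<times> real) set \<Rightarrow> nat \<Rightarrow> int \<Rightarrow> (real \<times> real \<Rightarrow> complex) \<Rightarrow> ennreal"
  where "Hperpk3_sq U m k w = Hperp_sq (1, 0, 0) (0, 1, 0) U m (lift3 k w)"

definition Hperpk2_sq :: "(real \<times> real) set \<Rightarrow> nat \<Rightarrow> int \<Rightarrow> (real \<Rightarrow> complex) \<Rightarrow> ennreal"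
  where "Hperpk2_sq U m k w = Hperp_sq (1, 0) (0, 1) U m (lift2 k w)"

abbreviation W3_sq :: "(real \<times> real) set \<Rightarrow> nat \<Rightarrow> int \<Rightarrow> (real \<times> real \<Rightarrow> complex) \<Rightarrow> ennreal"
  where "W3_sq \<equiv> W_sq fst (1, 0)"

abbreviation X3_sq :: "(real \<times> real) set \<Rightarrow> nat \<Rightarrow> int \<Rightarrow> (real \<times> real \<Rightarrow> complex) \<Rightarrow> ennreal"
  where "X3_sq \<equiv> X_sq fst (1, 0)"

abbreviation W2_sq :: "real set \<Rightarrow> nat \<Rightarrow> int \<Rightarrow> (real \<Rightarrow> complex) \<Rightarrow> ennreal"
  where "W2_sq \<equiv> W_sq (\<lambda>r. r) 1"

abbreviation X2_sq :: "real set \<Rightarrow> nat \<Rightarrow> int \<Rightarrow> (real \<Rightarrow> complex) \<Rightarrow> ennreal"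
  where "X2_sq \<equiv> X_sq (\<lambda>r. r) 1"

end

theory Submission
  imports Defs "HOL-Computational_Algebra.Polynomial"
begin

text \<open>Let \<open>\<zeta> = x + \<i>y\<close>, with conjugate \<open>\<zeta>'\<close>. On functions \<open>e\<^sup>i\<^sup>k\<^sup>\<theta> w\<close> the derivatives \<open>2\<partial>\<^sub>\<zeta>\<close> and \<open>2\<partial>\<^sub>\<zeta>\<^sub>'\<close> lower, respectively
  raise, the mode \<open>k\<close> by one and act on \<open>w\<close> as \<open>\<partial>\<^sub>r + k/r\<close>, respectively \<open>\<partial>\<^sub>r - k/r\<close>. Since
  \<open>w \<mapsto> e\<^sup>i\<^sup>k\<^sup>\<theta> w\<close> is an isometry, the transversal seminorm is equivalent to the sum of the norms of
  \<open>r\<^sup>-\<^sup>m p(r\<partial>\<^sub>r) w\<close> for \<open>m + 1\<close> explicit polynomials \<open>p\<close>; the seminorms \<open>W\<close> and \<open>X\<close> are sums of the same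
  kind. Both families of polynomials span the polynomials of degree at most \<open>m\<close> that vanish at the
  points \<open>\<bar>k\<bar>, \<bar>k\<bar> + 2, \<bar>k\<bar> + 4, \<dots>\<close> below \<open>m\<close>, and the coefficients that express one family in
  terms of the other are bounded uniformly in \<open>k\<close>: for \<open>\<bar>k\<bar> \<ge> m\<close> they are rational in \<open>k\<close> of degree at
  most zero, and the remaining \<open>k\<close> are finitely many.\<close>

section \<open>Smooth functions and test functions\<close>

text \<open>Polar coordinates are smooth only off the axis, so every identity between modes and
  operators in \<open>r\<close> is proved on \<open>U'\<close>, that is \<open>U\<close> without its
  axis. The obstacle is the way back to \<open>U\<close>: a distributional derivative may acquire a
  part concentrated on the axis, as the Laplacian of \<open>log r\<close> does in the plane. Such
  parts are excluded by considering all derivatives of order \<open>m\<close> together. All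
  operators act on functionals by transposition, so a distribution is lifted by taking Fourier modes
  of test functions. The isometry is proved for arbitrary distributions: a representative of a
  lifted distribution need not look like a lift, but its angular average against the phase
  represents the original one and has no larger norm. The final constant is
  \<open>L\<^sup>2\<close>: one factor \<open>L\<close> pays for passing between real and complex
  derivatives, the other for passing between the two families of polynomials.\<close>

abbreviation pd :: "'a::euclidean_space \<Rightarrow> ('a \<Rightarrow> 'b::real_normed_vector) \<Rightarrow> 'a \<Rightarrow> 'b" where
  "pd b f \<equiv> (\<lambda>x. frechet_derivative f (at x) b)"

lemma pd_eqI: "(f has_derivative f') (at x) \<Longrightarrow> pd b f x = f' b"
  by (metis frechet_derivative_at)

lemma C_diff_Suc_imp: "C_diff (Suc n) f \<Longrightarrow> C_diff n f"
proof (induction n arbitrary: f)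
  case 0
  then show ?case
    by (auto intro!: continuous_at_imp_continuous_on differentiable_imp_continuous_within)
next
  case (Suc n)
  then show ?case by simp
qed

lemma smooth_continuous: "smooth f \<Longrightarrow> continuous_on UNIV f"
  unfolding smooth_def by (metis C_diff.simps(1))

lemma smooth_differentiable: "smooth f \<Longrightarrow> f differentiable (at x)"
  unfolding smooth_def using C_diff.simps(2) by blast

lemma smooth_has_derivative:
  "smooth f \<Longrightarrow> (f has_derivative frechet_derivative f (at x)) (at x)"
  by (metis frechet_derivative_works smooth_differentiable)

lemma smooth_pd_Basis: "smooth f \<Longrightarrow> b \<in> Basis \<Longrightarrow> smooth (pd b f)"
  unfolding smooth_def using C_diff.simps(2) by blast

lemma smoothI_pd:
  "(\<And>x. f differentiable (at x)) \<Longrightarrow> (\<And>b. b \<in> Basis \<Longrightarrow> smooth (pd b f)) \<Longrightarrow> smooth f"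
  unfolding smooth_def by (metis C_diff.simps(2) C_diff_Suc_imp)

lemma pd_add:
  assumes "f differentiable (at x)" "g differentiable (at x)"
  shows "pd b (\<lambda>x. f x + g x) x = pd b f x + pd b g x"
  using assms unfolding frechet_derivative_works
  by (intro pd_eqI[where f' = "\<lambda>h. pd h f x + pd h g x", simplified]) (auto intro: derivative_intros)

lemma pd_mult:
  fixes f g :: "'a::euclidean_space \<Rightarrow> 'b::real_normed_algebra"
  assumes "f differentiable (at x)" "g differentiable (at x)"
  shows "pd b (\<lambda>x. f x * g x) x = f x * pd b g x + pd b f x * g x"
  using assms unfolding frechet_derivative_works
  by (intro pd_eqI[where f' = "\<lambda>h. f x * pd h g x + pd h f x * g x", simplified])
     (auto intro: has_derivative_mult)

lemma C_diff_add: "C_diff n f \<Longrightarrow> C_diff n g \<Longrightarrow> C_diff n (\<lambda>x. f x + g x)"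
proof (induction n arbitrary: f g)
  case 0
  then show ?case by (auto intro: continuous_intros)
next
  case (Suc n)
  then have "pd b (\<lambda>x. f x + g x) = (\<lambda>x. pd b f x + pd b g x)" for b
    by (auto simp: pd_add)
  with Suc show ?case by (auto intro: derivative_intros)
qed

lemma C_diff_mult:
  fixes f g :: "'a::euclidean_space \<Rightarrow> 'b::real_normed_algebra"
  shows "C_diff n f \<Longrightarrow> C_diff n g \<Longrightarrow> C_diff n (\<lambda>x. f x * g x)"
proof (induction n arbitrary: f g)
  case 0
  then show ?case by (auto intro: continuous_intros)
next
  case (Suc n)
  have eq: "pd b (\<lambda>x. f x * g x) = (\<lambda>x. f x * pd b g x + pd b f x * g x)" for b
    using Suc.prems by (auto simp: pd_mult)
  have "C_diff n f" "C_diff n g"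
    using Suc.prems C_diff_Suc_imp by blast+
  then have "C_diff n (\<lambda>x. f x * pd b g x + pd b f x * g x)" if "b \<in> Basis" for b
    using Suc that by (intro C_diff_add) auto
  then show ?case using Suc.prems eq by (auto intro: derivative_intros)
qed

lemma smooth_add: "smooth f \<Longrightarrow> smooth g \<Longrightarrow> smooth (\<lambda>x. f x + g x)"
  by (simp add: smooth_def C_diff_add)

lemma smooth_mult:
  fixes f g :: "'a::euclidean_space \<Rightarrow> 'b::real_normed_algebra"
  shows "smooth f \<Longrightarrow> smooth g \<Longrightarrow> smooth (\<lambda>x. f x * g x)"
  by (simp add: smooth_def C_diff_mult)

lemma smooth_const [simp, intro]: "smooth (\<lambda>x::'a::euclidean_space. c::'b::real_normed_vector)"
proof -
  have "C_diff n (\<lambda>x::'a. c)" for n and c :: 'b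
    by (induction n arbitrary: c) auto
  then show ?thesis by (simp add: smooth_def)
qed

lemma smooth_cmult:
  fixes c :: "'b::real_normed_algebra" shows "smooth f \<Longrightarrow> smooth (\<lambda>x. c * f x)"
  by (rule smooth_mult) auto

lemma smooth_bounded_linear:
  assumes "bounded_linear f" shows "smooth f"
proof (rule smoothI_pd)
  show "f differentiable (at x)" for x
    using assms bounded_linear_imp_differentiable by blast
  have "pd b f = (\<lambda>x. f b)" for b
    using bounded_linear_imp_has_derivative[OF assms] by (auto simp: pd_eqI)
  then show "smooth (pd b f)" for b by simp
qed

lemma smooth_power:
  fixes f :: "'a::euclidean_space \<Rightarrow> 'b::real_normed_algebra_1"
  shows "smooth f \<Longrightarrow> smooth (\<lambda>x. f x ^ n)"
  by (induction n) (auto intro: smooth_mult)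

text \<open>The module generated by \<open>S\<close> over the ring of smooth functions. It holds the
  derivatives of a family that is closed under differentiation up to smooth coefficients.\<close>

inductive_set smooth_span :: "('a::euclidean_space \<Rightarrow> complex) set \<Rightarrow> ('a \<Rightarrow> complex) set"
  for S where
  base: "f \<in> S \<Longrightarrow> f \<in> smooth_span S"
| add: "f \<in> smooth_span S \<Longrightarrow> g \<in> smooth_span S \<Longrightarrow> (\<lambda>x. f x + g x) \<in> smooth_span S"
| mult: "smooth h \<Longrightarrow> f \<in> smooth_span S \<Longrightarrow> (\<lambda>x. h x * f x) \<in> smooth_span S"

text \<open>No higher derivative has to be computed: by induction on \<open>n\<close>, once all
  members of \<open>S\<close> are \<open>C_diff n\<close>, so is the whole span, and this contains
  their first derivatives. The lemma yields the smoothness of powers of \<open>1 / r\<close>, of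
  pullbacks, of modes and of cutoffs.\<close>

lemma smooth_coinduct:
  assumes "f \<in> S"
    and diff: "\<And>f x. f \<in> S \<Longrightarrow> f differentiable (at x)"
    and pd: "\<And>f b. f \<in> S \<Longrightarrow> b \<in> Basis \<Longrightarrow> pd b f \<in> smooth_span S"
  shows "smooth f"
proof -
  have "\<forall>f\<in>S. C_diff n f" for n
  proof (induction n)
    case 0
    show ?case using diff
      by (auto intro!: continuous_at_imp_continuous_on differentiable_imp_continuous_within)
  next
    case (Suc n)
    have "C_diff n f" if "f \<in> smooth_span S" for f
      using that Suc by induction (auto intro: C_diff_add C_diff_mult simp: smooth_def)
    with diff pd show ?case by auto
  qed
  with \<open>f \<in> S\<close> show ?thesis by (simp add: smooth_def)
qed

lemma smooth_span_uminus: "f \<in> smooth_span S \<Longrightarrow> (\<lambda>x. - f x) \<in> smooth_span S"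
  using smooth_span.mult[of "\<lambda>x. -1" f S] by simp

lemma smooth_span_diff:
  "f \<in> smooth_span S \<Longrightarrow> g \<in> smooth_span S \<Longrightarrow> (\<lambda>x. f x - g x) \<in> smooth_span S"
  using smooth_span.add[of f S "\<lambda>x. - g x"] smooth_span_uminus by auto

lemma smooth_span_cmult: "f \<in> smooth_span S \<Longrightarrow> (\<lambda>x. c * f x) \<in> smooth_span S"
  using smooth_span.mult[of "\<lambda>x. c"] by auto

section \<open>Directional derivatives and their symmetry\<close>

lemma pd_Basis_sum:
  assumes "smooth f"
  shows "pd v f = (\<lambda>x. \<Sum>b\<in>Basis. (v \<bullet> b) *\<^sub>R pd b f x)"
proof
  fix x
  have "linear (frechet_derivative f (at x))"
    using assms by (simp add: linear_frechet_derivative smooth_differentiable)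
  then show "pd v f x = (\<Sum>b\<in>Basis. (v \<bullet> b) *\<^sub>R pd b f x)"
    by (subst (1) euclidean_representation[of v, symmetric]) (simp only: linear_sum linear_scale)
qed

lemma pd_linear: 
  assumes "smooth f"
  shows "linear (\<lambda>v. pd v f x)"
  using assms by (simp add: linear_frechet_derivative smooth_differentiable)

lemma smooth_sum: "finite I \<Longrightarrow> (\<And>i. i \<in> I \<Longrightarrow> smooth (f i)) \<Longrightarrow> smooth (\<lambda>x. \<Sum>i\<in>I. f i x)"
  by (induction I rule: finite_induct) (auto intro: smooth_add)

lemma smooth_pd:
  fixes f :: "'a::euclidean_space \<Rightarrow> complex"
  assumes "smooth f" shows "smooth (pd v f)"
  unfolding pd_Basis_sum[OF assms] scaleR_conv_of_real
  using assms by (intro smooth_sum smooth_cmult smooth_pd_Basis) auto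

text \<open>This allows \<open>dderiv ex\<close> and \<open>dderiv ey\<close> to be handled as
  commuting variables of a polynomial.\<close>

lemma pd_commute:
  fixes f :: "'a::euclidean_space \<Rightarrow> complex"
  assumes f: "smooth f"
  shows "pd a (pd b f) = pd b (pd a f)"
proof
  fix x
  have cont: "continuous_on UNIV (pd a (pd b f))"
    by (intro smooth_continuous smooth_pd f)
  have line: "((\<lambda>s. g (y + s *\<^sub>R v)) has_vector_derivative pd v g (y + s *\<^sub>R v)) (at s within A)"
    if "smooth g" for g :: "'a \<Rightarrow> complex" and y v s A
  proof -
    have "((\<lambda>s. y + s *\<^sub>R v) has_derivative (\<lambda>h. h *\<^sub>R v)) (at s within A)"
      by (auto intro!: derivative_eq_intros)
    moreover have "(g has_derivative frechet_derivative g (at (y + s *\<^sub>R v))) (at (y + s *\<^sub>R v) within X)" for X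
      using smooth_has_derivative[OF that] has_derivative_at_withinI by blast
    ultimately have "((\<lambda>s. g (y + s *\<^sub>R v)) has_derivative (\<lambda>h. pd (h *\<^sub>R v) g (y + s *\<^sub>R v))) (at s within A)"
      using has_derivative_compose by blast
    then show ?thesis
      unfolding has_vector_derivative_def
      using linear_scale[OF pd_linear[OF that]] by simp
  qed
  define F where "F s t = pd a (pd b f) (x + s *\<^sub>R a + t *\<^sub>R b)" for s t :: real
  \<comment> \<open>The fundamental theorem along \<open>b\<close>, applied at the base point
    \<open>x + s *\<^sub>R a\<close>, is differentiated in \<open>s\<close> under the integral
    sign.\<close>
  have pF: "pd a f (x + t *\<^sub>R b) - pd a f x = integral {0..t} (F 0)" if "t \<in> {0..1}" for t
  proof -
    have I: "integral (cbox 0 t) (\<lambda>\<tau>. pd b f ((x + s *\<^sub>R a) + \<tau> *\<^sub>R b))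
        = f ((x + s *\<^sub>R a) + t *\<^sub>R b) - f ((x + s *\<^sub>R a) + 0 *\<^sub>R b)" for s
      unfolding cbox_interval using that
      by (intro integral_unique fundamental_theorem_of_calculus line f) auto
    have "((\<lambda>s. integral (cbox 0 t) (\<lambda>\<tau>. pd b f ((x + s *\<^sub>R a) + \<tau> *\<^sub>R b)))
       has_vector_derivative integral (cbox 0 t) (F 0)) (at 0 within UNIV)"
    proof (rule leibniz_rule_vector_derivative)
      show "((\<lambda>s. pd b f (x + s *\<^sub>R a + \<tau> *\<^sub>R b)) has_vector_derivative F s \<tau>) (at s within UNIV)" for s \<tau>
      proof -
        have eq: "x + \<tau> *\<^sub>R b + s *\<^sub>R a = x + s *\<^sub>R a + \<tau> *\<^sub>R b" for s
          by (simp add: algebra_simps)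
        show ?thesis
          using line[OF smooth_pd[OF f, of b], where y = "x + \<tau> *\<^sub>R b" and v = a and s = s and A = UNIV]
          unfolding F_def eq .
      qed
      show "(\<lambda>\<tau>. pd b f (x + s *\<^sub>R a + \<tau> *\<^sub>R b)) integrable_on cbox 0 t" for s
        by (intro integrable_continuous continuous_on_compose2[OF smooth_continuous[OF smooth_pd[OF f]]]
              continuous_intros) auto
      show "continuous_on (UNIV \<times> cbox 0 t) (\<lambda>(s, t). F s t)"
        unfolding F_def case_prod_beta
        by (intro continuous_on_compose2[OF cont] continuous_intros) auto
    qed auto
    moreover have "((\<lambda>s. integral (cbox 0 t) (\<lambda>\<tau>. pd b f ((x + s *\<^sub>R a) + \<tau> *\<^sub>R b)))
       has_vector_derivative (pd a f ((x + t *\<^sub>R b) + 0 *\<^sub>R a) - pd a f (x + 0 *\<^sub>R a))) (at 0)"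
    proof -
      have eq: "f (x + s *\<^sub>R a + t *\<^sub>R b) - f (x + s *\<^sub>R a + 0 *\<^sub>R b)
          = f ((x + t *\<^sub>R b) + s *\<^sub>R a) - f (x + s *\<^sub>R a)" for s
        by (simp add: algebra_simps)
      show ?thesis unfolding I eq by (intro has_vector_derivative_diff line f)
    qed
    ultimately show ?thesis
      using vector_derivative_unique_at by (fastforce simp: cbox_interval)
  qed
  \<comment> \<open>Both sides of \<open>pF\<close> are differentiated at \<open>t = 0\<close>. The
    formula is known only on \<open>{0..1}\<close>, hence the one-sided derivative.\<close>
  have "((\<lambda>t. integral {0..t} (F 0)) has_vector_derivative F 0 0) (at 0 within {0..1})"
    unfolding F_def
    by (intro integral_has_vector_derivative continuous_on_compose2[OF cont] continuous_intros) auto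
  then have 1: "((\<lambda>t. pd a f (x + t *\<^sub>R b) - pd a f x) has_vector_derivative F 0 0) (at 0 within {0..1})"
    by (rule has_vector_derivative_transform[rotated 2]) (use pF in auto)
  have 2: "((\<lambda>t. pd a f (x + t *\<^sub>R b) - pd a f x) has_vector_derivative pd b (pd a f) (x + 0 *\<^sub>R b)) (at 0 within {0..1})"
    using line[OF smooth_pd[OF f, of a], where y = x and v = b and s = 0 and A = "{0..1}"] by (auto intro!: derivative_eq_intros)
  have "F 0 0 = pd b (pd a f) (x + 0 *\<^sub>R b)"
    by (rule vector_derivative_unique_within[OF _ 1 2]) (auto simp: at_within_Icc_at_right)
  then show "pd a (pd b f) x = pd b (pd a f) x" by (simp add: F_def)
qed

section \<open>Test functions\<close>

lemma test_fun_smooth: "\<phi> \<in> test_fun U \<Longrightarrow> smooth \<phi>"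
  by (simp add: test_fun_def)

lemma test_funI_subset:
  assumes "\<phi> \<in> test_fun U" "smooth \<psi>" "\<And>x. \<phi> x = 0 \<Longrightarrow> \<psi> x = 0" 
  shows "\<psi> \<in> test_fun U"
proof -
  have "closure {x. \<psi> x \<noteq> 0} \<subseteq> closure {x. \<phi> x \<noteq> 0}"
    using assms(3) by (intro closure_mono) auto
  then show ?thesis using assms(1,2) unfolding test_fun_def compact_eq_bounded_closed
    using bounded_subset by auto
qed

lemma test_funI_closed:
  assumes "smooth \<psi>" "compact K" "K \<subseteq> U" "\<And>x. x \<notin> K \<Longrightarrow> \<psi> x = 0" 
  shows "\<psi> \<in> test_fun U"
proof -
  have "closure {x. \<psi> x \<noteq> 0} \<subseteq> K"
    using assms(2,4) by (intro closure_minimal) (auto intro: compact_imp_closed)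
  then show ?thesis using assms(1-3) unfolding test_fun_def compact_eq_bounded_closed
    using bounded_subset by auto
qed

lemma test_funE:
  assumes "\<phi> \<in> test_fun U"
  obtains K where "compact K" "K \<subseteq> U" "\<And>x. x \<notin> K \<Longrightarrow> \<phi> x = 0"
proof
  show "compact (closure {x. \<phi> x \<noteq> 0})" "closure {x. \<phi> x \<noteq> 0} \<subseteq> U"
    using assms by (auto simp: test_fun_def)
  show "\<phi> x = 0" if "x \<notin> closure {x. \<phi> x \<noteq> 0}" for x
    using that closure_subset[of "{x. \<phi> x \<noteq> 0}"] by auto
qed

lemma test_fun_zero_outside: "\<phi> \<in> test_fun U \<Longrightarrow> x \<notin> U \<Longrightarrow> \<phi> x = 0"
  by (meson subset_iff test_funE)

lemma test_fun_add: "\<phi> \<in> test_fun U \<Longrightarrow> \<psi> \<in> test_fun U \<Longrightarrow> (\<lambda>x. \<phi> x + \<psi> x) \<in> test_fun U"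
proof -
  assume a: "\<phi> \<in> test_fun U" "\<psi> \<in> test_fun U"
  obtain K where K: "compact K" "K \<subseteq> U" "\<And>x. x \<notin> K \<Longrightarrow> \<phi> x = 0" using test_funE[OF a(1)] by metis
  obtain L where L: "compact L" "L \<subseteq> U" "\<And>x. x \<notin> L \<Longrightarrow> \<psi> x = 0" using test_funE[OF a(2)] by metis
  show ?thesis
    using a K L by (intro test_funI_closed[of _ "K \<union> L"] smooth_add) (auto simp: test_fun_smooth)
qed

lemma test_fun_smult: "smooth h \<Longrightarrow> \<phi> \<in> test_fun U \<Longrightarrow> (\<lambda>x. h x * \<phi> x) \<in> test_fun U"
  by (rule test_funI_subset[of \<phi>]) (auto intro: smooth_mult test_fun_smooth)

lemma test_fun_cmult: "\<phi> \<in> test_fun U \<Longrightarrow> (\<lambda>x. c * \<phi> x) \<in> test_fun U"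
  by (rule test_fun_smult) auto

lemma test_fun_mono: "\<phi> \<in> test_fun U \<Longrightarrow> U \<subseteq> V \<Longrightarrow> \<phi> \<in> test_fun V"
  by (auto simp: test_fun_def)

lemma pd_zero_off_compact:
  assumes "compact K" "\<And>x. x \<notin> K \<Longrightarrow> \<phi> x = 0" "x \<notin> K"
  shows "pd v \<phi> x = 0"
proof -
  have "(\<phi> has_derivative (\<lambda>h. 0)) (at x)"
    using assms by (intro has_derivative_transform_within_open[OF has_derivative_const[of 0], of "- K"])
      (auto simp: compact_imp_closed open_Compl)
  then show ?thesis by (simp add: pd_eqI)
qed

lemma test_fun_pd: "\<phi> \<in> test_fun U \<Longrightarrow> pd v \<phi> \<in> test_fun U"
  by (rule test_funE, assumption, rule test_funI_closed)
     (auto intro: smooth_pd test_fun_smooth pd_zero_off_compact)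

section \<open>Borel representatives and polar coordinates\<close>

definition wnorm :: "('a::euclidean_space \<Rightarrow> real) \<Rightarrow> ('a \<Rightarrow> complex) \<Rightarrow> ennreal" where
  "wnorm \<omega> f = (\<integral>\<^sup>+x. ennreal (\<omega> x * (cmod (f x))\<^sup>2) \<partial>lborel)"

text \<open>Fubini and polar coordinates are used for Borel functions on the whole space, whereas
  the seminorms speak of Lebesgue measurable functions on \<open>U\<close>. Representatives are
  therefore taken Borel and extended by zero.\<close>

definition borel_rep ::
    "('a::euclidean_space \<Rightarrow> real) \<Rightarrow> 'a set \<Rightarrow> 'a distr \<Rightarrow> ('a \<Rightarrow> complex) \<Rightarrow> bool" where
  "borel_rep \<omega> U T f \<longleftrightarrow> f \<in> borel_measurable borel \<and> (\<forall>x. x \<notin> U \<longrightarrow> f x = 0) \<and>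
     wnorm \<omega> f < \<infinity> \<and> (\<forall>\<phi>\<in>test_fun U. T \<phi> = (LINT x|lborel. f x * \<phi> x))"

lemma borel_version:
  fixes f :: "'a::euclidean_space \<Rightarrow> complex"
  assumes f: "f \<in> borel_measurable (lebesgue_on U)" and U: "U \<in> sets borel"
  obtains g where "g \<in> borel_measurable borel" "\<And>x. x \<notin> U \<Longrightarrow> g x = 0"
    "AE x in lborel. x \<in> U \<longrightarrow> g x = f x"
proof -
  have "(\<lambda>x. if x \<in> U then f x else 0) \<in> borel_measurable lebesgue"
    using f U by (subst borel_measurable_if) auto
  then have m: "(\<lambda>x. Re (if x \<in> U then f x else 0)) \<in> borel_measurable lebesgue"
      "(\<lambda>x. Im (if x \<in> U then f x else 0)) \<in> borel_measurable lebesgue"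
    by measurable
  obtain a b :: "'a \<Rightarrow> real" where a: "a \<in> borel_measurable lborel" "b \<in> borel_measurable lborel"
    and ab: "AE x in lborel. Re (if x \<in> U then f x else 0) = a x"
      "AE x in lborel. Im (if x \<in> U then f x else 0) = b x"
    using completion_ex_borel_measurable_real[OF m(1)] completion_ex_borel_measurable_real[OF m(2)]
    by blast
  define g where "g x = (if x \<in> U then Complex (a x) (b x) else 0)" for x
  show ?thesis
  proof
    have [measurable]: "a \<in> borel_measurable borel" "b \<in> borel_measurable borel" "U \<in> sets borel"
      using a U by auto
    show "g \<in> borel_measurable borel"
      unfolding g_def Complex_eq by measurable
    show "AE x in lborel. x \<in> U \<longrightarrow> g x = f x"
      using ab by eventually_elim (auto simp: g_def complex_eq_iff)
  qed (simp add: g_def)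
qed

lemma L2norm_sq_version:
  assumes "\<And>x. x \<notin> U \<Longrightarrow> g x = 0" "AE x in lborel. x \<in> U \<longrightarrow> g x = f x"
  shows "L2norm_sq \<omega> U f = wnorm \<omega> g"
  unfolding L2norm_sq_def wnorm_def nn_integral_completion
  using assms(2)
  by (intro nn_integral_cong_AE, eventually_elim) (auto simp: indicator_def assms(1))

lemma test_fun_measurable:
  "\<phi> \<in> test_fun U \<Longrightarrow> \<phi> \<in> borel_measurable borel"
  by (intro borel_measurable_continuous_onI smooth_continuous test_fun_smooth)

lemma distr_of_version:
  assumes g: "g \<in> borel_measurable borel" "\<And>x. x \<notin> U \<Longrightarrow> g x = 0"
    and ae: "AE x in lborel. x \<in> U \<longrightarrow> g x = f x" and phi: "\<phi> \<in> borel_measurable borel"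
  shows "distr_of U f \<phi> = (LINT x|lborel. g x * \<phi> x)"
proof -
  have eq: "AE x in lebesgue. g x * \<phi> x = indicator U x *\<^sub>R (f x * \<phi> x)"
    unfolding AE_completion_iff using ae
    by eventually_elim (metis g(2) indicator_simps mult_zero_left scaleR_one scaleR_zero_left)
  have m: "(\<lambda>x. g x * \<phi> x) \<in> borel_measurable lebesgue"
    using g(1) phi by (intro measurable_completion) simp
  have "(\<lambda>x. indicator U x *\<^sub>R (f x * \<phi> x)) \<in> borel_measurable lebesgue"
    by (rule borel_measurable_AE[OF m eq])
  then have "distr_of U f \<phi> = (LINT x|lebesgue. g x * \<phi> x)"
    unfolding distr_of_def set_lebesgue_integral_def
    using eq m by (intro integral_cong_AE) auto
  also have "\<dots> = (LINT x|lborel. g x * \<phi> x)"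
    using g(1) phi by (intro integral_completion) simp
  finally show ?thesis .
qed

text \<open>Together with \<open>distr_L2norm_sq_ge\<close> this turns the infimum over Lebesgue
  measurable representatives into one over Borel representatives.\<close>

lemma distr_L2norm_sq_le:
  assumes "borel_rep \<omega> U T f" "U \<in> sets borel"
  shows "distr_L2norm_sq \<omega> U T \<le> wnorm \<omega> f"
proof -
  have f: "f \<in> borel_measurable borel" "\<And>x. x \<notin> U \<Longrightarrow> f x = 0" "wnorm \<omega> f < \<infinity>"
    using assms by (auto simp: borel_rep_def)
  have n: "L2norm_sq \<omega> U f = wnorm \<omega> f"
    using f by (intro L2norm_sq_version) auto
  have "f \<in> L2_space \<omega> U"
    using f n by (auto simp: L2_space_def intro!: measurable_restrict_space1 measurable_completion)
  moreover have "T \<phi> = distr_of U f \<phi>" if "\<phi> \<in> test_fun U" for \<phi>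
    using assms that f by (subst distr_of_version[of f]) (auto simp: borel_rep_def test_fun_measurable)
  ultimately show ?thesis
    unfolding distr_L2norm_sq_def n[symmetric] by (intro INF_lower) auto
qed

lemma distr_L2norm_sq_ge:
  assumes "\<And>f. borel_rep \<omega> U T f \<Longrightarrow> c \<le> wnorm \<omega> f" "U \<in> sets borel"
  shows "c \<le> distr_L2norm_sq \<omega> U T"
  unfolding distr_L2norm_sq_def
proof (rule INF_greatest, safe)
  fix f assume f: "f \<in> L2_space \<omega> U" "\<forall>\<phi>\<in>test_fun U. T \<phi> = distr_of U f \<phi>"
  then obtain g where g: "g \<in> borel_measurable borel" "\<And>x. x \<notin> U \<Longrightarrow> g x = 0"
      "AE x in lborel. x \<in> U \<longrightarrow> g x = f x"
    by (auto simp: L2_space_def intro: borel_version[OF _ assms(2), of f])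
  have "borel_rep \<omega> U T g"
    using f g L2norm_sq_version[OF g(2,3)] unfolding borel_rep_def
    by (auto simp: L2_space_def distr_of_version[OF g] test_fun_measurable)
  then show "c \<le> L2norm_sq \<omega> U f"
    using assms(1) L2norm_sq_version[OF g(2,3)] by simp
qed

section \<open>Rotations and polar coordinates in the plane\<close>

lemma nn_integral_shear:
  fixes f :: "real \<times> real \<Rightarrow> ennreal"
  assumes f[measurable]: "f \<in> borel_measurable borel"
  shows "(\<integral>\<^sup>+(x, y). f (x + a * y, y) \<partial>lborel) = integral\<^sup>N lborel f"
    and "(\<integral>\<^sup>+(x, y). f (x, y + a * x) \<partial>lborel) = integral\<^sup>N lborel f"
proof -
  have [measurable]: "f \<in> borel_measurable (lborel \<Otimes>\<^sub>M lborel)"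
    unfolding lborel_prod by simp
  have 1: "(\<lambda>(x, y). f (x + a * y, y)) \<in> borel_measurable (lborel \<Otimes>\<^sub>M lborel)"
    by measurable
  have "(\<integral>\<^sup>+(x, y). f (x + a * y, y) \<partial>lborel) = (\<integral>\<^sup>+y. \<integral>\<^sup>+x. f (x + a * y, y) \<partial>lborel \<partial>lborel)"
    using lborel_pair.nn_integral_snd[OF 1] by (simp add: lborel_prod)
  also have "\<dots> = (\<integral>\<^sup>+y. \<integral>\<^sup>+x. f (x, y) \<partial>lborel \<partial>lborel)"
    using nn_integral_real_affine[of "\<lambda>x. f (x, y)" 1 "a * y" for y] by (simp add: add_ac)
  also have "\<dots> = integral\<^sup>N lborel f"
    using lborel_pair.nn_integral_snd[of f] by (simp add: lborel_prod)
  finally show "(\<integral>\<^sup>+(x, y). f (x + a * y, y) \<partial>lborel) = integral\<^sup>N lborel f" .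
  have 1: "(\<lambda>(x, y). f (x, y + a * x)) \<in> borel_measurable (lborel \<Otimes>\<^sub>M lborel)"
    by measurable
  have "(\<integral>\<^sup>+(x, y). f (x, y + a * x) \<partial>lborel) = (\<integral>\<^sup>+x. \<integral>\<^sup>+y. f (x, y + a * x) \<partial>lborel \<partial>lborel)"
    using lborel.nn_integral_fst[OF 1] by (simp add: lborel_prod)
  also have "\<dots> = (\<integral>\<^sup>+x. \<integral>\<^sup>+y. f (x, y) \<partial>lborel \<partial>lborel)"
    using nn_integral_real_affine[of "\<lambda>y. f (x, y)" 1 "a * x" for x] by (simp add: add_ac)
  also have "\<dots> = integral\<^sup>N lborel f"
    using lborel.nn_integral_fst[of f lborel] by (simp add: lborel_prod)
  finally show "(\<integral>\<^sup>+(x, y). f (x, y + a * x) \<partial>lborel) = integral\<^sup>N lborel f" .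
qed

text \<open>A rotation by an angle other than \<open>\<pi>\<close> is a product of three shears.\<close>

lemma nn_integral_rotation:
  fixes f :: "real \<times> real \<Rightarrow> ennreal"
  assumes f[measurable]: "f \<in> borel_measurable borel" and t: "cos (t / 2) \<noteq> 0"
  shows "(\<integral>\<^sup>+(x, y). f (x * cos t - y * sin t, x * sin t + y * cos t) \<partial>lborel) = integral\<^sup>N lborel f"
proof -
  \<comment> \<open>The shears are by \<open>a\<close> along \<open>x\<close>, by
    \<open>sin t\<close> along \<open>y\<close>, and again by \<open>a\<close> along
    \<open>x\<close>. The half-angle identities \<open>c'\<close> and \<open>s'\<close> say that
    their product is the rotation by \<open>t\<close>.\<close>
  define a where "a = - tan (t / 2)"
  have s: "sin t = 2 * sin (t / 2) * cos (t / 2)" and c: "cos t = 1 - 2 * (sin (t / 2))\<^sup>2"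
    using sin_double[of "t / 2"] cos_double_sin[of "t / 2"] by auto
  have c': "cos t = 1 + a * sin t"
    using t unfolding s c a_def tan_def by (simp add: power2_eq_square)
  have s': "a + a * cos t = - sin t"
  proof -
    have "1 + cos t = 2 * (cos (t / 2))\<^sup>2" using cos_double_cos[of "t / 2"] by simp
    then have "a * (1 + cos t) = - sin t"
      using t unfolding s a_def tan_def by (simp add: power2_eq_square)
    then show ?thesis by (simp add: algebra_simps)
  qed
  define g where "g = (\<lambda>(x, y). f (x + a * y, y))"
  define h where "h = (\<lambda>(x, y). g (x, y + sin t * x))"
  have [measurable]: "g \<in> borel_measurable borel"
    unfolding g_def borel_prod[symmetric] by (measurable; simp add: borel_prod)
  have [measurable]: "h \<in> borel_measurable borel"
    unfolding h_def borel_prod[symmetric] by (measurable; simp add: borel_prod)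
  have "f (x * cos t - y * sin t, x * sin t + y * cos t) = h (x + a * y, y)" for x y
  proof -
    have *: "y + sin t * (x + a * y) = x * sin t + y * cos t"
      unfolding c' by (simp add: algebra_simps)
    have "x + a * y + a * (x * sin t + y * cos t) = x * (1 + a * sin t) + y * (a + a * cos t)"
      by (simp add: algebra_simps)
    then have "x + a * y + a * (x * sin t + y * cos t) = x * cos t - y * sin t"
      unfolding c'[symmetric] s' by simp
    with * show ?thesis by (simp add: g_def h_def)
  qed
  then have "(\<integral>\<^sup>+(x, y). f (x * cos t - y * sin t, x * sin t + y * cos t) \<partial>lborel) = (\<integral>\<^sup>+(x, y). h (x + a * y, y) \<partial>lborel)"
    by simp
  also have "\<dots> = integral\<^sup>N lborel h" by (rule nn_integral_shear) simp
  also have "\<dots> = integral\<^sup>N lborel g"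
    unfolding h_def by (rule nn_integral_shear) simp
  also have "\<dots> = integral\<^sup>N lborel f"
    unfolding g_def by (rule nn_integral_shear) simp
  finally show ?thesis .
qed

text \<open>Both sides integrate \<open>F\<close> against a measure on the line. The two measures
  agree on half-lines, because a disc of radius \<open>a\<close> has area
  \<open>pi * a\<^sup>2\<close>, and half-lines form a generator stable under intersection.\<close>

lemma nn_integral_radial:
  fixes F :: "real \<Rightarrow> ennreal"
  assumes F[measurable]: "F \<in> borel_measurable borel"
  shows "(\<integral>\<^sup>+x. F (norm (x :: real \<times> real)) \<partial>lborel)
    = (\<integral>\<^sup>+r. ennreal (2 * pi * r) * indicator {0..} r * F r \<partial>lborel)"
proof -
  define M where "M = distr (lborel :: (real \<times> real) measure) borel norm"
  define N where "N = density lborel (\<lambda>r. ennreal (2 * pi * r) * indicator {0..} r)"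
  have M: "emeasure M {..a} = ennreal (if a < 0 then 0 else pi * a\<^sup>2)" for a
  proof -
    have "norm -` {..a} \<inter> space lborel = (cball 0 a :: (real \<times> real) set)"
      by (auto simp: mem_cball_0 simp del: norm_Pair)
    then show ?thesis
      by (simp add: M_def emeasure_distr emeasure_cball unit_ball_vol_2 numeral_2_eq_2)
  qed
  have N: "emeasure N {..a} = ennreal (if a < 0 then 0 else pi * a\<^sup>2)" for a
  proof -
    have "emeasure N {..a} = (\<integral>\<^sup>+r. ennreal (2 * pi * r) * indicator {0..a} r \<partial>lborel)"
      unfolding N_def by (subst emeasure_density) (auto intro!: nn_integral_cong simp: indicator_def)
    also have "\<dots> = ennreal (if a < 0 then 0 else pi * a\<^sup>2)"
    proof (cases "a < 0")
      case False
      have "(\<integral>\<^sup>+r. ennreal (2 * pi * r) * indicator {0..a} r \<partial>lborel) = ennreal (pi * a\<^sup>2 - pi * 0\<^sup>2)"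
        using False by (intro nn_integral_FTC_Icc) (auto intro!: derivative_eq_intros)
      then show ?thesis using False by simp
    qed simp
    finally show ?thesis .
  qed
  have "M = N"
  proof (rule measure_eqI_generator_eq[where E = "range atMost" and A = "\<lambda>i. {..real i}" and \<Omega> = UNIV])
    show "Int_stable (range (atMost :: real \<Rightarrow> real set))"
      by (auto simp: Int_stable_def)
    show "sets M = sigma_sets UNIV (range atMost)" "sets N = sigma_sets UNIV (range atMost)"
      by (auto simp: M_def N_def borel_eq_atMost)
    show "(\<Union>i. {..real i}) = UNIV"
      using real_arch_simple by auto
    show "emeasure M {..real i} \<noteq> \<infinity>" for i
      by (simp add: M)
    show "emeasure M X = emeasure N X" if "X \<in> range atMost" for X
      using that M N by auto
  qed auto
  have "(\<integral>\<^sup>+x. F (norm (x :: real \<times> real)) \<partial>lborel) = integral\<^sup>N M F"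
    unfolding M_def by (subst nn_integral_distr) auto
  also have "\<dots> = (\<integral>\<^sup>+r. ennreal (2 * pi * r) * indicator {0..} r * F r \<partial>lborel)"
    unfolding \<open>M = N\<close> N_def by (subst nn_integral_density) auto
  finally show ?thesis .
qed

lemma nn_integral_periodic_shift:
  fixes h :: "real \<Rightarrow> ennreal"
  assumes h[measurable]: "h \<in> borel_measurable borel" and per: "\<And>t. h (t + 2 * pi) = h t"
    and s: "0 \<le> s" "s < 2 * pi"
  shows "(\<integral>\<^sup>+t. indicator {0..2 * pi} t * h (t + s) \<partial>lborel) = (\<integral>\<^sup>+t. indicator {0..2 * pi} t * h t \<partial>lborel)"
proof -
  have "(\<integral>\<^sup>+t. indicator {0..2 * pi} t * h (t + s) \<partial>lborel) = (\<integral>\<^sup>+t. indicator {s..s + 2 * pi} t * h t \<partial>lborel)"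
    using nn_integral_real_affine[of "\<lambda>t. indicator {s..s + 2 * pi} t * h t" 1 s]
    by (auto intro!: nn_integral_cong simp: indicator_def add_ac)
  also have "\<dots> = (\<integral>\<^sup>+t. indicator {s..2 * pi} t * h t + indicator {2 * pi<..2 * pi + s} t * h t \<partial>lborel)"
    using s by (intro nn_integral_cong) (auto simp: indicator_def)
  also have "\<dots> = (\<integral>\<^sup>+t. indicator {s..2 * pi} t * h t \<partial>lborel) + (\<integral>\<^sup>+t. indicator {2 * pi<..2 * pi + s} t * h t \<partial>lborel)"
    by (intro nn_integral_add) auto
  also have "(\<integral>\<^sup>+t. indicator {2 * pi<..2 * pi + s} t * h t \<partial>lborel) = (\<integral>\<^sup>+t. indicator {0<..s} t * h t \<partial>lborel)"
    using nn_integral_real_affine[of "\<lambda>t. indicator {2 * pi<..2 * pi + s} t * h t" 1 "2 * pi"] per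
    by (auto intro!: nn_integral_cong simp: indicator_def add_ac)
  also have "(\<integral>\<^sup>+t. indicator {s..2 * pi} t * h t \<partial>lborel) + (\<integral>\<^sup>+t. indicator {0<..s} t * h t \<partial>lborel)
     = (\<integral>\<^sup>+t. indicator {s..2 * pi} t * h t + indicator {0<..s} t * h t \<partial>lborel)"
    by (intro nn_integral_add[symmetric]) auto
  also have "\<dots> = (\<integral>\<^sup>+t. indicator {0..2 * pi} t * h t \<partial>lborel)"
    using AE_lborel_singleton[of 0] AE_lborel_singleton[of s]
    by (intro nn_integral_cong_AE, eventually_elim) (use s in \<open>auto simp: indicator_def\<close>)
  finally show ?thesis .
qed

text \<open>By rotation invariance, averaging \<open>f\<close> over all rotations preserves its
  integral. The average is a radial function, so the radial formula applies to it.\<close>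

lemma nn_integral_polar:
  fixes f :: "real \<times> real \<Rightarrow> ennreal"
  assumes f[measurable]: "f \<in> borel_measurable borel"
  shows "integral\<^sup>N lborel f = (\<integral>\<^sup>+r. \<integral>\<^sup>+t. ennreal r * indicator {0<..} r * indicator {0..2 * pi} t
      * f (r * cos t, r * sin t) \<partial>lborel \<partial>lborel)"
proof -
  have [measurable]: "f \<in> borel_measurable (borel \<Otimes>\<^sub>M borel)"
    unfolding borel_prod by simp
  define R :: "real \<times> real \<Rightarrow> real \<Rightarrow> real \<times> real" where
    "R z t = (fst z * cos t - snd z * sin t, fst z * sin t + snd z * cos t)" for z t
  define G where "G r = (\<integral>\<^sup>+t. indicator {0..2 * pi} t * f (r * cos t, r * sin t) \<partial>lborel)" for r
  have fst_m: "(fst :: real \<times> real \<Rightarrow> real) \<in> borel_measurable borel" "(snd :: real \<times> real \<Rightarrow> real) \<in> borel_measurable borel"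
    by (auto intro!: borel_measurable_continuous_onI continuous_intros)
  note [measurable] = measurable_compose[OF measurable_fst fst_m(1)] measurable_compose[OF measurable_fst fst_m(2)]
  have Rm: "(\<lambda>(z, t). indicator {0..2 * pi} t * f (R z t)) \<in> borel_measurable ((lborel :: (real \<times> real) measure) \<Otimes>\<^sub>M (lborel :: real measure))"
    unfolding R_def case_prod_beta by measurable
  have Gm[measurable]: "G \<in> borel_measurable borel"
    unfolding G_def by measurable
  \<comment> \<open>In polar form the rotation of \<open>z\<close> is a shift of the angle, which an
    integral over a full period does not see.\<close>
  have circle: "(\<integral>\<^sup>+t. indicator {0..2 * pi} t * f (R z t) \<partial>lborel) = G (norm z)" for z
  proof -
    obtain x y where z: "z = (x, y)" by force
    define r where "r = norm z"
    have r: "r = sqrt (x\<^sup>2 + y\<^sup>2)" by (simp add: r_def z norm_Pair)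
    obtain s where s: "0 \<le> s" "s < 2 * pi" "x = r * cos s" "y = r * sin s"
    proof (cases "r = 0")
      case True
      then show ?thesis using that[of 0] by (simp add: r sum_power2_eq_zero_iff)
    next
      case False
      have "r\<^sup>2 = x\<^sup>2 + y\<^sup>2" "x\<^sup>2 + y\<^sup>2 \<noteq> 0"
        using False by (auto simp: r simp del: sum_power2_eq_zero_iff)
      then have "(x / r)\<^sup>2 + (y / r)\<^sup>2 = 1"
        by (simp add: power_divide add_divide_distrib[symmetric])
      then obtain s where "0 \<le> s" "s < 2 * pi" "x / r = cos s" "y / r = sin s"
        using sincos_total_2pi by metis
      then show ?thesis using that[of s] False by (auto simp: field_simps)
    qed
    have "R z t = (r * cos (t + s), r * sin (t + s))" for t
      by (simp add: R_def z s(3,4) cos_add sin_add algebra_simps)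
    then have "(\<integral>\<^sup>+t. indicator {0..2 * pi} t * f (R z t) \<partial>lborel)
      = (\<integral>\<^sup>+t. indicator {0..2 * pi} t * (\<lambda>t. f (r * cos t, r * sin t)) (t + s) \<partial>lborel)"
      by simp
    also have "\<dots> = G r"
      unfolding G_def using s by (intro nn_integral_periodic_shift) auto
    finally show ?thesis by (simp add: r_def)
  qed
  \<comment> \<open>The angle \<open>pi\<close>, for which the decomposition into shears breaks
    down, is a null set.\<close>
  have ae: "AE t in lborel. indicator {0..2 * pi} t * (\<integral>\<^sup>+z. f (R z t) \<partial>lborel) = indicator {0..2 * pi} t * integral\<^sup>N lborel f"
    using AE_lborel_singleton[of pi]
  proof eventually_elim
    case (elim t)
    show ?case
    proof (cases "t \<in> {0..2 * pi}")
      case True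
      have "cos (t / 2) \<noteq> 0"
      proof
        assume "cos (t / 2) = 0"
        moreover have "cos (pi / 2) = 0" by simp
        ultimately have "t / 2 = pi / 2"
          using True cos_inj_pi[of "t / 2" "pi / 2"] by simp
        with elim show False by simp
      qed
      from nn_integral_rotation[OF f this] show ?thesis
        by (simp add: R_def case_prod_unfold)
    qed simp
  qed
  have "ennreal (2 * pi) * integral\<^sup>N lborel f = (\<integral>\<^sup>+t. indicator {0..2 * pi} t * integral\<^sup>N lborel f \<partial>lborel)"
    by (subst nn_integral_multc) auto
  also have "\<dots> = (\<integral>\<^sup>+t. indicator {0..2 * pi} t * (\<integral>\<^sup>+z. f (R z t) \<partial>lborel) \<partial>lborel)"
    by (rule nn_integral_cong_AE) (use ae in \<open>eventually_elim, simp\<close>)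
  also have "\<dots> = (\<integral>\<^sup>+t. (\<integral>\<^sup>+z. indicator {0..2 * pi} t * f (R z t) \<partial>lborel) \<partial>lborel)"
    unfolding R_def by (intro nn_integral_cong nn_integral_cmult[symmetric]) (use fst_m in measurable)
  also have "\<dots> = (\<integral>\<^sup>+z. (\<integral>\<^sup>+t. indicator {0..2 * pi} t * f (R z t) \<partial>lborel) \<partial>lborel)"
    by (rule lborel_pair.Fubini'[OF Rm])
  also have "\<dots> = (\<integral>\<^sup>+z. G (norm (z :: real \<times> real)) \<partial>lborel)"
    by (simp add: circle)
  also have "\<dots> = (\<integral>\<^sup>+r. ennreal (2 * pi * r) * indicator {0..} r * G r \<partial>lborel)"
    by (rule nn_integral_radial) simp
  also have "\<dots> = (\<integral>\<^sup>+r. ennreal (2 * pi) * (ennreal r * indicator {0<..} r * G r) \<partial>lborel)"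
    by (intro nn_integral_cong) (auto simp: indicator_def ennreal_mult' mult_ac)
  also have "\<dots> = ennreal (2 * pi) * (\<integral>\<^sup>+r. ennreal r * indicator {0<..} r * G r \<partial>lborel)"
    by (intro nn_integral_cmult) auto
  finally have "integral\<^sup>N lborel f = (\<integral>\<^sup>+r. ennreal r * indicator {0<..} r * G r \<partial>lborel)"
    by (subst (asm) ennreal_mult_cancel_left) auto
  also have "\<dots> = (\<integral>\<^sup>+r. \<integral>\<^sup>+t. ennreal r * indicator {0<..} r * (indicator {0..2 * pi} t
      * f (r * cos t, r * sin t)) \<partial>lborel \<partial>lborel)"
    unfolding G_def by (intro nn_integral_cong nn_integral_cmult[symmetric]) measurable
  finally show ?thesis by (simp add: mult_ac)
qed

section \<open>Polynomial symbols\<close>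

text \<open>The span with control of the coefficients. The explicit bound \<open>K\<close> is what
  later yields a constant independent of \<open>k\<close>.\<close>

definition bspan :: "real \<Rightarrow> 'i set \<Rightarrow> ('i \<Rightarrow> real poly) \<Rightarrow> real poly \<Rightarrow> bool" where
  "bspan K I F q \<longleftrightarrow> (\<exists>c. (\<forall>i\<in>I. \<bar>c i\<bar> \<le> K) \<and> q = (\<Sum>i\<in>I. smult (c i) (F i)))"

lemma bspan_base: "finite I \<Longrightarrow> i \<in> I \<Longrightarrow> bspan 1 I F (F i)"
  unfolding bspan_def
  by (intro exI[of _ "\<lambda>j. if j = i then 1 else 0"]) (auto simp: if_distrib[of "\<lambda>c. smult c _"] cong: if_cong)

lemma bspan_mono: "bspan K I F q \<Longrightarrow> K \<le> K' \<Longrightarrow> bspan K' I F q"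
  unfolding bspan_def using order_trans by blast

lemma bspan_zero: "0 \<le> K \<Longrightarrow> bspan K I F 0"
  unfolding bspan_def by (intro exI[of _ "\<lambda>_. 0"]) auto

lemma bspan_add:
  assumes "bspan K I F q" "bspan K' I F q'" shows "bspan (K + K') I F (q + q')"
proof -
  obtain c c' where "\<forall>i\<in>I. \<bar>c i\<bar> \<le> K" "q = (\<Sum>i\<in>I. smult (c i) (F i))"
    "\<forall>i\<in>I. \<bar>c' i\<bar> \<le> K'" "q' = (\<Sum>i\<in>I. smult (c' i) (F i))"
    using assms by (auto simp: bspan_def)
  then show ?thesis unfolding bspan_def
    by (intro exI[of _ "\<lambda>i. c i + c' i"])
       (auto simp: smult_add_left sum.distrib intro: order_trans[OF abs_triangle_ineq] add_mono)
qed

lemma smult_sum_right: "smult r (sum f I) = (\<Sum>i\<in>I. smult r (f i))"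
  by (induction I rule: infinite_finite_induct) (auto simp: smult_add_right)

lemma bspan_smult:
  assumes "bspan K I F q" "\<bar>r\<bar> \<le> M" shows "bspan (M * K) I F (smult r q)"
proof -
  obtain c where c: "\<forall>i\<in>I. \<bar>c i\<bar> \<le> K" "q = (\<Sum>i\<in>I. smult (c i) (F i))"
    using assms by (auto simp: bspan_def)
  have "0 \<le> M" using assms(2) by linarith
  then show ?thesis unfolding bspan_def using c assms(2)
    by (intro exI[of _ "\<lambda>i. r * c i"]) (auto simp: smult_sum_right abs_mult intro!: mult_mono)
qed

lemma bspan_sum:
  "finite I \<Longrightarrow> (\<And>i. i \<in> I \<Longrightarrow> bspan (K i) J G (q i)) \<Longrightarrow> bspan (sum K I) J G (sum q I)"
  by (induction I rule: finite_induct) (auto intro: bspan_add bspan_zero)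

text \<open>The inductions on \<open>m\<close> multiply an expansion by a linear factor or a
  constant and then re-expand each product. The factor \<open>card I\<close> counts the
  contributions to one coefficient.\<close>

lemma bspan_mult_trans:
  assumes "finite I" "bspan K I F q" "\<And>i. i \<in> I \<Longrightarrow> bspan L J G (r * F i)"
  shows "bspan (real (card I) * (K * L)) J G (r * q)"
proof -
  obtain c where c: "\<forall>i\<in>I. \<bar>c i\<bar> \<le> K" "q = (\<Sum>i\<in>I. smult (c i) (F i))"
    using assms by (auto simp: bspan_def)
  have "bspan (\<Sum>i\<in>I. K * L) J G (\<Sum>i\<in>I. smult (c i) (r * F i))"
    using assms c by (intro bspan_sum bspan_smult) auto
  then show ?thesis by (simp add: c sum_distrib_left)
qed

definition lin_fac :: "real \<Rightarrow> real poly" where "lin_fac x = [:- x, 1:]"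

lemma lin_fac_simps [simp]:
  "poly (lin_fac x) y = y - x" "degree (lin_fac x) = 1" "lin_fac x \<noteq> 0"
  by (simp_all add: lin_fac_def)

lemma lin_fac_shift: "lin_fac x = lin_fac y + [:y - x:]"
  by (simp add: lin_fac_def)

text \<open>A polynomial \<open>q\<close> of degree at most \<open>m\<close> encodes the operator \<open>r\<^sup>-\<^sup>m q(r \<partial>\<^sub>r)\<close>. The operators
  \<open>(2 \<partial>\<^sub>\<zeta>)\<^sup>a (2 \<partial>\<^sub>\<zeta>\<^sub>')\<^sup>b\<close> (with \<open>\<zeta> = x + i y\<close> and \<open>\<zeta>'\<close> its conjugate) on the Fourier mode \<open>k\<close>, and the
  operators in the seminorms \<open>W\<close> and \<open>X\<close>, are encoded as follows; \<open>WX_poly\<close> enumerates the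
  latter by decreasing degree.\<close>

definition P_poly :: "real \<Rightarrow> nat \<Rightarrow> nat \<Rightarrow> real poly" where
  "P_poly k a b = (\<Prod>j<b. lin_fac (k + 2 * real j)) * (\<Prod>i<a. lin_fac (- k + 2 * real i))"

definition W_poly :: "nat \<Rightarrow> nat \<Rightarrow> nat \<Rightarrow> real poly" where
  "W_poly k m l = smult (real k ^ l) (\<Prod>i\<in>{l..<m}. lin_fac (real i))"

definition X_poly :: "nat \<Rightarrow> nat \<Rightarrow> nat \<Rightarrow> real poly" where
  "X_poly k m l = (\<Prod>j<l. lin_fac (real k + 2 * real j)) * (\<Prod>i\<in>{k + 2 * l..<m}. lin_fac (real i))"

definition WX_poly :: "nat \<Rightarrow> nat \<Rightarrow> nat \<Rightarrow> real poly" where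
  "WX_poly k m i = (if i \<le> k then W_poly k m i else X_poly k m (i - k))"

text \<open>The last index of the combined list. For \<open>k < m\<close> there are
  \<open>m - WX_top k m\<close> numbers \<open>k + 2 j\<close> below \<open>m\<close>, so the
  \<open>WX_top k m + 1\<close> members of the list are as many as the dimension of the polynomials
  of degree at most \<open>m\<close> vanishing there.\<close>

definition WX_top :: "nat \<Rightarrow> nat \<Rightarrow> nat" where
  "WX_top k m = (if m \<le> k then m else k + (m - k) div 2)"

lemma P_poly_Suc1: "P_poly k (Suc a) b = lin_fac (- k + 2 * real a) * P_poly k a b"
  and P_poly_Suc2: "P_poly k a (Suc b) = lin_fac (k + 2 * real b) * P_poly k a b"
  by (simp_all add: P_poly_def mult_ac)

lemma P_poly_uminus: "P_poly (- k) a b = P_poly k b a"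
  by (simp add: P_poly_def mult.commute)

text \<open>On symbols, this says that \<open>\<partial>\<^sub>r\<close> is half the sum of the
  lowering and the raising operator.\<close>

lemma P_poly_sum:
  "lin_fac (real (a + b)) * P_poly k a b = smult (1 / 2) (P_poly k (Suc a) b + P_poly k a (Suc b))"
proof -
  have "lin_fac (- k + 2 * real a) + lin_fac (k + 2 * real b) = smult 2 (lin_fac (real (a + b)))"
    by (simp add: lin_fac_def)
  then show ?thesis
    unfolding P_poly_Suc1 P_poly_Suc2 distrib_right[symmetric] by simp
qed

text \<open>After \<open>a\<close> lowerings and \<open>b\<close> raisings the mode is
  \<open>n = k + b - a\<close>, and the difference of lowering and raising is multiplication by
  \<open>2 n / r\<close>. It can be inverted only for \<open>n \<noteq> 0\<close>.\<close>

lemma P_poly_diff: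
  assumes "k + real b - real a \<noteq> 0"
  shows "P_poly k a b = smult (1 / (2 * (k + real b - real a))) (P_poly k (Suc a) b + smult (-1) (P_poly k a (Suc b)))"
proof -
  have "lin_fac (- k + 2 * real a) + smult (-1) (lin_fac (k + 2 * real b)) = [:2 * (k + real b - real a):]"
    by (simp add: lin_fac_def)
  then have "P_poly k (Suc a) b + smult (-1) (P_poly k a (Suc b)) = smult (2 * (k + real b - real a)) (P_poly k a b)"
    unfolding P_poly_Suc1 P_poly_Suc2 mult_smult_left[symmetric] distrib_right[symmetric] by simp
  then show ?thesis using assms by (simp only: smult_smult) simp
qed

lemma bspan_P_Suc:
  assumes "a \<le> m"
  shows "bspan 1 {..Suc m} (\<lambda>a. P_poly k a (Suc m - a)) (P_poly k (Suc a) (m - a))"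
    and "bspan 1 {..Suc m} (\<lambda>a. P_poly k a (Suc m - a)) (P_poly k a (Suc (m - a)))"
  using bspan_base[of "{..Suc m}" "Suc a" "\<lambda>a. P_poly k a (Suc m - a)"]
    bspan_base[of "{..Suc m}" a "\<lambda>a. P_poly k a (Suc m - a)"] assms
  by (auto simp: Suc_diff_le)

lemma bspan_P_lin_fac:
  assumes "a \<le> m"
  shows "bspan 1 {..Suc m} (\<lambda>a. P_poly k a (Suc m - a)) (lin_fac (real m) * P_poly k a (m - a))"
proof -
  have "bspan (1 / 2 * (1 + 1)) {..Suc m} (\<lambda>a. P_poly k a (Suc m - a)) (lin_fac (real (a + (m - a))) * P_poly k a (m - a))"
    unfolding P_poly_sum by (intro bspan_smult bspan_add bspan_P_Suc assms) simp
  then show ?thesis using assms by simp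
qed

lemma bspan_P_const:
  assumes "a \<le> m" "k + real (m - a) - real a \<noteq> 0" "\<bar>c\<bar> \<le> L * \<bar>k + real (m - a) - real a\<bar>"
  shows "bspan L {..Suc m} (\<lambda>a. P_poly k a (Suc m - a)) (smult c (P_poly k a (m - a)))"
proof -
  let ?d = "k + real (m - a) - real a"
  have *: "bspan (L / 2 * (1 + 1 * 1)) {..Suc m} (\<lambda>a. P_poly k a (Suc m - a))
     (smult (c * (1 / (2 * ?d))) (P_poly k (Suc a) (m - a) + smult (-1) (P_poly k a (Suc (m - a)))))"
  proof (intro bspan_smult bspan_add bspan_P_Suc assms(1))
    show "\<bar>c * (1 / (2 * ?d))\<bar> \<le> L / 2"
      using assms(2,3) by (simp only: abs_mult abs_divide) (simp add: field_simps del: right_diff_distrib_numeral distrib_left_numeral)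
  qed simp
  show ?thesis
    by (subst P_poly_diff[OF assms(2)]) (use * in simp)
qed

lemma W_poly_Suc: "l \<le> m \<Longrightarrow> W_poly k (Suc m) l = lin_fac (real m) * W_poly k m l"
  by (simp add: W_poly_def prod.atLeastLessThan_Suc mult_smult_right mult.commute)

lemma X_poly_Suc: "k + 2 * l \<le> m \<Longrightarrow> X_poly k (Suc m) l = lin_fac (real m) * X_poly k m l"
  by (simp add: X_poly_def prod.atLeastLessThan_Suc mult_ac)

lemma WX_poly_Suc: "i \<le> WX_top k m \<Longrightarrow> WX_poly k (Suc m) i = lin_fac (real m) * WX_poly k m i"
  by (auto simp: WX_poly_def WX_top_def W_poly_Suc X_poly_Suc split: if_splits)

text \<open>Induction on \<open>m\<close>, for all \<open>k\<close> at once. The old members of the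
  list are multiplied by \<open>lin_fac m\<close>, which \<open>P_poly_sum\<close> handles. At most
  one member is new; it is a constant multiple of the old last one, so it is handled by
  \<open>P_poly_diff\<close>, provided the constant is controlled by all the modes
  \<open>k + m - 2 a\<close> that occur.\<close>

lemma WX_in_span_P:
  "\<exists>K\<ge>0. \<forall>k i. i \<le> WX_top k m \<longrightarrow> bspan K {..m} (\<lambda>a. P_poly (real k) a (m - a)) (WX_poly k m i)"
proof (induction m)
  case 0
  have "WX_poly k 0 i = P_poly (real k) 0 (0 - 0)" if "i \<le> WX_top k 0" for k i
    using that by (auto simp: WX_top_def WX_poly_def W_poly_def P_poly_def one_pCons)
  then show ?case
    using bspan_base[of "{..0::nat}" 0 "\<lambda>a. P_poly (real k) a (0 - a)" for k]
    by (intro exI[of _ 1]) auto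
next
  case (Suc m)
  then obtain K where K: "K \<ge> 0"
    "\<And>k i. i \<le> WX_top k m \<Longrightarrow> bspan K {..m} (\<lambda>a. P_poly (real k) a (m - a)) (WX_poly k m i)"
    by blast
  define L where "L = real (Suc m) * (K * real (Suc m))"
  have "bspan L {..Suc m} (\<lambda>a. P_poly (real k) a (Suc m - a)) (WX_poly k (Suc m) i)"
    if i: "i \<le> WX_top k (Suc m)" for k i
  proof (cases "i \<le> WX_top k m")
    case True
    have "bspan (real (card {..m}) * (K * real (Suc m))) {..Suc m} (\<lambda>a. P_poly (real k) a (Suc m - a))
      (lin_fac (real m) * WX_poly k m i)"
      using bspan_P_lin_fac[of _ m "real k"]
      by (intro bspan_mult_trans[OF _ K(2)[OF True]]) (auto intro: bspan_mono[where K = 1])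
    then show ?thesis by (simp add: WX_poly_Suc[OF True] L_def)
  next
    case False
    have *: "bspan (real (Suc m) * (K * real (Suc m))) {..Suc m} (\<lambda>a. P_poly (real k) a (Suc m - a)) (smult c (WX_poly k m (WX_top k m)))"
      if "\<And>a. a \<le> m \<Longrightarrow> real k + real (m - a) - real a \<noteq> 0"
        "\<And>a. a \<le> m \<Longrightarrow> \<bar>c\<bar> \<le> real (Suc m) * \<bar>real k + real (m - a) - real a\<bar>" for c
    proof -
      have "bspan (real (card {..m}) * (K * real (Suc m))) {..Suc m} (\<lambda>a. P_poly (real k) a (Suc m - a)) ([:c:] * WX_poly k m (WX_top k m))"
        using that by (intro bspan_mult_trans[OF _ K(2)]) (auto intro!: bspan_P_const)
      then show ?thesis by simp
    qed
    show ?thesis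
    proof (cases "m < k")
      case True
      then have "i = Suc m" using i False by (simp add: WX_top_def)
      then have "WX_poly k (Suc m) i = smult (real k) (WX_poly k m (WX_top k m))"
        using True by (simp add: WX_poly_def WX_top_def W_poly_def)
      moreover have "real k \<le> real (Suc m) * \<bar>real k + real (m - a) - real a\<bar>" if "a \<le> m" for a
      proof -
        \<comment> \<open>Every mode is at least \<open>k - m\<close>, and
          \<open>k - m \<ge> 1\<close> makes \<open>k\<close> at most \<open>m + 1\<close> times as
          large, uniformly in \<open>k\<close>.\<close>
        have "real k \<le> real (Suc m) * (real k - real m)"
        proof -
          have "real m * 1 \<le> real m * (real k - real m)"
            using True by (intro mult_left_mono) auto
          then show ?thesis by (simp add: algebra_simps)
        qed
        also have "\<dots> \<le> real (Suc m) * \<bar>real k + real (m - a) - real a\<bar>"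
          using that True by (intro mult_left_mono) auto
        finally show ?thesis .
      qed
      ultimately show ?thesis using *[of "real k"] True by (auto simp: L_def)
    next
      case k: False
      \<comment> \<open>For \<open>k \<le> m\<close> a new member appears only if
        \<open>m - k\<close> is odd. Then all modes \<open>k + m - 2 a\<close> are odd, and so of
        absolute value at least 1.\<close>
      then have m: "odd (m - k)" and il: "i = k + (Suc m - k) div 2" "i = Suc (WX_top k m)"
        using i False by (auto simp: WX_top_def split: if_splits) presburger+
      obtain l where l: "m = k + 2 * l + 1"
        using m k by (metis oddE le_add_diff_inverse not_less add.assoc)
      have top: "WX_top k m = k + l" and i': "i = k + Suc l"
        using il l by (auto simp: WX_top_def)
      have X: "WX_poly k (Suc m) i = (\<Prod>j<Suc l. lin_fac (real k + 2 * real j))"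
        by (simp add: WX_poly_def i' X_poly_def l)
      \<comment> \<open>For \<open>l = 0\<close> the old last member is still a \<open>W\<close>
        term and carries the factor \<open>k ^ k\<close>, which is at least 1 even for
        \<open>k = 0\<close>, since \<open>0 ^ 0 = 1\<close>. For \<open>l > 0\<close> it is an
        \<open>X\<close> term with the same symbol as the new one.\<close>
      obtain c where c: "\<bar>c\<bar> \<le> 1" "WX_poly k (Suc m) i = smult c (WX_poly k m (WX_top k m))"
      proof (cases "l = 0")
        case True
        have "WX_poly k m (WX_top k m) = smult (real k ^ k) (lin_fac (real k))"
          using True unfolding top by (simp add: WX_poly_def W_poly_def l)
        moreover have "real k ^ k \<ge> 1"
          by (cases "k = 0") auto
        ultimately show ?thesis
          using X True by (intro that[of "1 / real k ^ k"]) (auto simp: divide_le_eq_1)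
      next
        case False
        have "{k + 2 * l..<m} = {k + 2 * l}" using l by auto
        then have "WX_poly k m (WX_top k m) = WX_poly k (Suc m) i"
          using False unfolding X by (simp add: WX_poly_def top X_poly_def)
        then show ?thesis using that[of 1] by simp
      qed
      have ge1: "\<bar>real k + real (m - a) - real a\<bar> \<ge> 1" if "a \<le> m" for a
      proof -
        have "odd (int k + int (m - a) - int a)"
          using l that by (simp add: of_nat_diff)
        then have "int k + int (m - a) - int a \<noteq> 0" by (metis even_zero)
        then have "\<bar>int k + int (m - a) - int a\<bar> \<ge> 1" by linarith
        then show ?thesis by linarith
      qed
      have "\<bar>c\<bar> \<le> real (Suc m) * \<bar>real k + real (m - a) - real a\<bar>" if "a \<le> m" for a
        using c(1) mult_mono[of 1 "real (Suc m)" 1 "\<bar>real k + real (m - a) - real a\<bar>"] ge1[OF that] by simp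
      with * ge1 show ?thesis unfolding c(2) L_def by fastforce
    qed
  qed
  moreover have "L \<ge> 0" using K by (simp add: L_def)
  ultimately show ?case by blast
qed

text \<open>Downward induction on \<open>l = m - d\<close>. Writing the root factor
  \<open>lin_fac l\<close> as \<open>lin_fac m + (m - l)\<close> splits the product into a member of
  the new list and \<open>(m - l) / k\<close> times the case \<open>l + 1\<close>. The quotient is
  bounded because \<open>k \<ge> 1\<close>.\<close>

lemma bspan_W_smult:
  "d \<le> m \<Longrightarrow> \<exists>L\<ge>0. \<forall>k\<ge>1. bspan L {..Suc m} (W_poly k (Suc m)) (smult (real k) (W_poly k m (m - d)))"
proof (induction d)
  case 0
  have "smult (real k) (W_poly k m m) = W_poly k (Suc m) (Suc m)" for k
    by (simp add: W_poly_def)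
  then show ?case
    using bspan_base[of "{..Suc m}" "Suc m" "W_poly k (Suc m)" for k]
    by (intro exI[of _ 1]) auto
next
  case (Suc d)
  then obtain L where L: "L \<ge> 0" "\<And>k. k \<ge> 1 \<Longrightarrow> bspan L {..Suc m} (W_poly k (Suc m)) (smult (real k) (W_poly k m (m - d)))"
    by auto
  define l where "l = m - Suc d"
  have l: "m - d = Suc l" "l < m" "m - l = Suc d" using Suc.prems by (auto simp: l_def)
  have "bspan (1 + real m * L) {..Suc m} (W_poly k (Suc m)) (smult (real k) (W_poly k m l))" if k: "k \<ge> 1" for k
  proof -
    have fac: "lin_fac (real l) = lin_fac (real m) + [:real m - real l:]" by (rule lin_fac_shift)
    have "(\<Prod>i\<in>{l..<m}. lin_fac (real i)) = lin_fac (real l) * (\<Prod>i\<in>{Suc l..<m}. lin_fac (real i))"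
      using l by (simp add: prod.atLeast_Suc_lessThan)
    also have "\<dots> = (\<Prod>i\<in>{Suc l..<Suc m}. lin_fac (real i)) + smult (real m - real l) (\<Prod>i\<in>{Suc l..<m}. lin_fac (real i))"
      using l unfolding fac distrib_right by (simp add: prod.atLeastLessThan_Suc mult.commute)
    finally have "smult (real k) (W_poly k m l) = W_poly k (Suc m) (Suc l)
        + smult ((real m - real l) / real k) (smult (real k) (W_poly k m (Suc l)))"
      using k by (simp add: W_poly_def smult_add_right mult_ac)
    moreover have "bspan (1 + real m * L) {..Suc m} (W_poly k (Suc m)) (W_poly k (Suc m) (Suc l)
        + smult ((real m - real l) / real k) (smult (real k) (W_poly k m (Suc l))))"
    proof (intro bspan_add bspan_smult bspan_base)
      have "real m - real l \<le> real m * real k"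
        using k l mult_left_mono[of 1 "real k" "real m"] by linarith
      then show "\<bar>(real m - real l) / real k\<bar> \<le> real m"
        using k l by (simp add: field_simps)
    qed (use L(2)[OF k] l in auto)
    ultimately show ?thesis by simp
  qed
  moreover have "1 + real m * L \<ge> 0" using L by simp
  ultimately show ?case unfolding l_def by blast
qed

text \<open>Each step multiplies by \<open>lin_fac m + x\<close> with
  \<open>\<bar>x\<bar> \<le> k + 2 m\<close>. Since \<open>k\<close> exceeds \<open>m\<close>,
  \<open>x\<close> is at most \<open>2 m + 1\<close> times \<open>k\<close>, and a factor
  \<open>k\<close> is absorbed by \<open>bspan_W_smult\<close>. This is the source of uniformity for
  large \<open>k\<close>.\<close>

lemma P_in_span_W:
  "\<exists>K\<ge>0. \<forall>k\<ge>m. \<forall>a\<le>m. bspan K {..m} (W_poly k m) (P_poly (real k) a (m - a))"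
proof (induction m)
  case 0
  have "P_poly (real k) 0 0 = W_poly k 0 0" for k
    by (simp add: W_poly_def P_poly_def)
  then show ?case
    using bspan_base[of "{..0::nat}" 0 "W_poly k 0" for k]
    by (intro exI[of _ 1]) auto
next
  case (Suc m)
  then obtain K where K: "K \<ge> 0" "\<And>k a. k \<ge> m \<Longrightarrow> a \<le> m \<Longrightarrow> bspan K {..m} (W_poly k m) (P_poly (real k) a (m - a))"
    by blast
  obtain L' where L': "\<And>d. d \<le> m \<Longrightarrow> L' d \<ge> 0"
    "\<And>d k. d \<le> m \<Longrightarrow> k \<ge> 1 \<Longrightarrow> bspan (L' d) {..Suc m} (W_poly k (Suc m)) (smult (real k) (W_poly k m (m - d)))"
    using bspan_W_smult[of _ m] by metis
  define L where "L = sum L' {..m}"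
  have L: "bspan L {..Suc m} (W_poly k (Suc m)) (smult (real k) (W_poly k m l))" if "k \<ge> 1" "l \<le> m" for k l
  proof -
    have "L' (m - l) \<le> L" unfolding L_def by (intro member_le_sum) (auto simp: L')
    then show ?thesis using L'(2)[of "m - l" k] that by (auto intro: bspan_mono)
  qed
  define M where "M = real (Suc m) * (K * 1) + (2 * real m + 1) * (real (Suc m) * (K * L))"
  have step: "bspan M {..Suc m} (W_poly k (Suc m)) ((lin_fac (real m) + [:x:]) * P_poly (real k) a (m - a))"
    if k: "k \<ge> Suc m" and a: "a \<le> m" and x: "\<bar>x\<bar> \<le> real k + 2 * real m" for k a x
  proof -
    have Kk: "bspan K {..m} (W_poly k m) (P_poly (real k) a (m - a))"
      using K(2) k a by simp
    have 1: "bspan (real (card {..m}) * (K * 1)) {..Suc m} (W_poly k (Suc m)) (lin_fac (real m) * P_poly (real k) a (m - a))"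
    proof (rule bspan_mult_trans[OF _ Kk])
      show "bspan 1 {..Suc m} (W_poly k (Suc m)) (lin_fac (real m) * W_poly k m i)" if "i \<in> {..m}" for i
        using bspan_base[of "{..Suc m}" i "W_poly k (Suc m)"] that W_poly_Suc[of i m k] by auto
    qed simp
    have 2: "bspan (real (card {..m}) * (K * L)) {..Suc m} (W_poly k (Suc m)) ([:real k:] * P_poly (real k) a (m - a))"
      by (rule bspan_mult_trans[OF _ Kk]) (use L k in auto)
    have "real k + 2 * real m \<le> (2 * real m + 1) * real k"
      using k mult_mono[of "2 * real m" "2 * real m" 1 "real k"] by (simp add: algebra_simps)
    with x have "\<bar>x / real k\<bar> \<le> 2 * real m + 1"
      using k by (simp add: field_simps)
    from bspan_add[OF 1 bspan_smult[OF 2 this]] k show ?thesis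
      by (simp add: M_def distrib_right)
  qed
  have "bspan M {..Suc m} (W_poly k (Suc m)) (P_poly (real k) a (Suc m - a))" if k: "k \<ge> Suc m" and a: "a \<le> Suc m" for k a
  proof (cases a)
    case 0
    have "lin_fac (real k + 2 * real m) = lin_fac (real m) + [:- real k - real m:]"
      using lin_fac_shift[of "real k + 2 * real m" "real m"] by simp
    then show ?thesis using step[OF k, of 0 "- real k - real m"] unfolding 0
      by (simp only: P_poly_Suc2 diff_zero)
  next
    case (Suc a')
    have "lin_fac (- real k + 2 * real a') = lin_fac (real m) + [:real m + real k - 2 * real a':]"
      using lin_fac_shift[of "- real k + 2 * real a'" "real m"] by simp
    then show ?thesis using step[OF k, of a' "real m + real k - 2 * real a'"] a k unfolding Suc
      by (simp only: P_poly_Suc1 diff_Suc_Suc)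
  qed
  moreover have "M \<ge> 0"
    using K L' by (auto simp: M_def L_def intro!: add_nonneg_nonneg mult_nonneg_nonneg sum_nonneg)
  ultimately show ?case by blast
qed

lemma degree_prod_lin_fac: "finite A \<Longrightarrow> degree (\<Prod>i\<in>A. lin_fac (f i)) = card A"
  by (subst degree_prod_eq_sum_degree) auto

text \<open>For \<open>j < b\<close> the root comes from the raising factor \<open>j\<close>.
  Otherwise \<open>k + j < a\<close>, and the lowering factor with index \<open>k + j\<close> has
  the root \<open>- k + 2 (k + j) = k + 2 j\<close>.\<close>

lemma P_poly_root:
  assumes "k + 2 * j < a + b" shows "poly (P_poly (real k) a b) (real k + 2 * real j) = 0"
proof (cases "j < b")
  case True
  then show ?thesis by (auto simp: P_poly_def poly_prod prod_zero_iff)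
next
  case False
  then have "k + j < a" using assms by simp
  then have "(\<Prod>i<a. poly (lin_fac (- real k + 2 * real i)) (real k + 2 * real j)) = 0"
    by (intro prod_zero) (auto intro!: bexI[of _ "k + j"])
  then show ?thesis by (simp add: P_poly_def poly_prod)
qed

lemma WX_poly_root:
  assumes "k + 2 * j < m" shows "poly (WX_poly k m i) (real k + 2 * real j) = 0"
proof (cases "i \<le> k")
  case True
  have "\<exists>i'\<in>{i..<m}. real k + 2 * real j = real i'"
    using assms True by (intro bexI[of _ "k + 2 * j"]) auto
  then show ?thesis using True by (auto simp: WX_poly_def W_poly_def poly_prod prod_zero_iff)
next
  case False
  have "\<exists>i'\<in>{k + 2 * l..<m}. real k + 2 * real j = real i'" if "\<not> j < l" for l
    using assms that by (intro bexI[of _ "k + 2 * j"]) auto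
  then show ?thesis using False by (cases "j < i - k") (auto simp: WX_poly_def X_poly_def poly_prod prod_zero_iff)
qed

lemma WX_poly_degree:
  assumes "k < m" "i \<le> WX_top k m" shows "degree (WX_poly k m i) = m - i" "WX_poly k m i \<noteq> 0"
proof -
  have pos: "real k ^ i \<noteq> 0" if "i \<le> k" using that by (cases "k = 0") auto
  then show "degree (WX_poly k m i) = m - i"
    using assms
    by (auto simp: WX_poly_def W_poly_def X_poly_def degree_prod_lin_fac degree_mult_eq WX_top_def prod_zero_iff)
  show "WX_poly k m i \<noteq> 0"
    using pos by (auto simp: WX_poly_def W_poly_def X_poly_def)
qed

text \<open>The members of the list have the distinct degrees \<open>m - i\<close>, so leading terms
  can be removed one by one; \<open>d\<close> counts those still to be removed. At
  \<open>d = 0\<close> the degree is smaller than the number of prescribed roots and the remainder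
  is zero. The bound \<open>K\<close> may depend on \<open>k\<close> and \<open>q\<close>.\<close>

lemma in_span_WX:
  assumes k: "k < m" and d: "d \<le> Suc (WX_top k m)"
  shows "degree q + Suc (WX_top k m) \<le> m + d \<Longrightarrow>
    (\<And>j. k + 2 * j < m \<Longrightarrow> poly q (real k + 2 * real j) = 0) \<Longrightarrow>
    \<exists>K. bspan K {..WX_top k m} (WX_poly k m) q"
  using d
proof (induction d arbitrary: q)
  case 0
  have "q = 0"
  proof (rule ccontr)
    assume q: "q \<noteq> 0"
    define J where "J = {j. k + 2 * j < m}"
    have "J = {..< m - WX_top k m}"
      using k by (auto simp: J_def WX_top_def)
    then have "card ((\<lambda>j. real k + 2 * real j) ` J) = m - WX_top k m"
      by (subst card_image) (auto simp: inj_on_def)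
    moreover have "card ((\<lambda>j. real k + 2 * real j) ` J) \<le> card {x. poly q x = 0}"
      using 0(2) poly_roots_finite[OF q] by (intro card_mono) (auto simp: J_def)
    moreover have "card {x. poly q x = 0} \<le> degree q"
      by (rule card_poly_roots_bound[OF q])
    ultimately show False using 0(1) by linarith
  qed
  then show ?case using bspan_zero[of 0] by auto
next
  case (Suc d)
  define i where "i = WX_top k m - d"
  have i: "i \<le> WX_top k m" using Suc.prems by (simp add: i_def)
  have top: "WX_top k m < m" using k by (auto simp: WX_top_def)
  note deg = WX_poly_degree[OF k i]
  define c where "c = coeff q (m - i) / lead_coeff (WX_poly k m i)"
  define q' where "q' = q - smult c (WX_poly k m i)"
  have q: "q = q' + smult c (WX_poly k m i)" by (simp add: q'_def)
  have "degree q \<le> m - i" using Suc.prems top by (simp add: i_def)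
  then have "degree q' \<le> m - i" unfolding q'_def
    by (intro degree_diff_le) (auto simp: deg)
  moreover have "coeff q' (m - i) = 0"
    using deg leading_coeff_0_iff[of "WX_poly k m i"] by (simp add: q'_def c_def)
  moreover have "m - i > 0" using top i by simp
  ultimately have "degree q' < m - i"
    by (metis coeff_0_degree_minus_1 degree_0 le_neq_implies_less leading_coeff_0_iff)
  then have "degree q' + Suc (WX_top k m) \<le> m + d"
    using Suc.prems top by (simp add: i_def)
  moreover have "poly q' (real k + 2 * real j) = 0" if "k + 2 * j < m" for j
    using Suc.prems(2)[OF that] WX_poly_root[OF that] by (simp add: q'_def)
  ultimately obtain K where "bspan K {..WX_top k m} (WX_poly k m) q'"
    using Suc.IH Suc.prems(3) by auto
  moreover have "bspan (\<bar>c\<bar> * 1) {..WX_top k m} (WX_poly k m) (smult c (WX_poly k m i))"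
    using i by (intro bspan_smult bspan_base) auto
  ultimately have "bspan (K + \<bar>c\<bar> * 1) {..WX_top k m} (WX_poly k m) q"
    unfolding q by (rule bspan_add)
  then show ?case by blast
qed

text \<open>The finitely many pairs with \<open>k < m\<close> contribute the sum of their individual
  bounds. For \<open>k \<ge> m\<close> the list consists of \<open>W\<close> terms only, and the
  uniform bound applies.\<close>

lemma P_in_span_WX:
  "\<exists>K\<ge>0. \<forall>k. \<forall>a\<le>m. bspan K {..WX_top k m} (WX_poly k m) (P_poly (real k) a (m - a))"
proof -
  have "\<exists>K. bspan K {..WX_top k m} (WX_poly k m) (P_poly (real k) a (m - a))" if "k < m" "a \<le> m" for k a
  proof (rule in_span_WX[OF that(1) order_refl])
    have "degree (P_poly (real k) a (m - a)) = m"
      using that(2) by (simp add: P_poly_def degree_prod_lin_fac degree_mult_eq prod_zero_iff)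
    then show "degree (P_poly (real k) a (m - a)) + Suc (WX_top k m) \<le> m + Suc (WX_top k m)" by simp
    show "poly (P_poly (real k) a (m - a)) (real k + 2 * real j) = 0" if "k + 2 * j < m" for j
      using that \<open>a \<le> m\<close> by (intro P_poly_root) simp
  qed
  then obtain K1 where K1: "\<And>k a. k < m \<Longrightarrow> a \<le> m \<Longrightarrow> bspan (K1 k a) {..WX_top k m} (WX_poly k m) (P_poly (real k) a (m - a))"
    by metis
  obtain K2 where K2: "K2 \<ge> 0" "\<And>k a. k \<ge> m \<Longrightarrow> a \<le> m \<Longrightarrow> bspan K2 {..m} (W_poly k m) (P_poly (real k) a (m - a))"
    using P_in_span_W[of m] by blast
  define K where "K = K2 + (\<Sum>k<m. \<Sum>a\<le>m. \<bar>K1 k a\<bar>)"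
  have "bspan K {..WX_top k m} (WX_poly k m) (P_poly (real k) a (m - a))" if a: "a \<le> m" for k a
  proof (cases "k < m")
    case True
    have "K1 k a \<le> \<bar>K1 k a\<bar>" by simp
    also have "\<dots> \<le> (\<Sum>a\<le>m. \<bar>K1 k a\<bar>)"
      using a by (intro member_le_sum) auto
    also have "\<dots> \<le> (\<Sum>k<m. \<Sum>a\<le>m. \<bar>K1 k a\<bar>)"
      using True by (intro member_le_sum[of k "{..<m}" "\<lambda>k. \<Sum>a\<le>m. \<bar>K1 k a\<bar>"]) (auto intro: sum_nonneg)
    finally show ?thesis using K1[OF True a] K2(1) by (auto simp: K_def intro: bspan_mono)
  next
    case False
    have "bspan K {..m} (W_poly k m) (P_poly (real k) a (m - a))"
      using K2(2)[of k a] False a by (auto simp: K_def intro!: bspan_mono[where K = K2] sum_nonneg)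
    moreover have "bspan K {..m} (WX_poly k m) q = bspan K {..m} (W_poly k m) q" for q
      using False unfolding bspan_def by (auto simp: WX_poly_def intro!: arg_cong[of _ _ Ex] ext sum.cong)
    ultimately show ?thesis using False by (simp add: WX_top_def)
  qed
  moreover have "K \<ge> 0" using K2 by (auto simp: K_def intro!: add_nonneg_nonneg sum_nonneg)
  ultimately show ?thesis by blast
qed

section \<open>Distributions\<close>

text \<open>The weight \<open>2 * pi * r\<close> is negative for negative radii, so positivity can
  be asked on \<open>U\<close> only.\<close>

definition weight_on :: "'a::euclidean_space set \<Rightarrow> ('a \<Rightarrow> real) \<Rightarrow> bool" where
  "weight_on U \<omega> \<longleftrightarrow> continuous_on UNIV \<omega> \<and> (\<forall>x\<in>U. 0 < \<omega> x)"

lemma weight_on_measurable: "weight_on U \<omega> \<Longrightarrow> \<omega> \<in> borel_measurable borel"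
  by (simp add: weight_on_def borel_measurable_continuous_onI)

text \<open>The product is dominated by \<open>\<omega> \<bar>f\<bar>\<^sup>2 +
  \<bar>\<phi>\<bar>\<^sup>2 / \<omega>\<close>. On a compact subset of \<open>U\<close> outside
  which \<open>\<phi>\<close> vanishes, both terms are integrable, the second because
  \<open>\<omega>\<close> is continuous and positive there.\<close>

lemma integrable_test_fun_mult:
  fixes f :: "'a::euclidean_space \<Rightarrow> complex"
  assumes \<omega>: "weight_on U \<omega>" and f: "f \<in> borel_measurable borel" "wnorm \<omega> f < \<infinity>"
    and \<phi>: "\<phi> \<in> test_fun U"
  shows "integrable lborel (\<lambda>x. f x * \<phi> x)"
proof -
  obtain K where K: "compact K" "K \<subseteq> U" "\<And>x. x \<notin> K \<Longrightarrow> \<phi> x = 0"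
    using test_funE[OF \<phi>] by metis
  have cont: "continuous_on A \<phi>" for A
    using smooth_continuous[OF test_fun_smooth[OF \<phi>]] continuous_on_subset by blast
  note [measurable] = f(1) test_fun_measurable[OF \<phi>] weight_on_measurable[OF \<omega>]
  have "\<forall>x\<in>K. \<omega> x \<noteq> 0" "continuous_on K \<omega>"
    using K(2) \<omega> continuous_on_subset[of UNIV \<omega> K] by (force simp: weight_on_def)+
  then have "integrable lborel (\<lambda>x. indicator K x *\<^sub>R ((cmod (\<phi> x))\<^sup>2 / \<omega> x))"
    using K cont by (intro borel_integrable_compact continuous_intros) auto
  moreover have "integrable lborel (\<lambda>x. indicator K x *\<^sub>R (\<omega> x * (cmod (f x))\<^sup>2))"
  proof (rule integrableI_bounded)
    show "(\<lambda>x. indicator K x *\<^sub>R (\<omega> x * (cmod (f x))\<^sup>2)) \<in> borel_measurable lborel"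
      using K(1) by (auto simp: compact_imp_closed)
    have "(\<integral>\<^sup>+x. ennreal (norm (indicator K x *\<^sub>R (\<omega> x * (cmod (f x))\<^sup>2))) \<partial>lborel) \<le> wnorm \<omega> f"
      unfolding wnorm_def using \<omega> K
      by (intro nn_integral_mono)
         (auto simp: indicator_def weight_on_def abs_mult subset_iff abs_of_pos)
    with f(2) show "(\<integral>\<^sup>+x. ennreal (norm (indicator K x *\<^sub>R (\<omega> x * (cmod (f x))\<^sup>2))) \<partial>lborel) < \<infinity>"
      using order.strict_trans1 by blast
  qed
  ultimately have "integrable lborel (\<lambda>x. indicator K x *\<^sub>R (\<omega> x * (cmod (f x))\<^sup>2)
      + indicator K x *\<^sub>R ((cmod (\<phi> x))\<^sup>2 / \<omega> x))"
    by (rule Bochner_Integration.integrable_add[rotated])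
  then show ?thesis
  proof (rule Bochner_Integration.integrable_bound)
    show "AE x in lborel. norm (f x * \<phi> x) \<le> norm (indicator K x *\<^sub>R (\<omega> x * (cmod (f x))\<^sup>2)
      + indicator K x *\<^sub>R ((cmod (\<phi> x))\<^sup>2 / \<omega> x))"
    proof (rule AE_I2)
      fix x
      show "norm (f x * \<phi> x) \<le> norm (indicator K x *\<^sub>R (\<omega> x * (cmod (f x))\<^sup>2) + indicator K x *\<^sub>R ((cmod (\<phi> x))\<^sup>2 / \<omega> x))"
      proof (cases "x \<in> K")
        case True
        then have w: "\<omega> x > 0" using \<omega> K by (auto simp: weight_on_def)
        define a b where "a = cmod (f x)" and "b = cmod (\<phi> x)"
        have nn: "0 \<le> a" "0 \<le> b" by (auto simp: a_def b_def)
        have "0 \<le> (\<omega> x * a - b)\<^sup>2 / \<omega> x" using w by simp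
        also have "\<dots> = \<omega> x * a\<^sup>2 + b\<^sup>2 / \<omega> x - 2 * (a * b)"
          using w by (simp add: field_simps power2_eq_square)
        finally have "a * b \<le> \<omega> x * a\<^sup>2 + b\<^sup>2 / \<omega> x"
          using nn mult_nonneg_nonneg[OF nn] by linarith
        then show ?thesis using True w by (simp add: norm_mult a_def b_def)
      qed (simp add: K)
    qed
  qed simp
qed

lemma borel_rep_sum:
  assumes \<omega>: "weight_on U \<omega>" and I: "finite I" and K: "\<And>i. i \<in> I \<Longrightarrow> cmod (c i) \<le> K"
    and f: "\<And>i. i \<in> I \<Longrightarrow> borel_rep \<omega> U (S i) (f i)"
    and T: "\<And>\<phi>. \<phi> \<in> test_fun U \<Longrightarrow> T \<phi> = (\<Sum>i\<in>I. c i * S i \<phi>)"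
  shows "borel_rep \<omega> U T (\<lambda>x. \<Sum>i\<in>I. c i * f i x)" (is ?rep)
    and "wnorm \<omega> (\<lambda>x. \<Sum>i\<in>I. c i * f i x) \<le> ennreal (real (card I) * K\<^sup>2) * (\<Sum>i\<in>I. wnorm \<omega> (f i))" (is ?le)
proof -
  have fm[measurable]: "f i \<in> borel_measurable borel" and fz: "x \<notin> U \<Longrightarrow> f i x = 0" if "i \<in> I" for i x
    using f[OF that] by (auto simp: borel_rep_def)
  note [measurable] = weight_on_measurable[OF \<omega>]
  have pt: "(cmod (\<Sum>i\<in>I. c i * f i x))\<^sup>2 \<le> real (card I) * K\<^sup>2 * (\<Sum>i\<in>I. (cmod (f i x))\<^sup>2)" for x
  proof -
    have "(cmod (\<Sum>i\<in>I. c i * f i x))\<^sup>2 \<le> (\<Sum>i\<in>I. cmod (c i * f i x))\<^sup>2"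
      by (intro power_mono norm_sum) auto
    also have "\<dots> \<le> real (card I) * (\<Sum>i\<in>I. (cmod (c i * f i x))\<^sup>2)"
      using sum_squared_le_sum_of_squares[of "\<lambda>i. cmod (c i * f i x)" I] by (simp add: mult.commute)
    also have "\<dots> \<le> real (card I) * (\<Sum>i\<in>I. K\<^sup>2 * (cmod (f i x))\<^sup>2)"
      using K by (intro mult_left_mono sum_mono) (auto simp: norm_mult power_mult_distrib intro!: mult_right_mono power_mono)
    finally show ?thesis by (simp add: sum_distrib_left mult_ac)
  qed
  have "wnorm \<omega> (\<lambda>x. \<Sum>i\<in>I. c i * f i x)
      \<le> (\<integral>\<^sup>+x. ennreal (real (card I) * K\<^sup>2) * (\<Sum>i\<in>I. ennreal (\<omega> x * (cmod (f i x))\<^sup>2)) \<partial>lborel)"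
    unfolding wnorm_def
  proof (rule nn_integral_mono)
    fix x
    show "ennreal (\<omega> x * (cmod (\<Sum>i\<in>I. c i * f i x))\<^sup>2)
      \<le> ennreal (real (card I) * K\<^sup>2) * (\<Sum>i\<in>I. ennreal (\<omega> x * (cmod (f i x))\<^sup>2))"
    proof (cases "x \<in> U")
      case True
      then have w: "\<omega> x > 0" using \<omega> by (auto simp: weight_on_def)
      then have "\<omega> x * (cmod (\<Sum>i\<in>I. c i * f i x))\<^sup>2 \<le> real (card I) * K\<^sup>2 * (\<Sum>i\<in>I. \<omega> x * (cmod (f i x))\<^sup>2)"
        using mult_left_mono[OF pt, of "\<omega> x"] by (simp add: sum_distrib_left mult_ac)
      then show ?thesis using w
        by (subst sum_ennreal) (auto simp: ennreal_mult[symmetric] sum_nonneg intro: ennreal_leI)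
    qed (simp add: fz)
  qed
  also have "\<dots> = ennreal (real (card I) * K\<^sup>2) * (\<Sum>i\<in>I. wnorm \<omega> (f i))"
    unfolding wnorm_def
    by (subst nn_integral_cmult) (auto intro!: borel_measurable_sum arg_cong2[where f = "(*)"] nn_integral_sum)
  finally show le: ?le .
  have "(\<Sum>i\<in>I. wnorm \<omega> (f i)) < \<infinity>"
    using f I by (auto simp: borel_rep_def less_top)
  then have "wnorm \<omega> (\<lambda>x. \<Sum>i\<in>I. c i * f i x) < \<infinity>"
    using le by (auto simp: ennreal_mult_less_top intro: le_less_trans)
  moreover have "T \<phi> = (LINT x|lborel. (\<Sum>i\<in>I. c i * f i x) * \<phi> x)" if "\<phi> \<in> test_fun U" for \<phi>
  proof -
    have "integrable lborel (\<lambda>x. f i x * \<phi> x)" if "i \<in> I" for i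
      using f[OF that] \<open>\<phi> \<in> test_fun U\<close> by (intro integrable_test_fun_mult[OF \<omega>]) (auto simp: borel_rep_def)
    moreover have "S i \<phi> = (LINT x|lborel. f i x * \<phi> x)" if "i \<in> I" for i
      using f[OF that] \<open>\<phi> \<in> test_fun U\<close> by (auto simp: borel_rep_def)
    ultimately show ?thesis
      using T[OF that] by (simp add: sum_distrib_right mult.assoc)
  qed
  ultimately show ?rep
    using fz by (auto simp: borel_rep_def)
qed

text \<open>The norms are infima, so representatives that are optimal up to \<open>\<delta>\<close>
  are combined. With \<open>\<bar>K\<bar> + 1\<close> in place of \<open>K\<close> the factor stays
  positive, so that an infinite summand makes the right-hand side infinite; in
  \<open>ennreal\<close> the product of 0 and infinity is 0.\<close>

lemma distr_L2norm_sq_sum_le: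
  assumes \<omega>: "weight_on U \<omega>" and U: "open U" and I: "finite I" and K: "\<And>i. i \<in> I \<Longrightarrow> cmod (c i) \<le> K"
    and T: "\<And>\<phi>. \<phi> \<in> test_fun U \<Longrightarrow> T \<phi> = (\<Sum>i\<in>I. c i * S i \<phi>)"
  shows "distr_L2norm_sq \<omega> U T \<le> ennreal (real (card I) * (\<bar>K\<bar> + 1)\<^sup>2) * (\<Sum>i\<in>I. distr_L2norm_sq \<omega> U (S i))"
proof -
  define C where "C = real (card I) * (\<bar>K\<bar> + 1)\<^sup>2"
  have "C \<ge> 0" by (simp add: C_def)
  have UB: "U \<in> sets borel" using U by simp
  show ?thesis
  proof (cases "\<exists>i\<in>I. distr_L2norm_sq \<omega> U (S i) = \<infinity>")
    case True
    then have "C > 0" using I unfolding C_def by (intro mult_pos_pos) (auto simp: card_gt_0_iff)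
    moreover have "(\<Sum>i\<in>I. distr_L2norm_sq \<omega> U (S i)) = \<infinity>"
      using True I by simp
    ultimately show ?thesis unfolding C_def[symmetric]
      by (simp add: ennreal_mult_top)
  next
    case False
    show ?thesis unfolding C_def[symmetric]
    proof (rule ennreal_le_epsilon)
      fix \<epsilon> :: real assume \<epsilon>: "\<epsilon> > 0"
      \<comment> \<open>The total excess \<open>C * card I * \<delta>\<close> must not exceed
        \<open>\<epsilon>\<close>; the \<open>+ 1\<close> avoids division by zero.\<close>
      define \<delta> where "\<delta> = \<epsilon> / (C * real (card I) + 1)"
      have pos: "C * real (card I) + 1 > 0" using \<open>C \<ge> 0\<close> by (simp add: add_nonneg_pos)
      then have \<delta>: "\<delta> > 0" using \<epsilon> by (simp add: \<delta>_def)
      have "C * (real (card I) * \<delta>) \<le> (C * real (card I) + 1) * \<delta>"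
        using \<delta> by (simp add: algebra_simps)
      also have "\<dots> = \<epsilon>" using pos by (simp add: \<delta>_def)
      finally have small: "C * (real (card I) * \<delta>) \<le> \<epsilon>" .
      have "\<exists>f. borel_rep \<omega> U (S i) f \<and> wnorm \<omega> f \<le> distr_L2norm_sq \<omega> U (S i) + ennreal \<delta>" if "i \<in> I" for i
      proof (rule ccontr)
        assume "\<not> ?thesis"
        then have "distr_L2norm_sq \<omega> U (S i) + ennreal \<delta> \<le> distr_L2norm_sq \<omega> U (S i)"
          by (intro distr_L2norm_sq_ge[OF _ UB]) (auto simp: not_le intro: less_imp_le)
        then show False using False that \<delta>
          by (cases "distr_L2norm_sq \<omega> U (S i)") (auto simp: ennreal_plus[symmetric] simp del: ennreal_plus)
      qed
      then obtain f where f: "\<And>i. i \<in> I \<Longrightarrow> borel_rep \<omega> U (S i) (f i)"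
        "\<And>i. i \<in> I \<Longrightarrow> wnorm \<omega> (f i) \<le> distr_L2norm_sq \<omega> U (S i) + ennreal \<delta>"
        by metis
      have K': "cmod (c i) \<le> \<bar>K\<bar> + 1" if "i \<in> I" for i using K[OF that] by linarith
      have "distr_L2norm_sq \<omega> U T \<le> wnorm \<omega> (\<lambda>x. \<Sum>i\<in>I. c i * f i x)"
        by (rule distr_L2norm_sq_le[OF borel_rep_sum(1)[OF \<omega> I K' f(1) T] UB])
      also have "\<dots> \<le> ennreal C * (\<Sum>i\<in>I. wnorm \<omega> (f i))"
        unfolding C_def by (rule borel_rep_sum(2)[OF \<omega> I K' f(1) T])
      also have "\<dots> \<le> ennreal C * (\<Sum>i\<in>I. distr_L2norm_sq \<omega> U (S i) + ennreal \<delta>)"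
        using f(2) by (intro mult_left_mono sum_mono) auto
      also have "\<dots> = ennreal C * (\<Sum>i\<in>I. distr_L2norm_sq \<omega> U (S i)) + ennreal (C * (real (card I) * \<delta>))"
        using \<open>C \<ge> 0\<close> \<delta>
        by (simp add: sum.distrib distrib_left ennreal_mult ennreal_of_nat_eq_real_of_nat)
      also have "\<dots> \<le> ennreal C * (\<Sum>i\<in>I. distr_L2norm_sq \<omega> U (S i)) + ennreal \<epsilon>"
        using small by (intro add_left_mono ennreal_leI)
      finally show "distr_L2norm_sq \<omega> U T \<le> ennreal C * (\<Sum>i\<in>I. distr_L2norm_sq \<omega> U (S i)) + ennreal \<epsilon>" .
    qed
  qed
qed

lemma distr_L2norm_sq_cong:
  "(\<And>\<phi>. \<phi> \<in> test_fun U \<Longrightarrow> T \<phi> = T' \<phi>) \<Longrightarrow> distr_L2norm_sq \<omega> U T = distr_L2norm_sq \<omega> U T'"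
  unfolding distr_L2norm_sq_def by simp

text \<open>The type \<open>distr\<close> admits arbitrary functionals, so linearity has to be
  carried along. Only test functions are tested, because elsewhere the values carry no
  meaning.\<close>

definition dlin :: "'a::euclidean_space set \<Rightarrow> 'a distr \<Rightarrow> bool" where
  "dlin U T \<longleftrightarrow> (\<forall>\<phi>\<in>test_fun U. \<forall>\<psi>\<in>test_fun U. \<forall>c. T (\<lambda>x. \<phi> x + c * \<psi> x) = T \<phi> + c * T \<psi>)"

lemma dlinD: "dlin U T \<Longrightarrow> \<phi> \<in> test_fun U \<Longrightarrow> \<psi> \<in> test_fun U \<Longrightarrow> T (\<lambda>x. \<phi> x + c * \<psi> x) = T \<phi> + c * T \<psi>"
  by (simp add: dlin_def)

lemma dlin_cmult:
  assumes "dlin U T" "\<phi> \<in> test_fun U" shows "T (\<lambda>x. c * \<phi> x) = c * T \<phi>"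
proof -
  have z: "(\<lambda>x. 0 * \<phi> x) \<in> test_fun U" by (rule test_fun_cmult[OF assms(2)])
  have "T (\<lambda>x. 0 * \<phi> x + c * \<phi> x) = T (\<lambda>x. 0 * \<phi> x) + c * T \<phi>" for c
    by (rule dlinD[OF assms(1) z assms(2)])
  from this[of c] this[of 0] show ?thesis using dlinD[OF assms(1) z z, of 1] by simp
qed

lemma pd_lin:
  fixes \<phi> \<psi> :: "'a::euclidean_space \<Rightarrow> complex"
  assumes "smooth \<phi>" "smooth \<psi>"
  shows "pd v (\<lambda>x. \<phi> x + c * \<psi> x) = (\<lambda>x. pd v \<phi> x + c * pd v \<psi> x)"
proof
  fix x
  show "pd v (\<lambda>x. \<phi> x + c * \<psi> x) x = pd v \<phi> x + c * pd v \<psi> x"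
    by (rule pd_eqI[where f' = "\<lambda>h. pd h \<phi> x + c * pd h \<psi> x", simplified])
       (auto intro!: has_derivative_add has_derivative_mult_right smooth_has_derivative assms)
qed

lemma dlin_dderiv: "dlin U T \<Longrightarrow> dlin U (dderiv v T)"
  unfolding dlin_def dderiv_def by (simp add: pd_lin test_fun_smooth test_fun_pd)

lemma dlin_dmult:
  assumes "dlin U T" "\<And>\<phi>. \<phi> \<in> test_fun U \<Longrightarrow> (\<lambda>x. complex_of_real (g x) * \<phi> x) \<in> test_fun U"
  shows "dlin U (dmult g T)"
  unfolding dlin_def dmult_def
proof safe
  fix \<phi> \<psi> c assume a: "\<phi> \<in> test_fun U" "\<psi> \<in> test_fun U"
  have "(\<lambda>x. complex_of_real (g x) * (\<phi> x + c * \<psi> x))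
    = (\<lambda>x. complex_of_real (g x) * \<phi> x + c * (complex_of_real (g x) * \<psi> x))"
    by (simp add: algebra_simps)
  then show "T (\<lambda>x. complex_of_real (g x) * (\<phi> x + c * \<psi> x)) =
       T (\<lambda>x. complex_of_real (g x) * \<phi> x) + c * T (\<lambda>x. complex_of_real (g x) * \<psi> x)"
    using dlinD[OF assms(1) assms(2)[OF a(1)] assms(2)[OF a(2)]] by simp
qed

lemma dlin_borel:
  assumes \<omega>: "weight_on U \<omega>" and f: "f \<in> borel_measurable borel" "wnorm \<omega> f < \<infinity>"
    and T: "\<And>\<phi>. \<phi> \<in> test_fun U \<Longrightarrow> T \<phi> = (LINT x|lborel. f x * \<phi> x)"
  shows "dlin U T"
  unfolding dlin_def
proof safe
  fix \<phi> \<psi> c assume a: "\<phi> \<in> test_fun U" "\<psi> \<in> test_fun U"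
  note i = integrable_test_fun_mult[OF \<omega> f]
  have "T (\<lambda>x. \<phi> x + c * \<psi> x) = (LINT x|lborel. f x * \<phi> x + c * (f x * \<psi> x))"
    using a by (subst T) (auto intro: test_fun_add test_fun_cmult simp: algebra_simps)
  also have "\<dots> = T \<phi> + c * T \<psi>"
    using i[OF a(1)] i[OF a(2)] a by (simp add: T)
  finally show "T (\<lambda>x. \<phi> x + c * \<psi> x) = T \<phi> + c * T \<psi>" .
qed

text \<open>For \<open>\<alpha> = 1\<close> this is \<open>2\<partial>\<^sub>\<zeta>\<close> when
  \<open>\<beta> = - \<i>\<close>, and \<open>2\<partial>\<^sub>\<zeta>\<^sub>'\<close> when
  \<open>\<beta> = \<i>\<close>.\<close>

definition cderiv :: "'a::euclidean_space \<Rightarrow> 'a \<Rightarrow> complex \<Rightarrow> complex \<Rightarrow> 'a distr \<Rightarrow> 'a distr" where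
  "cderiv ex ey \<alpha> \<beta> T = (\<lambda>\<phi>. \<alpha> * dderiv ex T \<phi> + \<beta> * dderiv ey T \<phi>)"

text \<open>Homogeneous polynomials in the two commuting operators \<open>dderiv ex\<close>, \<open>dderiv ey\<close>, dehomogenized.\<close>

definition hom_op :: "'a::euclidean_space \<Rightarrow> 'a \<Rightarrow> nat \<Rightarrow> complex poly \<Rightarrow> 'a distr \<Rightarrow> 'a distr" where
  "hom_op ex ey m q T = (\<lambda>\<phi>. \<Sum>i\<le>m. coeff q i * (dderiv ex ^^ i) ((dderiv ey ^^ (m - i)) T) \<phi>)"

lemma dderiv_cong_smooth:
  assumes "\<And>\<phi>. smooth \<phi> \<Longrightarrow> S \<phi> = T \<phi>" "smooth \<phi>"
  shows "dderiv v S \<phi> = dderiv v T \<phi>"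
  using assms by (simp add: dderiv_def smooth_pd)

lemma cderiv_cong_smooth:
  assumes "\<And>\<phi>. smooth \<phi> \<Longrightarrow> S \<phi> = T \<phi>" "smooth \<phi>"
  shows "cderiv ex ey \<alpha> \<beta> S \<phi> = cderiv ex ey \<alpha> \<beta> T \<phi>"
  using dderiv_cong_smooth[OF assms] by (simp add: cderiv_def)

lemma dderiv_commute:
  assumes "smooth \<phi>" shows "dderiv v ((dderiv w ^^ i) S) \<phi> = (dderiv w ^^ i) (dderiv v S) \<phi>"
  using assms
proof (induction i arbitrary: \<phi>)
  case (Suc i)
  let ?S = "(dderiv w ^^ i) S"
  have "dderiv v ((dderiv w ^^ Suc i) S) \<phi> = - dderiv v ?S (pd w \<phi>)"
    using Suc.prems by (simp add: dderiv_def pd_commute)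
  also have "\<dots> = - (dderiv w ^^ i) (dderiv v S) (pd w \<phi>)"
    using Suc.IH[OF smooth_pd[OF Suc.prems]] by simp
  also have "\<dots> = (dderiv w ^^ Suc i) (dderiv v S) \<phi>"
    by (simp add: dderiv_def)
  finally show ?case .
qed simp

text \<open>In the dehomogenized form the variable stands for \<open>dderiv ex\<close> and 1 for
  \<open>dderiv ey\<close>, so the operator becomes multiplication by
  \<open>\<beta> + \<alpha> X\<close>.\<close>

lemma hom_op_cderiv:
  assumes "degree q \<le> m" "smooth \<phi>"
  shows "cderiv ex ey \<alpha> \<beta> (hom_op ex ey m q T) \<phi> = hom_op ex ey (Suc m) ([:\<beta>, \<alpha>:] * q) T \<phi>"
proof -
  let ?D = "\<lambda>i j. (dderiv ex ^^ i) ((dderiv ey ^^ j) T) \<phi>"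
  have x: "dderiv ex (hom_op ex ey m q T) \<phi> = (\<Sum>i\<le>m. coeff q i * ?D (Suc i) (m - i))"
    by (simp add: dderiv_def hom_op_def sum_negf)
  have "dderiv ey (hom_op ex ey m q T) \<phi> = (\<Sum>i\<le>m. coeff q i * dderiv ey ((dderiv ex ^^ i) ((dderiv ey ^^ (m - i)) T)) \<phi>)"
    by (simp add: dderiv_def hom_op_def sum_negf)
  also have "\<dots> = (\<Sum>i\<le>m. coeff q i * ?D i (Suc m - i))"
    using assms(2) by (intro sum.cong) (auto simp: dderiv_commute Suc_diff_le)
  finally have y: "dderiv ey (hom_op ex ey m q T) \<phi> = (\<Sum>i\<le>m. coeff q i * ?D i (Suc m - i))" .
  have "hom_op ex ey (Suc m) (pCons 0 q) T \<phi> = (\<Sum>i\<le>m. coeff q i * ?D (Suc i) (m - i))"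
    unfolding hom_op_def by (subst sum.atMost_Suc_shift) simp
  moreover have "hom_op ex ey (Suc m) q T \<phi> = (\<Sum>i\<le>m. coeff q i * ?D i (Suc m - i))"
    using assms(1) unfolding hom_op_def by (simp add: coeff_eq_0)
  moreover have "hom_op ex ey (Suc m) ([:\<beta>, \<alpha>:] * q) T \<phi>
     = \<alpha> * hom_op ex ey (Suc m) (pCons 0 q) T \<phi> + \<beta> * hom_op ex ey (Suc m) q T \<phi>"
  proof -
    have "coeff ([:\<beta>, \<alpha>:] * q) i = \<alpha> * coeff (pCons 0 q) i + \<beta> * coeff q i" for i
      by (simp add: coeff_pCons split: nat.split)
    then show ?thesis
      unfolding hom_op_def by (simp only: distrib_right sum.distrib sum_distrib_left mult.assoc)
  qed
  ultimately show ?thesis by (simp add: cderiv_def x y)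
qed

lemma hom_op_cderiv_pow:
  assumes "degree q \<le> m" "smooth \<phi>" "\<And>\<phi>. smooth \<phi> \<Longrightarrow> S \<phi> = hom_op ex ey m q T \<phi>"
  shows "(cderiv ex ey \<alpha> \<beta> ^^ n) S \<phi> = hom_op ex ey (m + n) ([:\<beta>, \<alpha>:] ^ n * q) T \<phi>"
  using assms(2)
proof (induction n arbitrary: \<phi>)
  case 0
  then show ?case using assms by simp
next
  case (Suc n)
  have "degree ([:\<beta>, \<alpha>:] ^ n) \<le> degree [:\<beta>, \<alpha>:] * n" by (rule degree_power_le)
  also have "\<dots> \<le> n" by simp
  finally have "degree ([:\<beta>, \<alpha>:] ^ n * q) \<le> m + n"
    using assms(1) degree_mult_le[of "[:\<beta>, \<alpha>:] ^ n" q] by linarith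
  from hom_op_cderiv[OF this Suc.prems] cderiv_cong_smooth[OF Suc.IH Suc.prems]
  show ?case by (simp only: funpow.simps comp_apply power_Suc mult.assoc add_Suc_right)
qed

lemma cderiv_pow_pow:
  assumes "smooth \<phi>"
  shows "(cderiv ex ey \<alpha> \<beta> ^^ a) ((cderiv ex ey \<gamma> \<delta> ^^ b) T) \<phi>
    = hom_op ex ey (a + b) ([:\<beta>, \<alpha>:] ^ a * [:\<delta>, \<gamma>:] ^ b) T \<phi>"
proof -
  have 1: "(cderiv ex ey \<gamma> \<delta> ^^ b) T \<phi> = hom_op ex ey b ([:\<delta>, \<gamma>:] ^ b) T \<phi>" if "smooth \<phi>" for \<phi>
    using hom_op_cderiv_pow[where q = 1 and m = 0 and S = T and T = T and n = b] that
    by (simp add: hom_op_def)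
  have "degree ([:\<delta>, \<gamma>:] ^ b) \<le> degree [:\<delta>, \<gamma>:] * b" by (rule degree_power_le)
  also have "\<dots> \<le> b" by simp
  finally show ?thesis
    using hom_op_cderiv_pow[OF _ assms 1, where n = a] by (simp add: add.commute)
qed

text \<open>The linear polynomials \<open>X - \<i>\<close> and \<open>X + \<i>\<close> are the
  symbols of the two complex derivatives. Both 1 and \<open>X\<close> are combinations of them, and
  each induction step multiplies by one of these two combinations.\<close>

lemma monom_in_span_powers:
  "i \<le> m \<Longrightarrow> \<exists>c. monom 1 i = (\<Sum>a\<le>m. smult (c a) ([:- \<i>, 1:] ^ a * [:\<i>, 1:] ^ (m - a)))"
proof (induction m arbitrary: i)
  case 0
  then show ?case by (intro exI[of _ "\<lambda>_. 1"]) (simp add: monom_0 one_pCons)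
next
  case (Suc m)
  have lin: "\<exists>c. (\<alpha> * [:- \<i>, 1:] + \<beta> * [:\<i>, 1:]) * q = (\<Sum>a\<le>Suc m. smult (c a) ([:- \<i>, 1:] ^ a * [:\<i>, 1:] ^ (Suc m - a)))"
    if "q = (\<Sum>a\<le>m. smult (c a) ([:- \<i>, 1:] ^ a * [:\<i>, 1:] ^ (m - a)))" "\<alpha> = [:\<alpha>':]" "\<beta> = [:\<beta>':]" for \<alpha> \<beta> q c \<alpha>' \<beta>'
  proof -
    let ?p = "\<lambda>a b. [:- \<i>, 1:] ^ a * [:\<i>, 1:] ^ b"
    have "(\<alpha> * [:- \<i>, 1:] + \<beta> * [:\<i>, 1:]) * q
        = (\<Sum>a\<le>m. smult (\<alpha>' * c a) (?p (Suc a) (m - a))) + (\<Sum>a\<le>m. smult (\<beta>' * c a) (?p a (Suc m - a)))"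
      unfolding that sum_distrib_left sum.distrib[symmetric]
    proof (intro sum.cong refl)
      fix a assume "a \<in> {..m}"
      then have "[:\<i>, 1:] ^ (Suc m - a) = [:\<i>, 1:] * [:\<i>, 1:] ^ (m - a)"
        by (simp add: Suc_diff_le)
      moreover have "([:\<alpha>':] * A + [:\<beta>':] * B) * smult (c a) (P * Q)
        = smult (\<alpha>' * c a) ((A * P) * Q) + smult (\<beta>' * c a) (P * (B * Q))" for A B P Q
        by (simp add: algebra_simps smult_add_right)
      ultimately show "([:\<alpha>':] * [:- \<i>, 1:] + [:\<beta>':] * [:\<i>, 1:]) * smult (c a) (?p a (m - a)) =
         smult (\<alpha>' * c a) (?p (Suc a) (m - a)) + smult (\<beta>' * c a) (?p a (Suc m - a))"
        by (simp only: power_Suc)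
    qed
    also have "(\<Sum>a\<le>m. smult (\<alpha>' * c a) (?p (Suc a) (m - a)))
        = (\<Sum>a\<le>Suc m. smult (case a of 0 \<Rightarrow> 0 | Suc a \<Rightarrow> \<alpha>' * c a) (?p a (Suc m - a)))"
      by (subst sum.atMost_Suc_shift) simp
    also have "(\<Sum>a\<le>m. smult (\<beta>' * c a) (?p a (Suc m - a)))
        = (\<Sum>a\<le>Suc m. smult (if a \<le> m then \<beta>' * c a else 0) (?p a (Suc m - a)))"
      by simp
    finally show ?thesis
      unfolding sum.distrib[symmetric] smult_add_left[symmetric]
      by (intro exI[of _ "\<lambda>x. (case x of 0 \<Rightarrow> 0 | Suc a \<Rightarrow> \<alpha>' * c a) + (if x \<le> m then \<beta>' * c x else 0)"])
  qed
  show ?case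
  proof (cases i)
    case 0
    \<comment> \<open>Here \<open>1 = (\<i> / 2) (X - \<i>) - (\<i> / 2) (X + \<i>)\<close>; in the
      other case \<open>X\<close> is half the sum.\<close>
    obtain c where c: "monom 1 0 = (\<Sum>a\<le>m. smult (c a) ([:- \<i>, 1:] ^ a * [:\<i>, 1:] ^ (m - a)))"
      using Suc.IH[of 0] by auto
    show ?thesis
      using lin[OF c, of "[:\<i> / 2:]" "\<i> / 2" "[:- \<i> / 2:]" "- \<i> / 2"] 0 by (simp add: monom_0 one_pCons)
  next
    case (Suc i')
    then obtain c where c: "monom 1 i' = (\<Sum>a\<le>m. smult (c a) ([:- \<i>, 1:] ^ a * [:\<i>, 1:] ^ (m - a)))"
      using Suc.IH[of i'] Suc.prems by auto
    show ?thesis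
      using lin[OF c, of "[:1 / 2:]" "1 / 2" "[:1 / 2:]" "1 / 2"] Suc by (simp add: monom_Suc)
  qed
qed

section \<open>Euler operators on the meridian domain\<close>

lemma DERIV_inv_power:
  fixes x :: real
  assumes "0 < x"
  shows "((\<lambda>x. (1 / x) ^ n) has_real_derivative (- real n * (1 / x) ^ Suc n)) (at x)"
proof (rule DERIV_cong)
  have "((\<lambda>x. 1 / x) has_real_derivative - ((1 / x) * (1 / x))) (at x)"
    using assms by (auto intro!: derivative_eq_intros)
  then show "((\<lambda>x. (1 / x) ^ n) has_real_derivative
      real n * (- (1 / x * (1 / x)) * (1 / x) ^ (n - Suc 0))) (at x)"
    by (rule DERIV_power)
  show "real n * (- (1 / x * (1 / x)) * (1 / x) ^ (n - Suc 0)) = - real n * (1 / x) ^ Suc n"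
  proof (cases n)
    case (Suc n')
    show ?thesis unfolding Suc diff_Suc_Suc diff_zero
      by (simp only: power_Suc mult_minus_left mult_minus_right mult_ac)
  qed simp
qed

locale meridian_domain =
  fixes e :: "'b::euclidean_space" and \<Omega> :: "'b set"
  assumes e_Basis: "e \<in> Basis" and open_\<Omega>: "open \<Omega>" and \<Omega>_pos: "\<And>p. p \<in> \<Omega> \<Longrightarrow> 0 < p \<bullet> e"
begin

text \<open>Valid at every point of the space: where \<open>1 / r\<close> is singular,
  \<open>\<phi>\<close> vanishes in a neighbourhood.\<close>

lemma has_derivative_inv_power:
  assumes \<phi>: "\<phi> \<in> test_fun \<Omega>"
  shows "((\<lambda>p. complex_of_real ((1 / (p \<bullet> e)) ^ n) * \<phi> p) has_derivative
     (\<lambda>h. complex_of_real (- real n * (h \<bullet> e)) * (complex_of_real ((1 / (p \<bullet> e)) ^ Suc n) * \<phi> p)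
        + complex_of_real ((1 / (p \<bullet> e)) ^ n) * pd h \<phi> p)) (at p)"
proof -
  obtain K where K: "compact K" "K \<subseteq> \<Omega>" "\<And>x. x \<notin> K \<Longrightarrow> \<phi> x = 0"
    using test_funE[OF \<phi>] by metis
  show ?thesis
  proof (cases "p \<in> K")
    case True
    then have pos: "p \<bullet> e > 0" using K \<Omega>_pos by auto
    have "((\<lambda>p. (1 / (p \<bullet> e)) ^ n) has_derivative (\<lambda>h. - real n * (1 / (p \<bullet> e)) ^ Suc n * (h \<bullet> e))) (at p)"
      by (rule has_derivative_compose[where f = "\<lambda>p. p \<bullet> e" and g = "\<lambda>x. (1 / x) ^ n",
            OF _ DERIV_inv_power[OF pos, unfolded has_field_derivative_def]]) (auto intro!: derivative_eq_intros)
    then have "((\<lambda>p. complex_of_real ((1 / (p \<bullet> e)) ^ n)) has_derivative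
        (\<lambda>h. complex_of_real (- real n * (1 / (p \<bullet> e)) ^ Suc n * (h \<bullet> e)))) (at p)"
      by (rule has_derivative_of_real)
    from has_derivative_mult[OF this smooth_has_derivative[OF test_fun_smooth[OF \<phi>]]]
    show ?thesis
      by (rule has_derivative_eq_rhs) (auto simp: algebra_simps)
  next
    case False
    have "((\<lambda>p. complex_of_real ((1 / (p \<bullet> e)) ^ n) * \<phi> p) has_derivative (\<lambda>h. 0)) (at p)"
      using False K by (intro has_derivative_transform_within_open[OF has_derivative_const[of 0], of "- K"])
        (auto simp: compact_imp_closed open_Compl)
    then show ?thesis
      using False K pd_zero_off_compact[OF K(1,3) False] by simp
  qed
qed

text \<open>A derivative either raises \<open>n\<close> or falls on \<open>\<phi>\<close>, so the
  coinduction runs over all \<open>n\<close> and \<open>\<phi>\<close> simultaneously.\<close>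

lemma test_fun_inv_power:
  assumes "\<phi> \<in> test_fun \<Omega>"
  shows "(\<lambda>p. complex_of_real ((1 / (p \<bullet> e)) ^ n) * \<phi> p) \<in> test_fun \<Omega>"
proof (rule test_funI_subset[OF assms])
  define S where "S = {\<lambda>p. complex_of_real ((1 / (p \<bullet> e)) ^ n) * \<phi> p | n \<phi>. \<phi> \<in> test_fun \<Omega>}"
  show "smooth (\<lambda>p. complex_of_real ((1 / (p \<bullet> e)) ^ n) * \<phi> p)"
  proof (rule smooth_coinduct[of _ S])
    fix f assume "f \<in> S"
    then obtain n \<phi> where f: "f = (\<lambda>p. complex_of_real ((1 / (p \<bullet> e)) ^ n) * \<phi> p)" "\<phi> \<in> test_fun \<Omega>"
      by (auto simp: S_def)
    show "f differentiable at x" for x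
      unfolding f(1) using has_derivative_inv_power[OF f(2)] by (rule differentiableI)
    fix b :: 'b
    have mem: "(\<lambda>p. complex_of_real ((1 / (p \<bullet> e)) ^ n) * \<psi> p) \<in> S" if "\<psi> \<in> test_fun \<Omega>" for n \<psi>
      using that by (auto simp: S_def)
    have "pd b f = (\<lambda>p. complex_of_real (- real n * (b \<bullet> e)) * (complex_of_real ((1 / (p \<bullet> e)) ^ Suc n) * \<phi> p)
        + complex_of_real ((1 / (p \<bullet> e)) ^ n) * pd b \<phi> p)"
      unfolding f(1) using pd_eqI[OF has_derivative_inv_power[OF f(2)]] by blast
    also have "\<dots> \<in> smooth_span S"
      by (intro smooth_span.add smooth_span_cmult smooth_span.base mem test_fun_pd f(2))
    finally show "pd b f \<in> smooth_span S" .
  qed (use assms in \<open>auto simp: S_def\<close>)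
qed auto

lemma test_fun_radius:
  "\<phi> \<in> test_fun \<Omega> \<Longrightarrow> (\<lambda>p. complex_of_real (p \<bullet> e) * \<phi> p) \<in> test_fun \<Omega>"
  by (intro test_fun_smult smooth_bounded_linear bounded_linear_compose[OF bounded_linear_of_real]
        bounded_linear_inner_left)

definition euler :: "'b distr \<Rightarrow> 'b distr" where
  "euler S = dmult (\<lambda>p. p \<bullet> e) (dderiv e S)"

definition euler_mon :: "nat \<Rightarrow> nat \<Rightarrow> 'b distr \<Rightarrow> 'b distr" where
  "euler_mon m i T = dmult (\<lambda>p. (1 / (p \<bullet> e)) ^ m) ((euler ^^ i) T)"

definition euler_op :: "nat \<Rightarrow> real poly \<Rightarrow> 'b distr \<Rightarrow> 'b distr" where
  "euler_op m q T = (\<lambda>\<phi>. \<Sum>i\<le>degree q. of_real (coeff q i) * euler_mon m i T \<phi>)"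

lemma dlin_euler_pow: "dlin \<Omega> T \<Longrightarrow> dlin \<Omega> ((euler ^^ i) T)"
  by (induction i) (auto simp: euler_def intro!: dlin_dmult dlin_dderiv test_fun_radius)

lemma dlin_euler_mon: "dlin \<Omega> T \<Longrightarrow> dlin \<Omega> (euler_mon m i T)"
  unfolding euler_mon_def by (intro dlin_dmult dlin_euler_pow test_fun_inv_power)

text \<open>The commutation rule \<open>\<partial>\<^sub>r r\<^sup>-\<^sup>m =
  r\<^sup>-\<^sup>m\<^sup>-\<^sup>1 (r\<partial>\<^sub>r - m)\<close>. It is the reason why
  \<open>\<partial>\<^sub>r\<close> acts on symbols as multiplication by
  \<open>lin_fac m\<close>.\<close>

lemma dderiv_euler_mon:
  assumes T: "dlin \<Omega> T" and \<phi>: "\<phi> \<in> test_fun \<Omega>"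
  shows "dderiv e (euler_mon m i T) \<phi> = euler_mon (Suc m) (Suc i) T \<phi> - of_nat m * euler_mon (Suc m) i T \<phi>"
proof -
  define S where "S = (euler ^^ i) T"
  have S: "dlin \<Omega> S" unfolding S_def by (rule dlin_euler_pow[OF T])
  let ?g = "\<lambda>n \<phi> p. complex_of_real ((1 / (p \<bullet> e)) ^ n) * \<phi> p"
  have 1: "?g 1 (?g n \<phi>) = ?g (Suc n) \<phi>" for n by (simp add: mult_ac fun_eq_iff)
  have "(\<lambda>p. complex_of_real (p \<bullet> e) * (?g (Suc m) \<phi> p)) = ?g m \<phi>"
  proof
    fix p show "complex_of_real (p \<bullet> e) * (?g (Suc m) \<phi> p) = ?g m \<phi> p"
      using \<Omega>_pos[of p] test_fun_zero_outside[OF \<phi>, of p] by (cases "p \<bullet> e = 0") auto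
  qed
  then have "euler_mon (Suc m) (Suc i) T \<phi> = - S (pd e (?g m \<phi>))"
    by (simp add: euler_mon_def euler_def dmult_def dderiv_def S_def)
  also have "pd e (?g m \<phi>) = (\<lambda>p. ?g m (pd e \<phi>) p + (- of_nat m) * ?g (Suc m) \<phi> p)"
  proof
    fix p
    show "pd e (?g m \<phi>) p = ?g m (pd e \<phi>) p + (- of_nat m) * ?g (Suc m) \<phi> p"
      using pd_eqI[OF has_derivative_inv_power[OF \<phi>, of m p], of e] e_Basis by (simp add: algebra_simps)
  qed
  also have "- S \<dots> = - S (?g m (pd e \<phi>)) + of_nat m * S (?g (Suc m) \<phi>)"
    by (subst dlinD[OF S test_fun_inv_power[OF test_fun_pd[OF \<phi>]] test_fun_inv_power[OF \<phi>]]) simp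
  finally show ?thesis
    by (simp add: euler_mon_def dmult_def dderiv_def S_def)
qed

lemma dmult_euler_mon:
  "dmult (\<lambda>p. 1 / (p \<bullet> e)) (euler_mon m i T) \<phi> = euler_mon (Suc m) i T \<phi>"
  by (simp add: euler_mon_def dmult_def mult_ac)

lemma euler_op_degree_le:
  "degree q \<le> n \<Longrightarrow> euler_op m q T \<phi> = (\<Sum>i\<le>n. of_real (coeff q i) * euler_mon m i T \<phi>)"
  unfolding euler_op_def by (intro sum.mono_neutral_left) (auto simp: coeff_eq_0)

lemma euler_op_add: "euler_op m (p + q) T \<phi> = euler_op m p T \<phi> + euler_op m q T \<phi>"
proof -
  define n where "n = max (degree p) (degree q)"
  have "degree (p + q) \<le> n" "degree p \<le> n" "degree q \<le> n"
    by (auto simp: n_def degree_add_le_max)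
  then show ?thesis
    by (simp add: euler_op_degree_le[of _ n] sum.distrib algebra_simps)
qed

lemma euler_op_smult: "euler_op m (smult c q) T \<phi> = of_real c * euler_op m q T \<phi>"
  using degree_smult_le[of c q]
  by (simp add: euler_op_degree_le[of _ "degree q"] sum_distrib_left mult_ac)

lemma euler_op_sum: "euler_op m (\<Sum>i\<in>I. smult (c i) (F i)) T \<phi> = (\<Sum>i\<in>I. of_real (c i) * euler_op m (F i) T \<phi>)"
proof (induction I rule: infinite_finite_induct)
  case (insert x I)
  then show ?case by (simp add: euler_op_add euler_op_smult)
qed (simp_all add: euler_op_def)

lemma dlin_euler_op:
  assumes "dlin \<Omega> T" shows "dlin \<Omega> (euler_op m q T)"
  unfolding dlin_def euler_op_def
  using dlinD[OF dlin_euler_mon[OF assms]] by (simp add: sum.distrib sum_distrib_left algebra_simps)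

lemma dderiv_euler_op:
  assumes T: "dlin \<Omega> T" and \<phi>: "\<phi> \<in> test_fun \<Omega>"
  shows "dderiv e (euler_op m q T) \<phi> = euler_op (Suc m) (lin_fac (real m) * q) T \<phi>"
proof -
  let ?M = "\<lambda>i. euler_mon (Suc m) i T \<phi>"
  have "dderiv e (euler_op m q T) \<phi> = (\<Sum>i\<le>degree q. of_real (coeff q i) * dderiv e (euler_mon m i T) \<phi>)"
    by (simp add: dderiv_def euler_op_def sum_negf)
  also have "\<dots> = (\<Sum>i\<le>degree q. of_real (coeff q i) * ?M (Suc i)) - of_nat m * (\<Sum>i\<le>degree q. of_real (coeff q i) * ?M i)"
    by (simp add: dderiv_euler_mon[OF T \<phi>] sum_subtractf sum_distrib_left algebra_simps)
  also have "(\<Sum>i\<le>degree q. of_real (coeff q i) * ?M (Suc i)) = euler_op (Suc m) (pCons 0 q) T \<phi>"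
    using degree_pCons_le[of 0 q]
    by (simp add: euler_op_degree_le[of _ "Suc (degree q)"] sum.atMost_Suc_shift del: sum.atMost_Suc)
  also have "(\<Sum>i\<le>degree q. of_real (coeff q i) * ?M i) = euler_op (Suc m) q T \<phi>"
    by (simp add: euler_op_def)
  also have "euler_op (Suc m) (pCons 0 q) T \<phi> - of_nat m * euler_op (Suc m) q T \<phi>
      = euler_op (Suc m) (pCons 0 q + smult (- real m) q) T \<phi>"
    unfolding euler_op_add euler_op_smult by simp
  also have "pCons 0 q + smult (- real m) q = lin_fac (real m) * q"
    by (simp add: lin_fac_def)
  finally show ?thesis .
qed

lemma dmult_euler_op: "dmult (\<lambda>p. 1 / (p \<bullet> e)) (euler_op m q T) \<phi> = euler_op (Suc m) q T \<phi>"
  using dmult_euler_mon[of m _ T \<phi>] by (simp add: dmult_def euler_op_def)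

lemma dderiv_cong_test:
  "(\<And>\<phi>. \<phi> \<in> test_fun U \<Longrightarrow> S \<phi> = T \<phi>) \<Longrightarrow> \<phi> \<in> test_fun U \<Longrightarrow> dderiv v S \<phi> = dderiv v T \<phi>"
  by (simp add: dderiv_def test_fun_pd)

text \<open>Each derivative raises the index by one, so repeated differentiation collects
  consecutive roots.\<close>

lemma dderiv_pow_euler_op:
  assumes T: "dlin \<Omega> T" and S: "\<And>\<phi>. \<phi> \<in> test_fun \<Omega> \<Longrightarrow> S \<phi> = euler_op l q T \<phi>" and \<phi>: "\<phi> \<in> test_fun \<Omega>"
  shows "(dderiv e ^^ n) S \<phi> = euler_op (l + n) ((\<Prod>i\<in>{l..<l + n}. lin_fac (real i)) * q) T \<phi>"
  using \<phi>
proof (induction n arbitrary: \<phi>)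
  case 0
  then show ?case using S by simp
next
  case (Suc n)
  have "(dderiv e ^^ Suc n) S \<phi> = dderiv e (euler_op (l + n) ((\<Prod>i\<in>{l..<l + n}. lin_fac (real i)) * q) T) \<phi>"
    using dderiv_cong_test[OF Suc.IH Suc.prems] by simp
  also have "\<dots> = euler_op (l + Suc n) (lin_fac (real (l + n)) * ((\<Prod>i\<in>{l..<l + n}. lin_fac (real i)) * q)) T \<phi>"
    using dderiv_euler_op[OF T Suc.prems] by simp
  finally show ?case
    by (simp only: add_Suc_right prod.atLeastLessThan_Suc le_add1 mult_ac)
qed

lemma inv_power_euler_op:
  assumes T: "dlin \<Omega> T" and \<phi>: "\<phi> \<in> test_fun \<Omega>"
  shows "dmult (\<lambda>p. (c / (p \<bullet> e)) ^ l) T \<phi> = euler_op l [:c ^ l:] T \<phi>"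
proof -
  have "dmult (\<lambda>p. (c / (p \<bullet> e)) ^ l) T \<phi> = T (\<lambda>p. of_real (c ^ l) * (of_real ((1 / (p \<bullet> e)) ^ l) * \<phi> p))"
    by (simp add: dmult_def power_divide)
  also have "\<dots> = of_real (c ^ l) * T (\<lambda>p. of_real ((1 / (p \<bullet> e)) ^ l) * \<phi> p)"
    by (intro dlin_cmult[OF T] test_fun_inv_power \<phi>)
  finally show ?thesis
    by (simp add: euler_op_def euler_mon_def dmult_def)
qed

lemma W_term:
  assumes T: "dlin \<Omega> T" and \<phi>: "\<phi> \<in> test_fun \<Omega>" and l: "l \<le> m"
  shows "(dderiv e ^^ (m - l)) (dmult (\<lambda>p. (real k / (p \<bullet> e)) ^ l) T) \<phi> = euler_op m (W_poly k m l) T \<phi>"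
  using dderiv_pow_euler_op[where l = l and q = "[:real k ^ l:]" and n = "m - l",
      OF T inv_power_euler_op[OF T] \<phi>] l
  by (simp add: W_poly_def)

text \<open>The derivative and the division by \<open>r\<close> raise the index by one each, so the
  collected roots are spaced by two.\<close>

lemma inv_dderiv_pow_euler_op:
  assumes T: "dlin \<Omega> T" and S: "\<And>\<phi>. \<phi> \<in> test_fun \<Omega> \<Longrightarrow> S \<phi> = euler_op k q T \<phi>" and \<phi>: "\<phi> \<in> test_fun \<Omega>"
  shows "((\<lambda>T. dmult (\<lambda>p. 1 / (p \<bullet> e)) (dderiv e T)) ^^ l) S \<phi>
    = euler_op (k + 2 * l) ((\<Prod>j<l. lin_fac (real k + 2 * real j)) * q) T \<phi>"
  using \<phi>
proof (induction l arbitrary: \<phi>)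
  case 0
  then show ?case using S by simp
next
  case (Suc l)
  let ?q = "(\<Prod>j<l. lin_fac (real k + 2 * real j)) * q"
  have inv: "(\<lambda>p. complex_of_real (1 / (p \<bullet> e)) * \<phi> p) \<in> test_fun \<Omega>"
    using test_fun_inv_power[OF Suc.prems, of 1] by simp
  have "((\<lambda>T. dmult (\<lambda>p. 1 / (p \<bullet> e)) (dderiv e T)) ^^ Suc l) S \<phi>
     = dmult (\<lambda>p. 1 / (p \<bullet> e)) (dderiv e (euler_op (k + 2 * l) ?q T)) \<phi>"
    using dderiv_cong_test[OF Suc.IH inv] by (simp add: dmult_def)
  also have "\<dots> = dmult (\<lambda>p. 1 / (p \<bullet> e)) (euler_op (Suc (k + 2 * l)) (lin_fac (real (k + 2 * l)) * ?q) T) \<phi>"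
    using dderiv_euler_op[OF T inv] by (simp add: dmult_def)
  also have "\<dots> = euler_op (k + 2 * Suc l) (lin_fac (real (k + 2 * l)) * ?q) T \<phi>"
    by (simp only: dmult_euler_op) simp
  finally show ?case by (simp add: mult_ac)
qed

lemma X_term:
  assumes T: "dlin \<Omega> T" and \<phi>: "\<phi> \<in> test_fun \<Omega>" and l: "k + 2 * l \<le> m"
  shows "(dderiv e ^^ (m - k - 2 * l)) (((\<lambda>T. dmult (\<lambda>p. 1 / (p \<bullet> e)) (dderiv e T)) ^^ l)
      (dmult (\<lambda>p. (1 / (p \<bullet> e)) ^ k) T)) \<phi> = euler_op m (X_poly k m l) T \<phi>"
  using dderiv_pow_euler_op[where l = "k + 2 * l" and n = "m - k - 2 * l", OF T
      inv_dderiv_pow_euler_op[where k = k and l = l and q = "[:1 ^ k:]", OF T inv_power_euler_op[OF T]] \<phi>] l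
  by (simp add: X_poly_def mult.commute)

section \<open>Norms of Euler operators and the seminorms W and X\<close>

definition euler_norm :: "nat \<Rightarrow> real poly \<Rightarrow> 'b distr \<Rightarrow> ennreal" where
  "euler_norm m q T = distr_L2norm_sq (\<lambda>p. 2 * pi * (p \<bullet> e)) \<Omega> (euler_op m q T)"

lemma weight_radius: "weight_on \<Omega> (\<lambda>p. 2 * pi * (p \<bullet> e))"
  using \<Omega>_pos by (auto simp: weight_on_def intro!: continuous_intros)

lemma euler_norm_bspan:
  assumes "finite I" "bspan K I F q"
  shows "euler_norm m q T \<le> ennreal (real (card I) * (\<bar>K\<bar> + 1)\<^sup>2) * (\<Sum>i\<in>I. euler_norm m (F i) T)"
proof -
  obtain c where c: "\<And>i. i \<in> I \<Longrightarrow> \<bar>c i\<bar> \<le> K" "q = (\<Sum>i\<in>I. smult (c i) (F i))"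
    using assms(2) by (auto simp: bspan_def)
  show ?thesis
    unfolding euler_norm_def c(2)
    by (rule distr_L2norm_sq_sum_le[OF weight_radius open_\<Omega> assms(1), of "\<lambda>i. of_real (c i)"])
       (auto simp: c(1) euler_op_sum)
qed

lemma euler_norm_sum_bspan:
  assumes "finite I" "finite J" "\<And>j. j \<in> J \<Longrightarrow> bspan K I F (G j)"
  shows "(\<Sum>j\<in>J. euler_norm m (G j) T)
    \<le> ennreal (real (card J) * (real (card I) * (\<bar>K\<bar> + 1)\<^sup>2)) * (\<Sum>i\<in>I. euler_norm m (F i) T)"
proof -
  have "(\<Sum>j\<in>J. euler_norm m (G j) T)
     \<le> (\<Sum>j\<in>J. ennreal (real (card I) * (\<bar>K\<bar> + 1)\<^sup>2) * (\<Sum>i\<in>I. euler_norm m (F i) T))"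
    using assms by (intro sum_mono euler_norm_bspan)
  then show ?thesis
    by (simp add: ennreal_mult ennreal_of_nat_eq_real_of_nat mult_ac)
qed

text \<open>A reindexing: \<open>W\<close> supplies the indices up to the minimum of
  \<open>\<bar>k\<bar>\<close> and \<open>m\<close>, and \<open>X\<close>, shifted by
  \<open>\<bar>k\<bar>\<close>, supplies those above.\<close>

lemma W_X_sq_eq:
  assumes T: "dlin \<Omega> (distr_of \<Omega> w)"
  shows "W_sq (\<lambda>p. p \<bullet> e) e \<Omega> m k w + X_sq (\<lambda>p. p \<bullet> e) e \<Omega> m k w
    = (\<Sum>i\<le>WX_top (nat \<bar>k\<bar>) m. euler_norm m (WX_poly (nat \<bar>k\<bar>) m i) (distr_of \<Omega> w))"
proof -
  define n where "n = nat \<bar>k\<bar>"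
  let ?T = "distr_of \<Omega> w"
  have k: "real_of_int \<bar>k\<bar> = real n" by (simp add: n_def)
  have W: "W_sq (\<lambda>p. p \<bullet> e) e \<Omega> m k w = (\<Sum>i\<in>{0..min n m}. euler_norm m (WX_poly n m i) ?T)"
    unfolding W_sq_def n_def[symmetric] k distr_L21norm_sq_def euler_norm_def
    by (intro sum.cong refl distr_L2norm_sq_cong) (auto simp: WX_poly_def W_term[OF T])
  have idx: "{l. 1 \<le> l \<and> real l \<le> (real m - real n) / 2} = {l. 1 \<le> l \<and> n + 2 * l \<le> m}"
    by (auto simp: field_simps)
  have "X_sq (\<lambda>p. p \<bullet> e) e \<Omega> m k w = (\<Sum>l\<in>{l. 1 \<le> l \<and> n + 2 * l \<le> m}. euler_norm m (WX_poly n m (n + l)) ?T)"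
    unfolding X_sq_def n_def[symmetric] k distr_L21norm_sq_def euler_norm_def idx
    by (intro sum.cong refl distr_L2norm_sq_cong) (auto simp: WX_poly_def X_term[OF T, unfolded diff_diff_left])
  also have "\<dots> = (\<Sum>i\<in>(\<lambda>l. n + l) ` {l. 1 \<le> l \<and> n + 2 * l \<le> m}. euler_norm m (WX_poly n m i) ?T)"
    by (subst sum.reindex) (auto simp: inj_on_def)
  finally have X: "X_sq (\<lambda>p. p \<bullet> e) e \<Omega> m k w
     = (\<Sum>i\<in>(\<lambda>l. n + l) ` {l. 1 \<le> l \<and> n + 2 * l \<le> m}. euler_norm m (WX_poly n m i) ?T)" .
  have fin: "finite {l. 1 \<le> l \<and> n + 2 * l \<le> m}"
    by (rule finite_subset[of _ "{..m}"]) auto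
  have "{..WX_top n m} = {0..min n m} \<union> (\<lambda>l. n + l) ` {l. 1 \<le> l \<and> n + 2 * l \<le> m}"
  proof (cases "m \<le> n")
    case True
    then show ?thesis by (auto simp: WX_top_def)
  next
    case False
    have "(\<lambda>l. n + l) ` {l. 1 \<le> l \<and> n + 2 * l \<le> m} = {n<..n + (m - n) div 2}"
    proof safe
      fix i assume "i \<in> {n<..n + (m - n) div 2}"
      then show "i \<in> (\<lambda>l. n + l) ` {l. 1 \<le> l \<and> n + 2 * l \<le> m}"
        using False by (intro image_eqI[of _ _ "i - n"]) auto
    qed (use False in auto)
    then show ?thesis using False by (auto simp: WX_top_def)
  qed
  moreover have "{0..min n m} \<inter> (\<lambda>l. n + l) ` {l. 1 \<le> l \<and> n + 2 * l \<le> m} = {}"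
    by auto
  ultimately show ?thesis
    unfolding n_def[symmetric] W X
    by (simp only: sum.union_disjoint[OF finite_atLeastAtMost finite_imageI[OF fin]])
qed

text \<open>Changing the sign of the mode exchanges the two complex derivatives, which reverses the
  order of summation.\<close>

lemma sum_P_poly_abs:
  "(\<Sum>a\<le>m. euler_norm m (P_poly (real_of_int k) a (m - a)) T)
    = (\<Sum>a\<le>m. euler_norm m (P_poly (real (nat \<bar>k\<bar>)) a (m - a)) T)"
proof (cases "k \<ge> 0")
  case False
  then have "real_of_int k = - real (nat \<bar>k\<bar>)" by simp
  then show ?thesis
    by (simp only: P_poly_uminus) (intro sum.reindex_bij_witness[of _ "\<lambda>i. m - i" "\<lambda>i. m - i"]; simp)
qed simp

end

section \<open>Cylindrical coordinates and Fourier modes\<close>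

text \<open>\<open>J\<close> extracts the longitudinal coordinates of a point of the axisymmetric domain, \<open>\<kappa>\<close> puts them
  back; in dimension two both vanish. The last assumption is integration in polar coordinates.\<close>

locale cylindrical =
  fixes ex ey :: "'a::euclidean_space" and e :: "'b::euclidean_space"
    and J :: "'a \<Rightarrow> 'b" and \<kappa> :: "'b \<Rightarrow> 'a"
  assumes ex: "ex \<in> Basis" and ey: "ey \<in> Basis" and ex_ey: "ex \<noteq> ey" and e_Basis': "e \<in> Basis"
    and J: "bounded_linear J" and \<kappa>: "bounded_linear \<kappa>"
    and J_e: "\<And>x. J x \<bullet> e = 0"
    and \<kappa>_ex: "\<And>p. \<kappa> p \<bullet> ex = 0" and \<kappa>_ey: "\<And>p. \<kappa> p \<bullet> ey = 0"
    and \<kappa>_J: "\<And>x. \<kappa> (J x) = x - (x \<bullet> ex) *\<^sub>R ex - (x \<bullet> ey) *\<^sub>R ey"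
    and J_\<kappa>: "\<And>p. J (\<kappa> p) = p - (p \<bullet> e) *\<^sub>R e"
    and J_ex: "J ex = 0" and J_ey: "J ey = 0"
    and nn_integral_cylindrical: "\<And>f. f \<in> borel_measurable borel \<Longrightarrow>
      integral\<^sup>N lborel f = (\<integral>\<^sup>+p. \<integral>\<^sup>+t. ennreal (p \<bullet> e) * indicator {0<..} (p \<bullet> e) * indicator {0..2 * pi} t
        * f ((p \<bullet> e * cos t) *\<^sub>R ex + (p \<bullet> e * sin t) *\<^sub>R ey + \<kappa> p) \<partial>lborel \<partial>lborel)"
begin

definition pol :: "real \<Rightarrow> 'b \<Rightarrow> 'a" where
  "pol t p = (p \<bullet> e * cos t) *\<^sub>R ex + (p \<bullet> e * sin t) *\<^sub>R ey + \<kappa> p"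

definition zc :: "'a \<Rightarrow> complex" where "zc x = Complex (x \<bullet> ex) (x \<bullet> ey)"

definition rad :: "'a \<Rightarrow> real" where "rad x = cmod (zc x)"

text \<open>The point of the closed meridian half-plane on the same rotation orbit as
  \<open>x\<close>; \<open>pol\<close> restores the angle.\<close>

definition mer :: "'a \<Rightarrow> 'b" where "mer x = rad x *\<^sub>R e + J x"

definition lift :: "int \<Rightarrow> ('b \<Rightarrow> complex) \<Rightarrow> 'a \<Rightarrow> complex" where
  "lift n w x = cis (real_of_int n * Arg (zc x)) * w (mer x)"

lemma orthonormal [simp]:
  "ex \<bullet> ex = 1" "ey \<bullet> ey = 1" "e \<bullet> e = 1" "ex \<bullet> ey = 0" "ey \<bullet> ex = 0"
  using ex ey ex_ey e_Basis' by (auto simp: inner_Basis)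

lemma mer_e [simp]: "mer x \<bullet> e = rad x"
  by (simp add: mer_def inner_add_left J_e)

lemma pol_ex [simp]: "pol t p \<bullet> ex = p \<bullet> e * cos t" and pol_ey [simp]: "pol t p \<bullet> ey = p \<bullet> e * sin t"
  by (simp_all add: pol_def inner_add_left \<kappa>_ex \<kappa>_ey)

lemma zc_pol: "zc (pol t p) = of_real (p \<bullet> e) * cis t"
  by (simp add: zc_def complex_eq_iff)

lemma rad_pol: "0 \<le> p \<bullet> e \<Longrightarrow> rad (pol t p) = p \<bullet> e"
  by (simp add: rad_def zc_pol norm_mult)

lemma J_pol: "J (pol t p) = p - (p \<bullet> e) *\<^sub>R e"
  using J by (simp add: pol_def linear_simps J_ex J_ey J_\<kappa>)

lemma mer_pol: "0 \<le> p \<bullet> e \<Longrightarrow> mer (pol t p) = p"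
  by (simp add: mer_def rad_pol J_pol)

lemma zc_Arg: "zc x = of_real (rad x) * cis (Arg (zc x))"
  using rcis_cmod_Arg[of "zc x"] by (simp add: rcis_def rad_def)

lemma \<kappa>_e: "\<kappa> e = 0"
proof -
  have "\<kappa> e = \<kappa> (J (\<kappa> e))" using \<kappa>_J[of "\<kappa> e"] by (simp add: \<kappa>_ex \<kappa>_ey)
  also have "J (\<kappa> e) = 0" by (simp add: J_\<kappa>)
  finally show ?thesis using \<kappa> by (simp add: linear_simps)
qed

lemma pol_mer: "pol (Arg (zc x)) (mer x) = x"
proof -
  have "rad x * cos (Arg (zc x)) = x \<bullet> ex" "rad x * sin (Arg (zc x)) = x \<bullet> ey"
    using zc_Arg[of x] by (auto simp: zc_def complex_eq_iff)
  then show ?thesis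
    using \<kappa> by (simp add: pol_def) (simp add: mer_def linear_simps \<kappa>_e \<kappa>_J)
qed

lemma lift_pol:
  assumes "0 < p \<bullet> e"
  shows "lift n w (pol t p) = cis (real_of_int n * t) * w p"
proof -
  have "zc (pol t p) \<noteq> 0" using assms by (simp add: zc_pol)
  then have "cis (Arg (zc (pol t p))) = cis t"
    using assms by (simp add: cis_Arg zc_pol sgn_mult sgn_of_real)
  then have "cis (real_of_int n * Arg (zc (pol t p))) = cis (real_of_int n * t)"
    by (metis cis_power_int)
  then show ?thesis using assms by (simp add: lift_def mer_pol)
qed

lemma zc_bounded_linear: "bounded_linear zc"
  unfolding zc_def Complex_eq
  by (intro bounded_linear_add bounded_linear_compose[OF bounded_linear_of_real]
       bounded_linear_const_mult[OF bounded_linear_compose[OF bounded_linear_of_real]] bounded_linear_inner_left)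

lemma continuous_rad [continuous_intros]: "continuous_on A f \<Longrightarrow> continuous_on A (\<lambda>x. rad (f x))"
  unfolding rad_def by (intro continuous_intros bounded_linear.continuous_on[OF zc_bounded_linear])

lemma continuous_mer [continuous_intros]: "continuous_on A f \<Longrightarrow> continuous_on A (\<lambda>x. mer (f x))"
  unfolding mer_def by (intro continuous_intros bounded_linear.continuous_on[OF J])

lemma continuous_pol [continuous_intros]:
  fixes f :: "'c::t2_space \<Rightarrow> real"
  shows "continuous_on A f \<Longrightarrow> continuous_on A g \<Longrightarrow> continuous_on A (\<lambda>x. pol (f x) (g x))"
  unfolding pol_def by (intro continuous_intros bounded_linear.continuous_on[OF \<kappa>])

lemma pol_bounded_linear: "bounded_linear (pol t)"
  unfolding pol_def
  by (intro bounded_linear_add \<kappa> bounded_linear_scaleR_const bounded_linear_mult_const bounded_linear_inner_left)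

lemma has_derivative_rad:
  assumes "rad x > 0"
  shows "(rad has_derivative (\<lambda>h. (x \<bullet> ex * (h \<bullet> ex) + x \<bullet> ey * (h \<bullet> ey)) / rad x)) (at x)"
proof -
  have rad: "rad = (\<lambda>x. sqrt ((x \<bullet> ex)\<^sup>2 + (x \<bullet> ey)\<^sup>2))"
    by (simp add: rad_def zc_def fun_eq_iff cmod_def)
  define g where "g = (\<lambda>x. (x \<bullet> ex)\<^sup>2 + (x \<bullet> ey)\<^sup>2)"
  have "sqrt (g x) > 0" using assms by (simp add: rad g_def)
  then have pos: "g x > 0" by simp
  have "(g has_derivative (\<lambda>h. 2 * (x \<bullet> ex * (h \<bullet> ex) + x \<bullet> ey * (h \<bullet> ey)))) (at x)"
  proof -
    have I: "((\<lambda>x. x \<bullet> v) has_derivative (\<lambda>h. h \<bullet> v)) (at x)" for v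
      by (rule bounded_linear_imp_has_derivative[OF bounded_linear_inner_left])
    show ?thesis
      unfolding g_def power2_eq_square
      by (rule has_derivative_eq_rhs[OF has_derivative_add[OF has_derivative_mult[OF I I] has_derivative_mult[OF I I]]])
         (auto simp: fun_eq_iff distrib_left mult.assoc)
  qed
  from has_derivative_compose[OF this DERIV_real_sqrt[OF pos, unfolded has_field_derivative_def]]
  have "((\<lambda>x. sqrt (g x)) has_derivative (\<lambda>h. (x \<bullet> ex * (h \<bullet> ex) + x \<bullet> ey * (h \<bullet> ey)) / sqrt (g x))) (at x)"
    by (rule has_derivative_eq_rhs) (rule ext, simp only: divide_inverse, simp)
  then show ?thesis unfolding rad g_def .
qed

text \<open>The map \<open>mer\<close> is not differentiable on the axis, but
  \<open>\<psi> (mer x)\<close> vanishes near it. The denominator of the derivative of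
  \<open>r\<close> is attached to \<open>pd e \<psi>\<close>, written as a power with exponent 1 to
  fit \<open>test_fun_inv_power\<close>; the coefficient left over is then linear in
  \<open>x\<close>, hence smooth.\<close>

lemma has_derivative_comp_mer:
  assumes D: "\<And>p. p \<in> D \<Longrightarrow> 0 < p \<bullet> e" and \<psi>: "\<psi> \<in> test_fun D"
  shows "((\<lambda>x. \<psi> (mer x)) has_derivative
    (\<lambda>h. of_real (x \<bullet> ex * (h \<bullet> ex) + x \<bullet> ey * (h \<bullet> ey)) * (of_real ((1 / (mer x \<bullet> e)) ^ 1) * pd e \<psi> (mer x))
      + pd (J h) \<psi> (mer x))) (at x)"
proof -
  obtain K where K: "compact K" "K \<subseteq> D" "\<And>x. x \<notin> K \<Longrightarrow> \<psi> x = 0"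
    using test_funE[OF \<psi>] by metis
  note lin = pd_linear[OF test_fun_smooth[OF \<psi>], of "mer x"]
  show ?thesis
  proof (cases "mer x \<in> K")
    case True
    then have r: "rad x > 0" using K(2) D[of "mer x"] by auto
    have "(mer has_derivative (\<lambda>h. ((x \<bullet> ex * (h \<bullet> ex) + x \<bullet> ey * (h \<bullet> ey)) / rad x) *\<^sub>R e + J h)) (at x)"
      unfolding mer_def
      by (intro has_derivative_add has_derivative_scaleR_left has_derivative_rad[OF r]
          bounded_linear_imp_has_derivative J)
    from has_derivative_compose[OF this smooth_has_derivative[OF test_fun_smooth[OF \<psi>]]]
    show ?thesis
      by (rule has_derivative_eq_rhs)
         (simp add: linear_add[OF lin] linear_scale[OF lin] fun_eq_iff scaleR_conv_of_real)
  next
    case False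
    have "open (mer -` (- K))"
      using K(1) by (intro open_vimage) (auto intro: continuous_intros simp: compact_imp_closed open_Compl)
    then have "((\<lambda>x. \<psi> (mer x)) has_derivative (\<lambda>h. 0)) (at x)"
      using False K(3) by (intro has_derivative_transform_within_open[OF has_derivative_const[of 0], of "mer -` (- K)"]) auto
    then show ?thesis
      using pd_zero_off_compact[OF K(1,3) False] by simp
  qed
qed

end

locale axisymmetric_domain = cylindrical ex ey e J \<kappa>
  for ex ey :: "'a::euclidean_space" and e :: "'b::euclidean_space" and J \<kappa> +
  fixes U :: "'a set"
  assumes open_U: "open U" and axisymmetric: "\<And>s t p. pol s p \<in> U \<Longrightarrow> pol t p \<in> U"
begin

definition \<Omega> :: "'b set" where "\<Omega> = {p. 0 < p \<bullet> e \<and> pol 0 p \<in> U}"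

definition U' :: "'a set" where "U' = {x \<in> U. 0 < rad x}"

lemma open_\<Omega>': "open \<Omega>"
proof -
  have "open {p. 0 < p \<bullet> e}" by (intro open_Collect_less continuous_intros)
  moreover have "open ((\<lambda>p. pol 0 p) -` U)"
    using open_U by (intro open_vimage) (auto intro!: continuous_intros)
  ultimately show ?thesis
    unfolding \<Omega>_def by (simp add: Collect_conj_eq vimage_def open_Int)
qed

lemma open_U': "open U'"
proof -
  have "open {x. 0 < rad x}" by (intro open_Collect_less continuous_intros)
  with open_U show ?thesis unfolding U'_def by (simp add: Collect_conj_eq open_Int)
qed

sublocale meridian_domain e \<Omega>
  using e_Basis' open_\<Omega>' by unfold_locales (auto simp: \<Omega>_def)

lemma pol_in_U': "pol t p \<in> U' \<longleftrightarrow> p \<in> \<Omega>" if "0 < p \<bullet> e"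
  using that axisymmetric by (auto simp: U'_def \<Omega>_def rad_pol)

lemma mer_in_\<Omega>: "mer x \<in> \<Omega> \<longleftrightarrow> x \<in> U'"
proof (cases "rad x > 0")
  case True
  then show ?thesis using pol_in_U'[of "mer x" "Arg (zc x)"] by (simp add: pol_mer)
qed (auto simp: U'_def \<Omega>_def)

section \<open>Test functions lifted from the meridian domain\<close>

lemma smooth_comp_mer:
  assumes "\<psi> \<in> test_fun \<Omega>" shows "smooth (\<lambda>x. \<psi> (mer x))"
proof -
  define S where "S = {\<lambda>x. \<psi> (mer x) | \<psi>. \<psi> \<in> test_fun \<Omega>}"
  have mem: "(\<lambda>x. \<psi> (mer x)) \<in> S" if "\<psi> \<in> test_fun \<Omega>" for \<psi> using that by (auto simp: S_def)
  show ?thesis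
  proof (rule smooth_coinduct[of _ S])
    fix f assume "f \<in> S"
    then obtain \<psi> where f: "f = (\<lambda>x. \<psi> (mer x))" "\<psi> \<in> test_fun \<Omega>" by (auto simp: S_def)
    note der = has_derivative_comp_mer[OF \<Omega>_pos f(2)]
    show "f differentiable at x" for x
      unfolding f(1) using der by (rule differentiableI)
    fix b :: 'a
    define \<psi>1 where "\<psi>1 = (\<lambda>p. complex_of_real ((1 / (p \<bullet> e)) ^ 1) * pd e \<psi> p)"
    have "pd b f = (\<lambda>x. of_real (x \<bullet> ex * (b \<bullet> ex) + x \<bullet> ey * (b \<bullet> ey)) * \<psi>1 (mer x) + pd (J b) \<psi> (mer x))"
      unfolding f(1) \<psi>1_def using pd_eqI[OF der] by blast
    also have "\<dots> \<in> smooth_span S"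
    proof (intro smooth_span.add smooth_span.mult smooth_span.base mem)
      show "smooth (\<lambda>x. complex_of_real (x \<bullet> ex * (b \<bullet> ex) + x \<bullet> ey * (b \<bullet> ey)))"
        by (intro smooth_bounded_linear bounded_linear_compose[OF bounded_linear_of_real] bounded_linear_add
            bounded_linear_mult_const bounded_linear_inner_left)
      show "\<psi>1 \<in> test_fun \<Omega>"
        unfolding \<psi>1_def by (intro test_fun_inv_power test_fun_pd f(2))
      show "pd (J b) \<psi> \<in> test_fun \<Omega>" by (intro test_fun_pd f(2))
    qed
    finally show "pd b f \<in> smooth_span S" .
  qed (use assms mem in auto)
qed

text \<open>\<open>Arg\<close> jumps across a ray, so the smoothness of a lift is not visible from
  its definition. Off the axis the phase is a power of \<open>\<zeta> / r\<close> or of its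
  conjugate: the numerator is a polynomial in the coordinates, and the powers of
  \<open>1 / r\<close> are absorbed by \<open>\<psi>\<close>.\<close>

lemma lift_phase:
  assumes \<psi>: "\<And>p. p \<bullet> e \<le> 0 \<Longrightarrow> \<psi> p = 0"
  shows "lift n \<psi> x = (if 0 \<le> n then zc x ^ nat n else cnj (zc x) ^ nat (- n))
      * (complex_of_real ((1 / (mer x \<bullet> e)) ^ nat \<bar>n\<bar>) * \<psi> (mer x))"
proof (cases "rad x > 0")
  case True
  let ?a = "Arg (zc x)"
  have "zc x ^ nat n = of_real (rad x ^ nat n) * cis (real_of_int n * ?a)" if "n \<ge> 0"
    using that by (subst zc_Arg) (simp add: power_mult_distrib Complex.DeMoivre)
  moreover have "cnj (zc x) ^ nat (- n) = of_real (rad x ^ nat (- n)) * cis (real_of_int n * ?a)" if "n < 0"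
  proof -
    have "cnj (zc x) = of_real (rad x) * cis (- ?a)"
      by (subst zc_Arg) (simp add: cis_cnj)
    then show ?thesis using that by (simp add: power_mult_distrib Complex.DeMoivre)
  qed
  ultimately show ?thesis using True by (auto simp: lift_def power_divide)
next
  case False
  then have "\<psi> (mer x) = 0" by (intro \<psi>) simp
  then show ?thesis by (simp add: lift_def)
qed

lemma test_fun_lift:
  assumes \<psi>: "\<psi> \<in> test_fun \<Omega>"
  shows "lift n \<psi> \<in> test_fun U'"
proof -
  obtain K where K: "compact K" "K \<subseteq> \<Omega>" "\<And>x. x \<notin> K \<Longrightarrow> \<psi> x = 0"
    using test_funE[OF \<psi>] by metis
  have z: "\<psi> p = 0" if "p \<bullet> e \<le> 0" for p
    using K \<Omega>_pos[of p] that by force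
  have cnj: "bounded_linear (\<lambda>x. cnj (zc x))"
    by (intro bounded_linear_compose[OF bounded_linear_cnj] zc_bounded_linear)
  have sm: "smooth (\<lambda>x. if 0 \<le> n then zc x ^ nat n else cnj (zc x) ^ nat (- n))"
    using smooth_power[OF smooth_bounded_linear[OF zc_bounded_linear], of "nat n"]
      smooth_power[OF smooth_bounded_linear[OF cnj], of "nat (- n)"] by (cases "0 \<le> n") simp_all
  show ?thesis
  proof (rule test_funI_closed[of _ "(\<lambda>(t, p). pol t p) ` ({-pi..pi} \<times> K)"])
    show "smooth (lift n \<psi>)"
    proof -
      have "lift n \<psi> = (\<lambda>x. (if 0 \<le> n then zc x ^ nat n else cnj (zc x) ^ nat (- n))
          * (complex_of_real ((1 / (mer x \<bullet> e)) ^ nat \<bar>n\<bar>) * \<psi> (mer x)))"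
        by (rule ext, rule lift_phase[OF z])
      then show ?thesis
        using smooth_mult[OF sm smooth_comp_mer[OF test_fun_inv_power[OF \<psi>]]] by (simp only:)
    qed
    show "compact ((\<lambda>(t, p). pol t p) ` ({-pi..pi} \<times> K))"
      by (intro compact_continuous_image compact_Times K(1)) (auto simp: case_prod_beta intro!: continuous_intros)
    show "(\<lambda>(t, p). pol t p) ` ({-pi..pi} \<times> K) \<subseteq> U'"
      using K(2) \<Omega>_pos pol_in_U' by auto
    fix x assume x: "x \<notin> (\<lambda>(t, p). pol t p) ` ({-pi..pi} \<times> K)"
    have "mer x \<notin> K"
    proof
      assume "mer x \<in> K"
      moreover have "Arg (zc x) \<in> {-pi..pi}" using Arg_bounded[of "zc x"] by auto
      ultimately have "(\<lambda>(t, p). pol t p) (Arg (zc x), mer x) \<in> (\<lambda>(t, p). pol t p) ` ({-pi..pi} \<times> K)"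
        by (intro imageI) auto
      with x show False by (simp add: pol_mer)
    qed
    then show "lift n \<psi> x = 0" by (simp add: lift_def K(3))
  qed
qed

text \<open>As \<open>pol t p\<close> makes sense for negative radii too, the integral alone would not vanish outside \<open>\<Omega>\<close>.\<close>

definition mode :: "int \<Rightarrow> ('a \<Rightarrow> complex) \<Rightarrow> 'b \<Rightarrow> complex" where
  "mode n \<phi> p = (if 0 < p \<bullet> e then integral {0..2 * pi} (\<lambda>t. cis (real_of_int n * t) * \<phi> (pol t p)) else 0)"

lemma continuous_cis [continuous_intros]: "continuous_on A f \<Longrightarrow> continuous_on A (\<lambda>x. cis (f x))"
  unfolding cis_conv_exp by (intro continuous_intros)

lemma mode_integrable:
  assumes "smooth \<phi>" shows "(\<lambda>t. cis (c * t) * \<phi> (pol t p)) integrable_on {0..2 * pi}"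
proof -
  have "continuous_on {0..2 * pi} (\<lambda>t. \<phi> (pol t p))"
    by (rule continuous_on_compose2[OF smooth_continuous[OF assms]]) (auto intro!: continuous_intros)
  then show ?thesis by (intro integrable_continuous_interval continuous_intros)
qed

lemma mode_add: "smooth \<phi> \<Longrightarrow> smooth \<psi> \<Longrightarrow> mode n (\<lambda>x. \<phi> x + \<psi> x) p = mode n \<phi> p + mode n \<psi> p"
  using mode_integrable[of \<phi> "real_of_int n" p] mode_integrable[of \<psi> "real_of_int n" p]
  by (simp add: mode_def distrib_left integral_add)

lemma mode_cmult: "mode n (\<lambda>x. c * \<phi> x) p = c * mode n \<phi> p"
  by (simp add: mode_def mult.left_commute[of _ c])

lemma mode_support:
  assumes "\<phi> \<in> test_fun U'"
  obtains K where "compact K" "K \<subseteq> \<Omega>" "\<And>n p. p \<notin> K \<Longrightarrow> mode n \<phi> p = 0"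
    "\<And>t p. 0 < p \<bullet> e \<Longrightarrow> p \<notin> K \<Longrightarrow> \<phi> (pol t p) = 0"
proof -
  obtain K where K: "compact K" "K \<subseteq> U'" "\<And>x. x \<notin> K \<Longrightarrow> \<phi> x = 0"
    using test_funE[OF assms] by metis
  have *: "\<phi> (pol t p) = 0" if "0 < p \<bullet> e" "p \<notin> mer ` K" for t p
    using that K(3) mer_pol[of p t] by (metis image_eqI less_imp_le)
  show ?thesis
  proof
    show "compact (mer ` K)"
      using K(1) by (intro compact_continuous_image continuous_intros)
    show "mer ` K \<subseteq> \<Omega>" using K(2) by (auto simp: mer_in_\<Omega>)
    show "mode n \<phi> p = 0" if "p \<notin> mer ` K" for n p
      using * that by (simp add: mode_def)
  qed (use * in auto)
qed

lemma pd_pol: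
  assumes "smooth \<phi>"
  shows "pd (pol t v) \<phi> x = of_real (v \<bullet> e * cos t) * pd ex \<phi> x + of_real (v \<bullet> e * sin t) * pd ey \<phi> x + pd (\<kappa> v) \<phi> x"
  using pd_linear[OF assms, of x] by (simp add: pol_def linear_add linear_scale scaleR_conv_of_real)

lemma has_derivative_mode:
  assumes \<phi>: "\<phi> \<in> test_fun U'"
  shows "(mode n \<phi> has_derivative (\<lambda>h. if 0 < p \<bullet> e
    then integral {0..2 * pi} (\<lambda>t. cis (real_of_int n * t) * pd (pol t h) \<phi> (pol t p)) else 0)) (at p)"
proof -
  obtain K where K: "compact K" "K \<subseteq> \<Omega>" "\<And>n p. p \<notin> K \<Longrightarrow> mode n \<phi> p = 0"
    using mode_support[OF \<phi>] by metis
  note sm = test_fun_smooth[OF \<phi>]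
  show ?thesis
  proof (cases "0 < p \<bullet> e")
    case True
    define fx where "fx p t = Blinfun (\<lambda>h. cis (real_of_int n * t) * pd (pol t h) \<phi> (pol t p))" for p t
    have der: "((\<lambda>p. cis (real_of_int n * t) * \<phi> (pol t p)) has_derivative
        (\<lambda>h. cis (real_of_int n * t) * pd (pol t h) \<phi> (pol t p))) (at p)" for p t
      by (intro has_derivative_mult_right has_derivative_compose[OF _ smooth_has_derivative[OF sm]]
            bounded_linear_imp_has_derivative pol_bounded_linear)
    have fx: "blinfun_apply (fx p t) = (\<lambda>h. cis (real_of_int n * t) * pd (pol t h) \<phi> (pol t p))" for p t
      unfolding fx_def by (intro bounded_linear_Blinfun_apply has_derivative_bounded_linear[OF der])
    have cont: "continuous_on UNIV (\<lambda>x. pd v \<phi> x)" for v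
      by (intro smooth_continuous smooth_pd sm)
    have fx_cont: "continuous_on (UNIV \<times> cbox 0 (2 * pi)) (\<lambda>(p, t). fx p t)"
      unfolding case_prod_beta
      by (rule continuous_on_blinfun_componentwise)
         (auto simp: fx pd_pol[OF sm] intro!: continuous_intros continuous_on_compose2[OF cont])
    have L: "((\<lambda>p. integral (cbox 0 (2 * pi)) (\<lambda>t. cis (real_of_int n * t) * \<phi> (pol t p))) has_derivative
      integral (cbox 0 (2 * pi)) (fx p)) (at p within UNIV)"
      using mode_integrable[OF sm, of "real_of_int n"] der
      by (intro leibniz_rule[OF _ _ fx_cont]) (auto simp: fx)
    have "fx p integrable_on cbox 0 (2 * pi)"
      by (intro integrable_continuous continuous_on_compose2[OF fx_cont, of _ "\<lambda>t. (p, t)", simplified] continuous_intros) auto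
    then have "blinfun_apply (integral (cbox 0 (2 * pi)) (fx p)) = (\<lambda>h. integral (cbox 0 (2 * pi)) (\<lambda>t. fx p t h))"
      by (intro ext blinfun_apply_integral)
    then have L': "((\<lambda>p. integral {0..2 * pi} (\<lambda>t. cis (real_of_int n * t) * \<phi> (pol t p))) has_derivative
        (\<lambda>h. integral {0..2 * pi} (\<lambda>t. cis (real_of_int n * t) * pd (pol t h) \<phi> (pol t p)))) (at p)"
      using L by (simp add: fx)
    have op: "open {p. 0 < p \<bullet> e}" by (intro open_Collect_less continuous_intros)
    show ?thesis
      using True by (auto intro!: has_derivative_transform_within_open[OF L' op] simp: mode_def)
  next
    case False
    then have "p \<notin> K" using K(2) \<Omega>_pos by auto
    then have "(mode n \<phi> has_derivative (\<lambda>h. 0)) (at p)"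
      using K by (intro has_derivative_transform_within_open[OF has_derivative_const[of 0], of "- K"])
        (auto simp: compact_imp_closed open_Compl)
    then show ?thesis using False by simp
  qed
qed

lemma pd_mode:
  assumes "\<phi> \<in> test_fun U'"
  shows "pd v (mode n \<phi>) p = (if 0 < p \<bullet> e
    then integral {0..2 * pi} (\<lambda>t. cis (real_of_int n * t) * pd (pol t v) \<phi> (pol t p)) else 0)"
  by (rule pd_eqI[OF has_derivative_mode[OF assms]])

text \<open>Multiplication by \<open>cos t\<close> and \<open>sin t\<close> shifts the mode by one.
  Derivatives of modes are thus constant combinations of modes of test functions, which closes the
  family in the coinduction for \<open>test_fun_mode\<close>.\<close>

lemma pd_mode_expand:
  assumes \<phi>: "\<phi> \<in> test_fun U'"
  shows "pd v (mode n \<phi>) = (\<lambda>p. of_real (v \<bullet> e / 2) * (mode (n + 1) (\<lambda>x. pd ex \<phi> x + - \<i> * pd ey \<phi> x) p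
     + mode (n - 1) (\<lambda>x. pd ex \<phi> x + \<i> * pd ey \<phi> x) p) + mode n (pd (\<kappa> v) \<phi>) p)"
proof
  fix p
  note sm = test_fun_smooth[OF \<phi>]
  let ?A = "\<lambda>x. pd ex \<phi> x + - \<i> * pd ey \<phi> x" and ?B = "\<lambda>x. pd ex \<phi> x + \<i> * pd ey \<phi> x"
  show "pd v (mode n \<phi>) p = of_real (v \<bullet> e / 2) * (mode (n + 1) ?A p + mode (n - 1) ?B p) + mode n (pd (\<kappa> v) \<phi>) p"
  proof (cases "0 < p \<bullet> e")
    case True
    have smAB: "smooth ?A" "smooth ?B" by (intro smooth_add smooth_cmult smooth_pd sm)+
    have "cis (real_of_int n * t) * pd (pol t v) \<phi> x
      = of_real (v \<bullet> e / 2) * (cis (real_of_int (n + 1) * t) * ?A x + cis (real_of_int (n - 1) * t) * ?B x)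
        + cis (real_of_int n * t) * pd (\<kappa> v) \<phi> x" for t x
    proof -
      define a b c where "a = pd ex \<phi> x" and "b = pd ey \<phi> x" and "c = pd (\<kappa> v) \<phi> x"
      have p1: "cis (real_of_int (n + 1) * t) = cis (real_of_int n * t) * (of_real (cos t) + \<i> * of_real (sin t))"
        and m1: "cis (real_of_int (n - 1) * t) = cis (real_of_int n * t) * (of_real (cos t) - \<i> * of_real (sin t))"
        using cis_mult[of "real_of_int n * t" t] cis_divide[of "real_of_int n * t" t]
          cis_mult[of "real_of_int n * t" "- t"]
        by (simp_all add: cis.code Complex_eq algebra_simps)
      show ?thesis
        unfolding pd_pol[OF sm] p1 m1 a_def[symmetric] b_def[symmetric] c_def[symmetric]
        by (simp add: algebra_simps add_divide_distrib diff_divide_distrib)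
    qed
    then have "pd v (mode n \<phi>) p = integral {0..2 * pi} (\<lambda>t. of_real (v \<bullet> e / 2) * (cis (real_of_int (n + 1) * t) * ?A (pol t p)
         + cis (real_of_int (n - 1) * t) * ?B (pol t p)) + cis (real_of_int n * t) * pd (\<kappa> v) \<phi> (pol t p))"
      using True by (simp only: pd_mode[OF \<phi>] if_True)
    also have "\<dots> = of_real (v \<bullet> e / 2) * (integral {0..2 * pi} (\<lambda>t. cis (real_of_int (n + 1) * t) * ?A (pol t p))
         + integral {0..2 * pi} (\<lambda>t. cis (real_of_int (n - 1) * t) * ?B (pol t p)))
         + integral {0..2 * pi} (\<lambda>t. cis (real_of_int n * t) * pd (\<kappa> v) \<phi> (pol t p))"
      by (simp only: integral_add integral_mult_right integrable_add integrable_on_mult_right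
            mode_integrable[OF smAB(1)] mode_integrable[OF smAB(2)] mode_integrable[OF smooth_pd[OF sm]])
    finally show ?thesis using True by (simp only: mode_def if_True)
  qed (simp add: pd_mode[OF \<phi>] mode_def)
qed

lemma test_fun_mode:
  assumes "\<phi> \<in> test_fun U'" shows "mode n \<phi> \<in> test_fun \<Omega>"
proof -
  define S where "S = {mode n \<phi> | n \<phi>. \<phi> \<in> test_fun U'}"
  have "smooth (mode n \<phi>)"
  proof (rule smooth_coinduct[of _ S])
    fix f assume "f \<in> S"
    then obtain n \<phi> where f: "f = mode n \<phi>" and \<phi>: "\<phi> \<in> test_fun U'" by (auto simp: S_def)
    show "f differentiable at x" for x
      unfolding f using has_derivative_mode[OF \<phi>] by (rule differentiableI)
    have mem: "(\<lambda>p. mode n \<psi> p) \<in> S" if "\<psi> \<in> test_fun U'" for n \<psi> using that by (auto simp: S_def)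
    show "pd b f \<in> smooth_span S" for b
      unfolding f pd_mode_expand[OF \<phi>]
      by (intro smooth_span.add smooth_span_cmult smooth_span.base mem test_fun_add test_fun_cmult test_fun_pd \<phi>)
  qed (use assms in \<open>auto simp: S_def\<close>)
  moreover obtain K where "compact K" "K \<subseteq> \<Omega>" "\<And>n p. p \<notin> K \<Longrightarrow> mode n \<phi> p = 0"
    using mode_support[OF assms] by metis
  ultimately show ?thesis by (intro test_funI_closed)
qed

text \<open>The factor after the phase is the derivative of \<open>\<phi> (pol t p)\<close> in
  \<open>t\<close>. The boundary terms cancel by periodicity, \<open>n\<close> being an
  integer.\<close>

lemma integral_mode_by_parts:
  assumes \<phi>: "smooth \<phi>"
  shows "integral {0..2 * pi} (\<lambda>t. cis (real_of_int n * t) * (of_real (p \<bullet> e) *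
      (of_real (cos t) * pd ey \<phi> (pol t p) - of_real (sin t) * pd ex \<phi> (pol t p))))
    = - \<i> * of_int n * integral {0..2 * pi} (\<lambda>t. cis (real_of_int n * t) * \<phi> (pol t p))"
proof -
  let ?f = "\<lambda>t. cis (real_of_int n * t) * \<phi> (pol t p)"
  let ?g = "\<lambda>t. cis (real_of_int n * t) * (of_real (p \<bullet> e) *
      (of_real (cos t) * pd ey \<phi> (pol t p) - of_real (sin t) * pd ex \<phi> (pol t p)))"
  have D: "(?f has_vector_derivative (\<i> * of_int n * ?f t + ?g t)) (at t within S)" for t S
  proof -
    have c: "((\<lambda>t. cis (real_of_int n * t)) has_vector_derivative (\<i> * of_int n * cis (real_of_int n * t))) (at t within S)"
    proof -
      have "((\<lambda>t. exp (\<i> * (of_int n * of_real t))) has_vector_derivative (\<i> * of_int n * exp (\<i> * (of_int n * of_real t)))) (at t within S)"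
        by (rule has_vector_derivative_real_field) (auto intro!: derivative_eq_intros)
      then show ?thesis by (simp add: cis_conv_exp)
    qed
    have "((\<lambda>t. pol t p) has_derivative (\<lambda>h. h *\<^sub>R ((- (p \<bullet> e) * sin t) *\<^sub>R ex + (p \<bullet> e * cos t) *\<^sub>R ey))) (at t within S)"
      unfolding pol_def by (auto intro!: derivative_eq_intros simp: algebra_simps fun_eq_iff)
    moreover have "(\<phi> has_derivative (\<lambda>h. pd h \<phi> (pol t p))) (at (pol t p) within X)" for X
      using smooth_has_derivative[OF \<phi>] has_derivative_at_withinI by blast
    ultimately have "((\<lambda>t. \<phi> (pol t p)) has_derivative
       (\<lambda>h. pd (h *\<^sub>R ((- (p \<bullet> e) * sin t) *\<^sub>R ex + (p \<bullet> e * cos t) *\<^sub>R ey)) \<phi> (pol t p))) (at t within S)"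
      by (rule has_derivative_compose)
    then have d: "((\<lambda>t. \<phi> (pol t p)) has_vector_derivative
       (of_real (p \<bullet> e) * (of_real (cos t) * pd ey \<phi> (pol t p) - of_real (sin t) * pd ex \<phi> (pol t p)))) (at t within S)"
      unfolding has_vector_derivative_def
    proof (rule has_derivative_eq_rhs, intro ext)
      fix h
      have "pd (h *\<^sub>R ((- (p \<bullet> e) * sin t) *\<^sub>R ex + (p \<bullet> e * cos t) *\<^sub>R ey)) \<phi> (pol t p)
        = h *\<^sub>R ((- (p \<bullet> e) * sin t) *\<^sub>R pd ex \<phi> (pol t p) + (p \<bullet> e * cos t) *\<^sub>R pd ey \<phi> (pol t p))"
        by (simp only: linear_add[OF pd_linear[OF \<phi>]] linear_scale[OF pd_linear[OF \<phi>]])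
      then show "pd (h *\<^sub>R ((- (p \<bullet> e) * sin t) *\<^sub>R ex + (p \<bullet> e * cos t) *\<^sub>R ey)) \<phi> (pol t p)
        = h *\<^sub>R (of_real (p \<bullet> e) * (of_real (cos t) * pd ey \<phi> (pol t p) - of_real (sin t) * pd ex \<phi> (pol t p)))"
        by (simp add: scaleR_conv_of_real algebra_simps)
    qed
    show ?thesis
      using has_vector_derivative_mult[OF c d] by (simp add: algebra_simps)
  qed
  have I: "?f integrable_on {0..2 * pi}" "?g integrable_on {0..2 * pi}"
    by (rule mode_integrable[OF \<phi>])
       (intro integrable_continuous_interval continuous_intros
          continuous_on_compose2[OF smooth_continuous[OF smooth_pd[OF \<phi>]]], auto)
  have "((\<lambda>t. \<i> * of_int n * ?f t + ?g t) has_integral (?f (2 * pi) - ?f 0)) {0..2 * pi}"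
    by (intro fundamental_theorem_of_calculus D) simp
  moreover have "?f (2 * pi) = ?f 0"
    using cis_multiple_2pi[of "real_of_int n"] by (simp add: pol_def mult.commute mult.left_commute)
  ultimately have "integral {0..2 * pi} (\<lambda>t. \<i> * of_int n * ?f t + ?g t) = 0"
    by (simp add: integral_unique)
  moreover have "integral {0..2 * pi} (\<lambda>t. \<i> * of_int n * ?f t + ?g t) = \<i> * of_int n * integral {0..2 * pi} ?f + integral {0..2 * pi} ?g"
    using I by (subst integral_add) (auto intro: integrable_on_mult_right)
  ultimately show ?thesis by (simp add: eq_neg_iff_add_eq_0 add.commute)
qed

text \<open>In polar coordinates \<open>\<partial>\<^sub>x - s \<i> \<partial>\<^sub>y\<close> is
  the phase of mode \<open>- s\<close> times
  \<open>\<partial>\<^sub>r - (s \<i> / r) \<partial>\<^sub>\<theta>\<close>. The phase shifts the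
  mode and the angular part is integrated by parts. The sign \<open>s\<close> treats lowering and
  raising at once, and the factor \<open>p \<bullet> e\<close> clears the denominator.\<close>

lemma mode_complex_derivative:
  assumes \<phi>: "\<phi> \<in> test_fun U'" and s: "s = 1 \<or> s = -1"
  shows "of_real (p \<bullet> e) * mode n (\<lambda>x. pd ex \<phi> x - of_int s * \<i> * pd ey \<phi> x) p
    = of_real (p \<bullet> e) * pd e (mode (n - s) \<phi>) p - of_int (s * (n - s)) * mode (n - s) \<phi> p"
proof (cases "0 < p \<bullet> e")
  case True
  note sm = test_fun_smooth[OF \<phi>]
  define l where "l = n - s"
  let ?c = "\<lambda>t. cis (real_of_int l * t)"
  let ?x = "\<lambda>t. pd ex \<phi> (pol t p)" and ?y = "\<lambda>t. pd ey \<phi> (pol t p)"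
  let ?r = "complex_of_real (p \<bullet> e)"
  have eq: "cis (real_of_int n * t) * (?x t - of_int s * \<i> * ?y t)
     = ?c t * (of_real (cos t) * ?x t + of_real (sin t) * ?y t)
      - of_int s * \<i> * (?c t * (of_real (cos t) * ?y t - of_real (sin t) * ?x t))" for t
  proof -
    have "cis (real_of_int n * t) = ?c t * cis (real_of_int s * t)"
      by (simp add: l_def cis_mult algebra_simps)
    moreover have "cis (real_of_int s * t) = of_real (cos t) + of_int s * \<i> * of_real (sin t)"
      using s by (auto simp: cis.code Complex_eq)
    ultimately show ?thesis
      using s by (auto simp: algebra_simps)
  qed
  have cont: "continuous_on A (\<lambda>t. pd v \<phi> (pol t p))" for v A
    by (intro continuous_on_compose2[OF smooth_continuous[OF smooth_pd[OF sm]]] continuous_intros) auto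
  have I: "(\<lambda>t. ?c t * (of_real (cos t) * ?x t + of_real (sin t) * ?y t)) integrable_on {0..2 * pi}"
    "(\<lambda>t. ?c t * (of_real (cos t) * ?y t - of_real (sin t) * ?x t)) integrable_on {0..2 * pi}"
    by (intro integrable_continuous_interval continuous_intros cont)+
  have parts: "?r * integral {0..2 * pi} (\<lambda>t. ?c t * (of_real (cos t) * ?y t - of_real (sin t) * ?x t))
     = - \<i> * of_int l * mode l \<phi> p"
    using integral_mode_by_parts[OF sm, of l p] True
    by (simp add: mode_def mult.left_commute[of _ ?r])
  define Q where "Q = integral {0..2 * pi} (\<lambda>t. ?c t * (of_real (cos t) * ?y t - of_real (sin t) * ?x t))"
  have "mode n (\<lambda>x. pd ex \<phi> x - of_int s * \<i> * pd ey \<phi> x) p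
     = integral {0..2 * pi} (\<lambda>t. ?c t * (of_real (cos t) * ?x t + of_real (sin t) * ?y t))
       - of_int s * \<i> * integral {0..2 * pi} (\<lambda>t. ?c t * (of_real (cos t) * ?y t - of_real (sin t) * ?x t))"
    using True unfolding mode_def eq
    by (subst integral_diff) (auto intro: I integrable_on_mult_right)
  also have "integral {0..2 * pi} (\<lambda>t. ?c t * (of_real (cos t) * ?x t + of_real (sin t) * ?y t)) = pd e (mode l \<phi>) p"
    using True linear_0[OF pd_linear[OF sm]] by (simp add: pd_mode[OF \<phi>] pd_pol[OF sm] \<kappa>_e)
  finally have "?r * mode n (\<lambda>x. pd ex \<phi> x - of_int s * \<i> * pd ey \<phi> x) p
     = ?r * pd e (mode l \<phi>) p - of_int s * \<i> * (?r * Q)"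
    unfolding Q_def[symmetric] by (simp only: right_diff_distrib mult.left_commute)
  also have "of_int s * \<i> * (?r * Q) = of_int (s * l) * mode l \<phi> p"
    unfolding parts[folded Q_def] by (simp add: algebra_simps)
  finally show ?thesis unfolding l_def .
qed (simp add: mode_def pd_mode[OF \<phi>])

text \<open>The extension of \<open>lift n\<close> to distributions, defined as the transpose of
  taking the mode \<open>n\<close>; the factor \<open>p \<bullet> e\<close> is the Jacobian. It is
  meaningful on \<open>test_fun U'\<close>, where modes are test functions on
  \<open>\<Omega>\<close>.\<close>

definition dlift :: "int \<Rightarrow> 'b distr \<Rightarrow> 'a distr" where
  "dlift n S = (\<lambda>\<phi>. S (\<lambda>p. of_real (p \<bullet> e) * mode n \<phi> p))"

lemma dlin_dlift:
  assumes "dlin \<Omega> S" shows "dlin U' (dlift n S)"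
  unfolding dlin_def dlift_def
proof safe
  fix \<phi> \<psi> c assume a: "\<phi> \<in> test_fun U'" "\<psi> \<in> test_fun U'"
  have "(\<lambda>p. of_real (p \<bullet> e) * mode n (\<lambda>x. \<phi> x + c * \<psi> x) p)
    = (\<lambda>p. of_real (p \<bullet> e) * mode n \<phi> p + c * (of_real (p \<bullet> e) * mode n \<psi> p))"
    using a by (simp add: mode_add mode_cmult smooth_cmult test_fun_smooth algebra_simps)
  then show "S (\<lambda>p. of_real (p \<bullet> e) * mode n (\<lambda>x. \<phi> x + c * \<psi> x) p)
    = S (\<lambda>p. of_real (p \<bullet> e) * mode n \<phi> p) + c * S (\<lambda>p. of_real (p \<bullet> e) * mode n \<psi> p)"
    using dlinD[OF assms test_fun_radius[OF test_fun_mode[OF a(1)]] test_fun_radius[OF test_fun_mode[OF a(2)]]]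
    by simp
qed

lemma cderiv_dlift:
  assumes S: "dlin \<Omega> S" and \<phi>: "\<phi> \<in> test_fun U'" and s: "s = 1 \<or> s = -1"
  shows "cderiv ex ey 1 (- of_int s * \<i>) (dlift n S) \<phi>
    = dlift (n - s) (\<lambda>\<phi>. dderiv e S \<phi> + of_int (s * n) * dmult (\<lambda>p. 1 / (p \<bullet> e)) S \<phi>) \<phi>"
proof -
  define M where "M = mode (n - s) \<phi>"
  have M: "M \<in> test_fun \<Omega>" unfolding M_def by (rule test_fun_mode[OF \<phi>])
  have t1: "(\<lambda>p. of_real (p \<bullet> e) * pd e M p) \<in> test_fun \<Omega>" by (intro test_fun_radius test_fun_pd M)
  have "cderiv ex ey 1 (- of_int s * \<i>) (dlift n S) \<phi>
      = - (dlift n S (\<lambda>x. pd ex \<phi> x + (- of_int s * \<i>) * pd ey \<phi> x))"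
    by (subst dlinD[OF dlin_dlift[OF S] test_fun_pd[OF \<phi>] test_fun_pd[OF \<phi>]])
       (simp add: cderiv_def dderiv_def algebra_simps)
  also have "dlift n S (\<lambda>x. pd ex \<phi> x + (- of_int s * \<i>) * pd ey \<phi> x)
      = S (\<lambda>p. of_real (p \<bullet> e) * pd e M p + (- of_int (s * (n - s))) * M p)"
  proof -
    have h: "(\<lambda>x. pd ex \<phi> x + (- of_int s * \<i>) * pd ey \<phi> x) = (\<lambda>x. pd ex \<phi> x - of_int s * \<i> * pd ey \<phi> x)"
      by (simp add: fun_eq_iff)
    show ?thesis
      unfolding dlift_def h mode_complex_derivative[OF \<phi> s] M_def by simp
  qed
  also have "\<dots> = S (\<lambda>p. of_real (p \<bullet> e) * pd e M p) + (- of_int (s * (n - s))) * S M"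
    by (rule dlinD[OF S t1 M])
  finally have lhs: "cderiv ex ey 1 (- of_int s * \<i>) (dlift n S) \<phi>
      = - S (\<lambda>p. of_real (p \<bullet> e) * pd e M p) + of_int (s * (n - s)) * S M" by simp
  have "pd e (\<lambda>p. of_real (p \<bullet> e) * M p) = (\<lambda>p. of_real (p \<bullet> e) * pd e M p + 1 * M p)"
  proof
    fix p
    have "((\<lambda>p. complex_of_real (p \<bullet> e)) has_derivative (\<lambda>h. of_real (h \<bullet> e))) (at p)"
      by (auto intro!: derivative_eq_intros)
    from pd_eqI[OF has_derivative_mult[OF this smooth_has_derivative[OF test_fun_smooth[OF M]]], of e]
    show "pd e (\<lambda>p. of_real (p \<bullet> e) * M p) p = of_real (p \<bullet> e) * pd e M p + 1 * M p"
      by simp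
  qed
  then have "S (pd e (\<lambda>p. of_real (p \<bullet> e) * M p)) = S (\<lambda>p. of_real (p \<bullet> e) * pd e M p) + 1 * S M"
    using dlinD[OF S t1 M, of 1] by simp
  moreover have "(\<lambda>p. of_real (1 / (p \<bullet> e)) * (of_real (p \<bullet> e) * M p)) = M"
    by (auto simp: M_def mode_def fun_eq_iff)
  ultimately have "dlift (n - s) (\<lambda>\<phi>. dderiv e S \<phi> + of_int (s * n) * dmult (\<lambda>p. 1 / (p \<bullet> e)) S \<phi>) \<phi>
     = - (S (\<lambda>p. of_real (p \<bullet> e) * pd e M p) + S M) + of_int (s * n) * S M"
    by (simp only: dlift_def dderiv_def dmult_def M_def[symmetric] mult_1)
  \<comment> \<open>Because of \<open>s * s = 1\<close> a term \<open>- 1\<close> appears; it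
    matches the derivative of the Jacobian \<open>p \<bullet> e\<close>.\<close>
  moreover have "of_int (s * (n - s)) = (of_int (s * n) - 1 :: complex)"
    using s by (auto simp: algebra_simps)
  ultimately show ?thesis unfolding lhs by (simp add: algebra_simps)
qed

lemma cderiv_cong_test:
  "(\<And>\<phi>. \<phi> \<in> test_fun V \<Longrightarrow> S \<phi> = T \<phi>) \<Longrightarrow> \<phi> \<in> test_fun V \<Longrightarrow> cderiv ex ey \<alpha> \<beta> S \<phi> = cderiv ex ey \<alpha> \<beta> T \<phi>"
  by (simp add: cderiv_def dderiv_def test_fun_pd)

lemma cderiv_dlift_euler_op:
  assumes T: "dlin \<Omega> T" and \<phi>: "\<phi> \<in> test_fun U'" and s: "s = 1 \<or> s = -1"
  shows "cderiv ex ey 1 (- of_int s * \<i>) (dlift n (euler_op m q T)) \<phi>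
    = dlift (n - s) (euler_op (Suc m) (lin_fac (real m - real_of_int (s * n)) * q) T) \<phi>"
proof -
  let ?F = "\<lambda>p. complex_of_real (p \<bullet> e) * mode (n - s) \<phi> p"
  have F: "?F \<in> test_fun \<Omega>" by (intro test_fun_radius test_fun_mode \<phi>)
  have "lin_fac (real m - real_of_int (s * n)) * q = lin_fac (real m) * q + smult (real_of_int (s * n)) q"
    by (subst lin_fac_shift[of _ "real m"]) (simp add: distrib_right)
  then show ?thesis
    using cderiv_dlift[OF dlin_euler_op[OF T] \<phi> s, of n m q] dderiv_euler_op[OF T F, of m q]
      dmult_euler_op[of m q T ?F]
    by (simp add: dlift_def euler_op_add euler_op_smult)
qed

text \<open>Raising at index \<open>b\<close> and mode \<open>k + b\<close> adds the root
  \<open>k + 2 b\<close>. Lowering at index \<open>a + b\<close> and mode \<open>k + b - a\<close>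
  adds the root \<open>(a + b) - (k + b - a) = - k + 2 a\<close>. These are the roots in
  \<open>P_poly\<close>.\<close>

lemma cderiv_pow_dlift:
  assumes T: "dlin \<Omega> T" and \<phi>: "\<phi> \<in> test_fun U'"
  shows "(cderiv ex ey 1 (- \<i>) ^^ a) ((cderiv ex ey 1 \<i> ^^ b) (dlift k T)) \<phi>
    = dlift (k + int b - int a) (euler_op (a + b) (P_poly (real_of_int k) a b) T) \<phi>"
proof -
  have b: "(cderiv ex ey 1 \<i> ^^ b) (dlift k T) \<phi> = dlift (k + int b) (euler_op b (P_poly (real_of_int k) 0 b) T) \<phi>"
    if "\<phi> \<in> test_fun U'" for \<phi>
    using that
  proof (induction b arbitrary: \<phi>)
    case 0
    have "(\<lambda>p. complex_of_real ((1 / (p \<bullet> e)) ^ 0) * \<phi> p) = \<phi>" for \<phi> by simp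
    then show ?case by (simp add: P_poly_def euler_op_def euler_mon_def dlift_def dmult_def)
  next
    case (Suc b)
    have "(cderiv ex ey 1 \<i> ^^ Suc b) (dlift k T) \<phi>
        = cderiv ex ey 1 (- of_int (-1) * \<i>) (dlift (k + int b) (euler_op b (P_poly (real_of_int k) 0 b) T)) \<phi>"
      using cderiv_cong_test[OF Suc.IH Suc.prems] by simp
    also have "\<dots> = dlift (k + int b - - 1) (euler_op (Suc b)
        (lin_fac (real b - real_of_int (- 1 * (k + int b))) * P_poly (real_of_int k) 0 b) T) \<phi>"
      by (rule cderiv_dlift_euler_op[OF T Suc.prems]) simp
    finally show ?case
      by (simp add: P_poly_Suc2 algebra_simps)
  qed
  show ?thesis using \<phi>
  proof (induction a arbitrary: \<phi>)
    case 0
    then show ?case using b by simp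
  next
    case (Suc a)
    have "(cderiv ex ey 1 (- \<i>) ^^ Suc a) ((cderiv ex ey 1 \<i> ^^ b) (dlift k T)) \<phi>
        = cderiv ex ey 1 (- of_int 1 * \<i>) (dlift (k + int b - int a) (euler_op (a + b) (P_poly (real_of_int k) a b) T)) \<phi>"
      using cderiv_cong_test[OF Suc.IH Suc.prems] by simp
    also have "\<dots> = dlift (k + int b - int a - 1) (euler_op (Suc (a + b))
        (lin_fac (real (a + b) - real_of_int (1 * (k + int b - int a))) * P_poly (real_of_int k) a b) T) \<phi>"
      by (rule cderiv_dlift_euler_op[OF T Suc.prems]) simp
    finally show ?case
      by (simp add: P_poly_Suc1 algebra_simps)
  qed
qed

end

section \<open>Isometry of the Fourier modes\<close>

context cylindrical
begin

definition cyl_dens :: "'b \<Rightarrow> real \<Rightarrow> real" where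
  "cyl_dens p t = (if 0 < p \<bullet> e \<and> 0 \<le> t \<and> t \<le> 2 * pi then p \<bullet> e else 0)"

lemma cyl_dens_nonneg [simp]: "0 \<le> cyl_dens p t"
  by (simp add: cyl_dens_def)

lemma cyl_dens_measurable [measurable]:
  "(\<lambda>z. cyl_dens (fst z) (snd z)) \<in> borel_measurable (lborel \<Otimes>\<^sub>M lborel)"
  unfolding cyl_dens_def by measurable

lemma pol_measurable [measurable]:
  "(\<lambda>z. pol (snd z) (fst z)) \<in> borel_measurable (lborel \<Otimes>\<^sub>M lborel)"
proof -
  have "(\<lambda>z. pol (snd z) (fst z)) \<in> borel_measurable borel"
    by (intro borel_measurable_continuous_onI continuous_intros)
  then show ?thesis by (simp add: lborel_prod)
qed

lemma nn_integral_cyl: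
  assumes "f \<in> borel_measurable borel"
  shows "integral\<^sup>N lborel f = (\<integral>\<^sup>+p. \<integral>\<^sup>+t. ennreal (cyl_dens p t) * f (pol t p) \<partial>lborel \<partial>lborel)"
  unfolding nn_integral_cylindrical[OF assms] pol_def[symmetric]
  by (intro nn_integral_cong) (auto simp: cyl_dens_def indicator_def)

text \<open>As an identity of measures, the formula for nonnegative functions passes on to Bochner
  integrals of complex functions.\<close>

lemma lborel_cyl:
  "(lborel :: 'a measure) = distr (density (lborel \<Otimes>\<^sub>M lborel) (\<lambda>z. ennreal (cyl_dens (fst z) (snd z))))
     borel (\<lambda>z. pol (snd z) (fst z))"
proof (rule measure_eqI)
  fix A :: "'a set" assume "A \<in> sets lborel"
  then have A[measurable]: "A \<in> sets borel" by simp
  have "emeasure lborel A = integral\<^sup>N lborel (indicator A)"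
    by simp
  also have "\<dots> = (\<integral>\<^sup>+p. \<integral>\<^sup>+t. ennreal (cyl_dens p t) * indicator A (pol t p) \<partial>lborel \<partial>lborel)"
    by (rule nn_integral_cyl) simp
  also have "\<dots> = (\<integral>\<^sup>+z. ennreal (cyl_dens (fst z) (snd z)) * indicator A (pol (snd z) (fst z)) \<partial>(lborel \<Otimes>\<^sub>M lborel))"
    by (subst lborel.nn_integral_fst[symmetric]) (auto intro!: borel_measurable_times_ennreal)
  also have "\<dots> = emeasure (distr (density (lborel \<Otimes>\<^sub>M lborel) (\<lambda>z. ennreal (cyl_dens (fst z) (snd z))))
     borel (\<lambda>z. pol (snd z) (fst z))) A"
    using measurable_sets[OF pol_measurable A]
    by (simp add: emeasure_distr emeasure_density) (auto intro!: nn_integral_cong simp: indicator_def space_pair_measure)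
  finally show "emeasure lborel A = \<dots>" .
qed simp

lemma integral_cyl:
  fixes F :: "'a \<Rightarrow> complex"
  assumes F: "integrable lborel F"
  shows "integral\<^sup>L lborel F = (LINT p|lborel. LINT t|lborel. cyl_dens p t *\<^sub>R F (pol t p))"
proof -
  have Fm[measurable]: "F \<in> borel_measurable borel" using F by auto
  let ?D = "density (lborel \<Otimes>\<^sub>M lborel) (\<lambda>z. ennreal (cyl_dens (fst z) (snd z)))"
  have pm: "(\<lambda>z. pol (snd z) (fst z)) \<in> measurable ?D borel" by simp
  have "integrable ?D (\<lambda>z. F (pol (snd z) (fst z)))"
    using F by (subst (asm) lborel_cyl) (simp add: integrable_distr_eq pm)
  then have i: "integrable (lborel \<Otimes>\<^sub>M lborel) (\<lambda>z. cyl_dens (fst z) (snd z) *\<^sub>R F (pol (snd z) (fst z)))"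
    by (subst (asm) integrable_density) auto
  have "integral\<^sup>L lborel F = integral\<^sup>L ?D (\<lambda>z. F (pol (snd z) (fst z)))"
    by (subst lborel_cyl) (simp add: integral_distr pm)
  also have "\<dots> = integral\<^sup>L (lborel \<Otimes>\<^sub>M lborel) (\<lambda>z. cyl_dens (fst z) (snd z) *\<^sub>R F (pol (snd z) (fst z)))"
    by (subst integral_density) auto
  also have "\<dots> = (LINT p|lborel. LINT t|lborel. cyl_dens p t *\<^sub>R F (pol t p))"
    using lborel_pair.integral_fst'[OF i] by simp
  finally show ?thesis .
qed

lemma mer_measurable [measurable]: "mer \<in> borel_measurable borel"
  by (intro borel_measurable_continuous_onI continuous_intros)

lemma lift_measurable:
  assumes [measurable]: "w \<in> borel_measurable borel"
  shows "lift n w \<in> borel_measurable borel"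
proof -
  have [measurable]: "zc \<in> borel_measurable borel"
    by (intro borel_measurable_continuous_onI linear_continuous_on zc_bounded_linear)
  \<comment> \<open>The phase is rewritten as a power of \<open>z\<close> over its modulus, which is
    Borel; the value 1 at the origin agrees with \<open>Arg 0 = 0\<close>.\<close>
  define h where "h z = (if z = 0 then 1 else if 0 \<le> n then (z /\<^sub>R cmod z) ^ nat n else cnj (z /\<^sub>R cmod z) ^ nat (- n))" for z
  have h: "cis (real_of_int n * Arg z) = h z" for z
  proof (cases "z = 0")
    case False
    then have *: "cis (Arg z) = z /\<^sub>R cmod z" by (simp add: cis_Arg sgn_div_norm)
    show ?thesis
    proof (cases "0 \<le> n")
      case True
      then have "cis (real_of_int n * Arg z) = cis (Arg z) ^ nat n" by (simp add: Complex.DeMoivre)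
      then show ?thesis using False True by (simp add: h_def *)
    next
      case neg: False
      then have "cis (real_of_int n * Arg z) = cis (- Arg z) ^ nat (- n)" by (simp add: Complex.DeMoivre)
      also have "cis (- Arg z) = cnj (cis (Arg z))" by (simp add: cis_cnj)
      finally show ?thesis using False neg by (simp only: h_def * if_False)
    qed
  qed (simp add: h_def Arg_zero)
  have [measurable]: "cnj \<in> borel_measurable borel"
    by (intro borel_measurable_continuous_onI continuous_intros)
  have [measurable]: "h \<in> borel_measurable borel"
    unfolding h_def by measurable
  show ?thesis unfolding lift_def h by measurable
qed

lemma norm_lift: "cmod (lift n w x) = cmod (w (mer x))"
  by (simp add: lift_def norm_mult)

end

lemma nn_integral_indicator_cyl:
  "(\<integral>\<^sup>+t. indicator {0..2 * pi} t * c \<partial>(lborel :: real measure)) = ennreal (2 * pi) * c"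
  by (subst nn_integral_multc) auto

text \<open>Cauchy-Schwarz on an interval. If the integrand is not integrable, the Bochner integral
  is 0 by convention, so the bound covers every slice of a measurable function.\<close>

lemma norm_integral_sq_le:
  fixes h :: "real \<Rightarrow> complex"
  assumes [measurable]: "h \<in> borel_measurable borel" and ab: "a \<le> b"
  shows "ennreal ((cmod (LINT t|lborel. indicator {a..b} t *\<^sub>R h t))\<^sup>2)
    \<le> ennreal (b - a) * (\<integral>\<^sup>+t. indicator {a..b} t * ennreal ((cmod (h t))\<^sup>2) \<partial>lborel)"
proof (cases "integrable lborel (\<lambda>t. indicator {a..b} t *\<^sub>R h t)")
  case True
  have "ennreal ((cmod (LINT t|lborel. indicator {a..b} t *\<^sub>R h t))\<^sup>2)
     = (ennreal (cmod (LINT t|lborel. indicator {a..b} t *\<^sub>R h t)))\<^sup>2"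
    by (simp add: ennreal_power)
  also have "\<dots> \<le> (\<integral>\<^sup>+t. ennreal (cmod (indicator {a..b} t *\<^sub>R h t)) \<partial>lborel)\<^sup>2"
    by (intro power_mono integral_norm_bound_ennreal True) simp
  also have "\<dots> = (\<integral>\<^sup>+t. indicator {a..b} t * (indicator {a..b} t * ennreal (cmod (h t))) \<partial>lborel)\<^sup>2"
    by (intro arg_cong[where f = "\<lambda>x. x\<^sup>2"] nn_integral_cong) (auto simp: indicator_def)
  also have "\<dots> \<le> (\<integral>\<^sup>+t. (indicator {a..b} t)\<^sup>2 \<partial>lborel) * (\<integral>\<^sup>+t. (indicator {a..b} t * ennreal (cmod (h t)))\<^sup>2 \<partial>lborel)"
    by (rule Cauchy_Schwarz_nn_integral) auto
  also have "(\<integral>\<^sup>+t. (indicator {a..b} t)\<^sup>2 \<partial>lborel) = (\<integral>\<^sup>+t. indicator {a..b} t \<partial>lborel)"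
    by (intro nn_integral_cong) (auto simp: indicator_def)
  also have "\<dots> = ennreal (b - a)" using ab by simp
  also have "(\<integral>\<^sup>+t. (indicator {a..b} t * ennreal (cmod (h t)))\<^sup>2 \<partial>lborel) = (\<integral>\<^sup>+t. indicator {a..b} t * ennreal ((cmod (h t))\<^sup>2) \<partial>lborel)"
    by (intro nn_integral_cong) (auto simp: indicator_def ennreal_power)
  finally show ?thesis .
qed (simp add: not_integrable_integral_eq)

context axisymmetric_domain
begin

abbreviation (input) \<omega>\<^sub>r :: "'b \<Rightarrow> real" where "\<omega>\<^sub>r \<equiv> \<lambda>p. 2 * pi * (p \<bullet> e)"
abbreviation (input) one_w :: "'a \<Rightarrow> real" where "one_w \<equiv> \<lambda>_. 1"

lemma weight_one: "weight_on V one_w"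
  by (simp add: weight_on_def)

lemma not_\<Omega>: "p \<bullet> e \<le> 0 \<Longrightarrow> p \<notin> \<Omega>"
  by (auto simp: \<Omega>_def)

lemma wnorm_lift:
  assumes [measurable]: "g \<in> borel_measurable borel" and g0: "\<And>p. p \<notin> \<Omega> \<Longrightarrow> g p = 0"
  shows "wnorm one_w (lift n g) = wnorm \<omega>\<^sub>r g"
proof -
  have "wnorm one_w (lift n g) = (\<integral>\<^sup>+x. ennreal ((cmod (g (mer x)))\<^sup>2) \<partial>lborel)"
    by (simp add: wnorm_def norm_lift)
  also have "\<dots> = (\<integral>\<^sup>+p. \<integral>\<^sup>+t. ennreal (cyl_dens p t) * ennreal ((cmod (g (mer (pol t p))))\<^sup>2) \<partial>lborel \<partial>lborel)"
    by (rule nn_integral_cyl) measurable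
  also have "\<dots> = wnorm \<omega>\<^sub>r g"
    unfolding wnorm_def
  proof (rule nn_integral_cong)
    fix p
    show "(\<integral>\<^sup>+t. ennreal (cyl_dens p t) * ennreal ((cmod (g (mer (pol t p))))\<^sup>2) \<partial>lborel) = ennreal (2 * pi * (p \<bullet> e) * (cmod (g p))\<^sup>2)"
    proof (cases "0 < p \<bullet> e")
      case True
      then have "(\<integral>\<^sup>+t. ennreal (cyl_dens p t) * ennreal ((cmod (g (mer (pol t p))))\<^sup>2) \<partial>lborel)
        = (\<integral>\<^sup>+t. indicator {0..2 * pi} t * ennreal (p \<bullet> e * (cmod (g p))\<^sup>2) \<partial>lborel)"
        by (intro nn_integral_cong) (auto simp: cyl_dens_def mer_pol indicator_def ennreal_mult)
      then show ?thesis using True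
        by (simp add: nn_integral_indicator_cyl flip: ennreal_mult)
    qed (simp add: cyl_dens_def g0 not_\<Omega>)
  qed
  finally show ?thesis .
qed

lemma lift_zero: "(\<And>p. p \<notin> \<Omega> \<Longrightarrow> g p = 0) \<Longrightarrow> x \<notin> U' \<Longrightarrow> lift n g x = 0"
  by (simp add: lift_def mer_in_\<Omega>)

text \<open>The transposition formula that makes \<open>dlift n\<close> agree with
  \<open>lift n\<close> on functions.\<close>

lemma integral_lift:
  assumes g[measurable]: "g \<in> borel_measurable borel" and g0: "\<And>p. p \<notin> \<Omega> \<Longrightarrow> g p = 0"
    and fin: "wnorm \<omega>\<^sub>r g < \<infinity>" and \<phi>: "\<phi> \<in> test_fun U'"
  shows "(LINT x|lborel. lift n g x * \<phi> x) = (LINT p|lborel. g p * (of_real (p \<bullet> e) * mode n \<phi> p))"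
proof -
  have "integrable lborel (\<lambda>x. lift n g x * \<phi> x)"
    using fin wnorm_lift[OF g g0, of n] by (intro integrable_test_fun_mult[OF weight_one _ _ \<phi>] lift_measurable) auto
  then have "(LINT x|lborel. lift n g x * \<phi> x)
     = (LINT p|lborel. LINT t|lborel. cyl_dens p t *\<^sub>R (lift n g (pol t p) * \<phi> (pol t p)))"
    by (rule integral_cyl)
  also have "\<dots> = (LINT p|lborel. g p * (of_real (p \<bullet> e) * mode n \<phi> p))"
  proof (rule Bochner_Integration.integral_cong[OF refl])
    fix p
    show "(LINT t|lborel. cyl_dens p t *\<^sub>R (lift n g (pol t p) * \<phi> (pol t p))) = g p * (of_real (p \<bullet> e) * mode n \<phi> p)"
    proof (cases "0 < p \<bullet> e")
      case True
      have "continuous_on {0..2 * pi} (\<lambda>t. \<phi> (pol t p))"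
        by (rule continuous_on_compose2[OF smooth_continuous[OF test_fun_smooth[OF \<phi>]]]) (auto intro!: continuous_intros)
      then have "set_integrable lborel {0..2 * pi} (\<lambda>t. cis (real_of_int n * t) * \<phi> (pol t p))"
        by (intro borel_integrable_atLeastAtMost' continuous_intros)
      from set_borel_integral_eq_integral(2)[OF this]
      have m: "mode n \<phi> p = (LINT t|lborel. indicator {0..2 * pi} t *\<^sub>R (cis (real_of_int n * t) * \<phi> (pol t p)))"
        using True by (simp add: mode_def set_lebesgue_integral_def)
      have "(LINT t|lborel. cyl_dens p t *\<^sub>R (lift n g (pol t p) * \<phi> (pol t p)))
        = (LINT t|lborel. (g p * of_real (p \<bullet> e)) * (indicator {0..2 * pi} t *\<^sub>R (cis (real_of_int n * t) * \<phi> (pol t p))))"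
        using True by (intro Bochner_Integration.integral_cong refl)
          (auto simp: cyl_dens_def lift_pol indicator_def scaleR_conv_of_real)
      also have "\<dots> = (g p * of_real (p \<bullet> e)) * mode n \<phi> p"
        unfolding m by (rule integral_mult_right_zero)
      finally show ?thesis by simp
    qed (simp add: cyl_dens_def g0 not_\<Omega>)
  qed
  finally show ?thesis .
qed

lemma distr_norm_dlift_le:
  "distr_L2norm_sq one_w U' (dlift n S) \<le> distr_L2norm_sq \<omega>\<^sub>r \<Omega> S"
proof (rule distr_L2norm_sq_ge)
  fix g assume "borel_rep \<omega>\<^sub>r \<Omega> S g"
  then have g: "g \<in> borel_measurable borel" "\<And>p. p \<notin> \<Omega> \<Longrightarrow> g p = 0" "wnorm \<omega>\<^sub>r g < \<infinity>"
    and S: "\<And>\<psi>. \<psi> \<in> test_fun \<Omega> \<Longrightarrow> S \<psi> = (LINT p|lborel. g p * \<psi> p)"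
    by (auto simp: borel_rep_def)
  have "borel_rep one_w U' (dlift n S) (lift n g)"
    unfolding borel_rep_def
    using g wnorm_lift[OF g(1,2)] integral_lift[OF g]
    by (auto simp: lift_measurable lift_zero dlift_def S test_fun_radius test_fun_mode)
  from distr_L2norm_sq_le[OF this] show "distr_L2norm_sq one_w U' (dlift n S) \<le> wnorm \<omega>\<^sub>r g"
    using wnorm_lift[OF g(1,2)] open_U' by simp
qed (use open_\<Omega> in simp)

lemma mode_lift:
  assumes "0 < p \<bullet> e" shows "mode n (lift (- n) \<psi>) p = of_real (2 * pi) * \<psi> p"
proof -
  have "cis (real_of_int n * t) * lift (- n) \<psi> (pol t p) = \<psi> p" for t
    using assms cis_mult[of "real_of_int n * t" "- (real_of_int n * t)"]
    by (simp add: lift_pol flip: mult.assoc)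
  then show ?thesis using assms by (simp add: mode_def scaleR_conv_of_real)
qed

text \<open>A representative \<open>f\<close> of the lifted distribution need not be a lift. Its
  angular average \<open>g\<close> against the phase of mode \<open>- n\<close> represents
  \<open>S\<close>, and Cauchy-Schwarz in the angle bounds the norm of \<open>g\<close> by that of
  \<open>f\<close>.\<close>

lemma distr_norm_dlift_ge:
  "distr_L2norm_sq \<omega>\<^sub>r \<Omega> S \<le> distr_L2norm_sq one_w U' (dlift n S)"
proof (rule distr_L2norm_sq_ge)
  fix f assume "borel_rep one_w U' (dlift n S) f"
  then have f[measurable]: "f \<in> borel_measurable borel" and f0: "\<And>x. x \<notin> U' \<Longrightarrow> f x = 0"
    and fin: "wnorm one_w f < \<infinity>"
    and S: "\<And>\<phi>. \<phi> \<in> test_fun U' \<Longrightarrow> dlift n S \<phi> = (LINT x|lborel. f x * \<phi> x)"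
    by (auto simp: borel_rep_def)
  have cis_m[measurable]: "(\<lambda>t. cis (c * t)) \<in> borel_measurable borel" for c
    by (intro borel_measurable_continuous_onI continuous_intros)
  define h where "h p t = cis (real_of_int (- n) * t) * f (pol t p)" for p t
  have [measurable]: "(\<lambda>z. h (fst z) (snd z)) \<in> borel_measurable (lborel \<Otimes>\<^sub>M lborel)"
    unfolding h_def by measurable
  have pm[measurable]: "(\<lambda>t. pol t p) \<in> borel_measurable borel" for p
    by (intro borel_measurable_continuous_onI continuous_intros)
  have hm: "h p \<in> borel_measurable borel" for p
    unfolding h_def by measurable
  define g where "g p = (if p \<in> \<Omega> then (LINT t|lborel. indicator {0..2 * pi} t *\<^sub>R h p t) / (2 * pi) else 0)" for p
  have \<Omega>m[measurable]: "\<Omega> \<in> sets borel" using open_\<Omega> by simp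
  have gm: "g \<in> borel_measurable borel"
  proof -
    have "(\<lambda>p. LINT t|lborel. indicator {0..2 * pi} t *\<^sub>R h p t) \<in> borel_measurable lborel"
      by (rule lborel.borel_measurable_lebesgue_integral) (simp add: case_prod_unfold)
    then show ?thesis unfolding g_def by (auto intro!: measurable_If)
  qed
  have "wnorm \<omega>\<^sub>r g \<le> (\<integral>\<^sup>+p. \<integral>\<^sup>+t. ennreal (cyl_dens p t) * ennreal ((cmod (f (pol t p)))\<^sup>2) \<partial>lborel \<partial>lborel)"
    unfolding wnorm_def
  proof (rule nn_integral_mono)
    fix p
    show "ennreal (2 * pi * (p \<bullet> e) * (cmod (g p))\<^sup>2) \<le> (\<integral>\<^sup>+t. ennreal (cyl_dens p t) * ennreal ((cmod (f (pol t p)))\<^sup>2) \<partial>lborel)"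
    proof (cases "p \<in> \<Omega>")
      case True
      then have pos: "0 < p \<bullet> e" by (rule \<Omega>_pos)
      let ?I = "LINT t|lborel. indicator {0..2 * pi} t *\<^sub>R h p t"
      have "2 * pi * (p \<bullet> e) * (cmod (g p))\<^sup>2 = (p \<bullet> e) / (2 * pi) * (cmod ?I)\<^sup>2"
        using True by (simp add: g_def norm_divide power_divide power2_eq_square field_simps)
      then have "ennreal (2 * pi * (p \<bullet> e) * (cmod (g p))\<^sup>2) = ennreal ((p \<bullet> e) / (2 * pi)) * ennreal ((cmod ?I)\<^sup>2)"
        using pos by (simp flip: ennreal_mult)
      also have "\<dots> \<le> ennreal ((p \<bullet> e) / (2 * pi)) * (ennreal (2 * pi - 0) * (\<integral>\<^sup>+t. indicator {0..2 * pi} t * ennreal ((cmod (h p t))\<^sup>2) \<partial>lborel))"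
        using hm[of p] by (intro mult_left_mono norm_integral_sq_le) auto
      also have "\<dots> = ennreal (p \<bullet> e) * (\<integral>\<^sup>+t. indicator {0..2 * pi} t * ennreal ((cmod (h p t))\<^sup>2) \<partial>lborel)"
        using pos by (simp flip: mult.assoc ennreal_mult)
      also have "\<dots> = (\<integral>\<^sup>+t. ennreal (p \<bullet> e) * (indicator {0..2 * pi} t * ennreal ((cmod (h p t))\<^sup>2)) \<partial>lborel)"
        using hm[of p] by (intro nn_integral_cmult[symmetric]) auto
      also have "\<dots> = (\<integral>\<^sup>+t. ennreal (cyl_dens p t) * ennreal ((cmod (f (pol t p)))\<^sup>2) \<partial>lborel)"
        using pos by (intro nn_integral_cong) (auto simp: cyl_dens_def indicator_def h_def norm_mult)
      finally show ?thesis .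
    qed (simp add: g_def)
  qed
  also have "\<dots> = wnorm one_w f"
    unfolding wnorm_def by (subst nn_integral_cyl) simp_all
  finally have le: "wnorm \<omega>\<^sub>r g \<le> wnorm one_w f" .
  have "S \<psi> = (LINT p|lborel. g p * \<psi> p)" if \<psi>: "\<psi> \<in> test_fun \<Omega>" for \<psi>
  proof -
    \<comment> \<open>Chosen so that the Jacobian times the mode \<open>n\<close> of
      \<open>lift (- n) \<eta>\<close> is \<open>\<psi>\<close>: the division by
      \<open>2 * pi\<close> cancels the length of the angular interval, that by \<open>r\<close> the
      Jacobian.\<close>
    define \<eta> where "\<eta> = (\<lambda>p. of_real (1 / (2 * pi)) * (complex_of_real ((1 / (p \<bullet> e)) ^ 1) * \<psi> p))"
    have \<eta>: "\<eta> \<in> test_fun \<Omega>" unfolding \<eta>_def by (intro test_fun_cmult test_fun_inv_power \<psi>)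
    note \<phi> = test_fun_lift[OF \<eta>, of "- n"]
    have \<psi>0: "\<psi> p = 0" if "p \<notin> \<Omega>" for p using test_fun_zero_outside[OF \<psi> that] .
    have "(\<lambda>p. of_real (p \<bullet> e) * mode n (lift (- n) \<eta>) p) = \<psi>"
    proof
      fix p show "of_real (p \<bullet> e) * mode n (lift (- n) \<eta>) p = \<psi> p"
      proof (cases "0 < p \<bullet> e")
        case True
        then show ?thesis by (simp add: mode_lift \<eta>_def)
      qed (simp add: mode_def \<psi>0 not_\<Omega>)
    qed
    then have "S \<psi> = dlift n S (lift (- n) \<eta>)" by (simp add: dlift_def)
    also have "\<dots> = (LINT x|lborel. f x * lift (- n) \<eta> x)" by (rule S[OF \<phi>])
    also have "\<dots> = (LINT p|lborel. LINT t|lborel. cyl_dens p t *\<^sub>R (f (pol t p) * lift (- n) \<eta> (pol t p)))"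
      by (intro integral_cyl integrable_test_fun_mult[OF weight_one f fin \<phi>])
    also have "\<dots> = (LINT p|lborel. g p * \<psi> p)"
    proof (rule Bochner_Integration.integral_cong[OF refl])
      fix p
      show "(LINT t|lborel. cyl_dens p t *\<^sub>R (f (pol t p) * lift (- n) \<eta> (pol t p))) = g p * \<psi> p"
      proof (cases "p \<in> \<Omega>")
        case True
        then have pos: "0 < p \<bullet> e" by (rule \<Omega>_pos)
        have "(LINT t|lborel. cyl_dens p t *\<^sub>R (f (pol t p) * lift (- n) \<eta> (pol t p)))
           = (LINT t|lborel. (\<psi> p / (2 * pi)) * (indicator {0..2 * pi} t *\<^sub>R h p t))"
          using pos by (intro Bochner_Integration.integral_cong refl)
            (auto simp: cyl_dens_def lift_pol indicator_def h_def \<eta>_def scaleR_conv_of_real)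
        also have "\<dots> = (\<psi> p / (2 * pi)) * (LINT t|lborel. indicator {0..2 * pi} t *\<^sub>R h p t)"
          by (rule integral_mult_right_zero)
        finally show ?thesis using True by (simp add: g_def)
      next
        case False
        have "lift (- n) \<eta> (pol t p) = 0" if "0 < p \<bullet> e" for t
          using False that by (simp add: lift_pol \<eta>_def \<psi>0)
        then have "(\<lambda>t. cyl_dens p t *\<^sub>R (f (pol t p) * lift (- n) \<eta> (pol t p))) = (\<lambda>t. 0)"
          by (auto simp: cyl_dens_def fun_eq_iff)
        then show ?thesis using False by (simp add: g_def)
      qed
    qed
    finally show ?thesis .
  qed
  then have "borel_rep \<omega>\<^sub>r \<Omega> S g"
    unfolding borel_rep_def using gm le fin by (auto simp: g_def)
  from distr_L2norm_sq_le[OF this \<Omega>m] le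
  show "distr_L2norm_sq \<omega>\<^sub>r \<Omega> S \<le> wnorm one_w f" by (rule order_trans)
qed (use open_U' in simp)

lemma distr_norm_dlift: "distr_L2norm_sq one_w U' (dlift n S) = distr_L2norm_sq \<omega>\<^sub>r \<Omega> S"
  using distr_norm_dlift_le distr_norm_dlift_ge by (rule order_antisym)

end

section \<open>Removal of the axis\<close>

text \<open>The standard flat function is \<open>flat 0\<close>. The powers in the denominator make
  the family closed under differentiation, which gives smoothness by coinduction.\<close>

definition flat :: "nat \<Rightarrow> real \<Rightarrow> real" where
  "flat k s = (if 0 < s then exp (- (1 / s)) / s ^ k else 0)"

lemma flat_quotient_tendsto: "((\<lambda>h. flat k h / h) \<longlongrightarrow> 0) (at 0)"
proof -
  have "((\<lambda>h. flat k h / h) \<longlongrightarrow> 0) (at_left 0)"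
    by (rule Lim_transform_eventually[OF tendsto_const])
       (auto simp: flat_def eventually_at_filter)
  moreover have "((\<lambda>h. flat k h / h) \<longlongrightarrow> 0) (at_right 0)"
  proof (rule Lim_transform_eventually)
    show "((\<lambda>h. inverse h ^ Suc k / exp (inverse h)) \<longlongrightarrow> (0::real)) (at_right 0)"
      by (rule filterlim_compose[OF tendsto_power_div_exp_0 filterlim_inverse_at_top_right])
    show "\<forall>\<^sub>F h in at_right 0. inverse h ^ Suc k / exp (inverse h) = flat k h / h"
      by (auto simp: flat_def eventually_at_filter exp_minus field_simps)
  qed
  ultimately show ?thesis by (simp add: filterlim_split_at)
qed

lemma flat_DERIV: "(flat k has_real_derivative (flat (k + 2) s - real k * flat (k + 1) s)) (at s)"
proof -
  consider "s < 0" | "s = 0" | "s > 0" by linarith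
  then show ?thesis
  proof cases
    case 1
    have "((\<lambda>s. 0) has_real_derivative 0) (at s)" by simp
    then have "(flat k has_real_derivative 0) (at s)"
      by (rule has_field_derivative_transform_within_open[where S = "{..<0}"]) (use 1 in \<open>auto simp: flat_def\<close>)
    then show ?thesis using 1 by (simp add: flat_def)
  next
    case 2
    then show ?thesis using flat_quotient_tendsto[of k] by (simp add: has_field_derivative_iff flat_def)
  next
    case 3
    have "((\<lambda>s. exp (- (1 / s)) * (1 / s) ^ k) has_real_derivative (flat (k + 2) s - real k * flat (k + 1) s)) (at s)"
    proof (rule DERIV_cong)
      have "((\<lambda>s. exp (- (1 / s))) has_real_derivative exp (- (1 / s)) * (1 / s) ^ 2) (at s)"
        using 3 by (auto intro!: derivative_eq_intros simp: power2_eq_square)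
      then show "((\<lambda>s. exp (- (1 / s)) * (1 / s) ^ k) has_real_derivative
          exp (- (1 / s)) * (1 / s) ^ 2 * (1 / s) ^ k + - real k * (1 / s) ^ Suc k * exp (- (1 / s))) (at s)"
        by (rule DERIV_mult[OF _ DERIV_inv_power[OF 3]])
      show "exp (- (1 / s)) * (1 / s) ^ 2 * (1 / s) ^ k + - real k * (1 / s) ^ Suc k * exp (- (1 / s))
          = flat (k + 2) s - real k * flat (k + 1) s"
        using 3 by (simp add: flat_def power_divide power_add power2_eq_square)
    qed
    then show ?thesis
      by (rule has_field_derivative_transform_within_open[where S = "{0<..}"]) (use 3 in \<open>auto simp: flat_def power_divide\<close>)
  qed
qed

lemma flat_tendsto: "0 < c \<Longrightarrow> (\<lambda>N. flat 0 ((real N)\<^sup>2 * c - 1)) \<longlonglongrightarrow> 1"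
proof -
  assume c: "0 < c"
  have "((\<lambda>s. exp (- inverse s)) \<longlongrightarrow> exp (- 0)) (at_top :: real filter)"
    by (intro tendsto_intros tendsto_inverse_0_at_top filterlim_ident)
  then have "((\<lambda>s. exp (- inverse s)) \<longlongrightarrow> 1) (at_top :: real filter)" by simp
  then have "(flat 0 \<longlongrightarrow> 1) at_top"
    by (rule Lim_transform_eventually)
       (use eventually_gt_at_top[of 0] in \<open>eventually_elim, simp add: flat_def divide_inverse\<close>)
  moreover have "filterlim (\<lambda>N. (real N)\<^sup>2 * c - 1) at_top sequentially"
  proof -
    have "filterlim (\<lambda>N. c * (real N)\<^sup>2) at_top sequentially"
      by (intro filterlim_tendsto_pos_mult_at_top[OF tendsto_const c] filterlim_pow_at_top filterlim_real_sequentially) simp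
    then have "filterlim (\<lambda>N. -1 + c * (real N)\<^sup>2) at_top sequentially"
      by (rule filterlim_tendsto_add_at_top[OF tendsto_const])
    then show ?thesis by (simp add: algebra_simps)
  qed
  ultimately show ?thesis by (rule filterlim_compose)
qed

text \<open>For \<open>k = 0\<close> and \<open>c = N\<^sup>2\<close> this vanishes on the slab of
  half-width \<open>1 / N\<close> around the hyperplane orthogonal to \<open>v\<close>, and tends to
  1 off that hyperplane as \<open>N\<close> grows. Larger \<open>k\<close> occur in its
  derivatives.\<close>

definition cutoff :: "nat \<Rightarrow> real \<Rightarrow> 'a::euclidean_space \<Rightarrow> 'a \<Rightarrow> complex" where
  "cutoff k c v x = of_real (flat k (c * (x \<bullet> v)\<^sup>2 - 1))"

lemma has_derivative_cutoff:
  "(cutoff k c v has_derivative (\<lambda>h. of_real (2 * c * (h \<bullet> v) * (x \<bullet> v)) *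
     (cutoff (k + 2) c v x - of_nat k * cutoff (k + 1) c v x))) (at x)"
proof -
  have I: "((\<lambda>x. x \<bullet> v) has_derivative (\<lambda>h. h \<bullet> v)) (at x)"
    by (rule bounded_linear_imp_has_derivative[OF bounded_linear_inner_left])
  have "((\<lambda>x. c * (x \<bullet> v)\<^sup>2 - 1) has_derivative (\<lambda>h. c * ((x \<bullet> v) * (h \<bullet> v) + (h \<bullet> v) * (x \<bullet> v)) - 0)) (at x)"
    unfolding power2_eq_square
    by (rule has_derivative_diff[OF has_derivative_mult_right[OF has_derivative_mult[OF I I]] has_derivative_const])
  from has_derivative_of_real[OF has_derivative_compose[OF this flat_DERIV[unfolded has_field_derivative_def]]]
  show ?thesis
    unfolding cutoff_def
    by (rule has_derivative_eq_rhs) (simp add: fun_eq_iff algebra_simps)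
qed

lemma smooth_cutoff: "smooth (cutoff k c v)"
proof (rule smooth_coinduct[of _ "range (\<lambda>k. cutoff k c v)"])
  fix f assume "f \<in> range (\<lambda>k. cutoff k c v)"
  then obtain k where f: "f = cutoff k c v" by auto
  show "f differentiable at x" for x
    unfolding f using has_derivative_cutoff by (rule differentiableI)
  have mem: "(\<lambda>x. cutoff k c v x) \<in> range (\<lambda>k. cutoff k c v)" for k by auto
  fix b
  have sm: "smooth (\<lambda>x. complex_of_real (2 * c * (b \<bullet> v) * (x \<bullet> v)))"
    by (intro smooth_bounded_linear bounded_linear_compose[OF bounded_linear_of_real]
        bounded_linear_const_mult bounded_linear_inner_left)
  have "pd b f = (\<lambda>x. of_real (2 * c * (b \<bullet> v) * (x \<bullet> v)) *
     (cutoff (k + 2) c v x - of_nat k * cutoff (k + 1) c v x))"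
    unfolding f using pd_eqI[OF has_derivative_cutoff] by blast
  also have "\<dots> \<in> smooth_span (range (\<lambda>k. cutoff k c v))"
    by (intro smooth_span.mult[OF sm] smooth_span_diff smooth_span_cmult smooth_span.base mem)
  finally show "pd b f \<in> smooth_span (range (\<lambda>k. cutoff k c v))" .
qed auto

lemma pd_cutoff_mult_pow:
  assumes "u \<bullet> v = 0" "smooth \<phi>"
  shows "((\<lambda>\<phi>. pd u \<phi>) ^^ m) (\<lambda>x. cutoff k c v x * \<phi> x) = (\<lambda>x. cutoff k c v x * ((\<lambda>\<phi>. pd u \<phi>) ^^ m) \<phi> x)"
    and "smooth (((\<lambda>\<phi>. pd u \<phi>) ^^ m) \<phi>)"
proof (induction m)
  case (Suc m)
  let ?\<psi> = "((\<lambda>\<phi>. pd u \<phi>) ^^ m) \<phi>"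
  {
    case 1
    have "pd u (\<lambda>x. cutoff k c v x * ?\<psi> x) x = cutoff k c v x * pd u ?\<psi> x" for x
      using pd_eqI[OF has_derivative_mult[OF has_derivative_cutoff smooth_has_derivative[OF Suc.IH(2)]], where b = u] assms(1)
      by simp
    then show ?case using Suc.IH(1) by simp
  next
    case 2
    show ?case using smooth_pd[OF Suc.IH(2)] by simp
  }
qed (use assms in auto)

section \<open>Passing from the domain without its axis to the full domain\<close>

context axisymmetric_domain
begin

lemma dlin_cderiv: "dlin V S \<Longrightarrow> dlin V (cderiv ex ey \<alpha> \<beta> S)"
  using dlinD[OF dlin_dderiv, of V S] unfolding dlin_def cderiv_def by (simp add: algebra_simps)

text \<open>For real \<open>j\<close> the operator is a power of a single directional derivative,
  along \<open>ex + j *\<^sub>R ey\<close>.\<close>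

lemma cderiv_pow_dlin:
  assumes T: "dlin V T" and \<phi>: "\<phi> \<in> test_fun V"
  shows "(cderiv ex ey 1 (of_real j) ^^ m) T \<phi> = (-1) ^ m * T (((\<lambda>\<phi>. pd (ex + j *\<^sub>R ey) \<phi>) ^^ m) \<phi>)"
  using \<phi>
proof (induction m arbitrary: \<phi>)
  case (Suc m)
  let ?S = "(cderiv ex ey 1 (of_real j) ^^ m) T"
  have S: "dlin V ?S" using T by (induction m) (auto intro: dlin_cderiv)
  have "pd (ex + j *\<^sub>R ey) \<phi> = (\<lambda>x. pd ex \<phi> x + of_real j * pd ey \<phi> x)"
    using pd_linear[OF test_fun_smooth[OF Suc.prems]] by (simp add: linear_add linear_scale scaleR_conv_of_real)
  then have "?S (pd (ex + j *\<^sub>R ey) \<phi>) = ?S (pd ex \<phi>) + of_real j * ?S (pd ey \<phi>)"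
    using dlinD[OF S test_fun_pd[OF Suc.prems] test_fun_pd[OF Suc.prems]] by simp
  then have "(cderiv ex ey 1 (of_real j) ^^ Suc m) T \<phi> = - ?S (pd (ex + j *\<^sub>R ey) \<phi>)"
    by (simp add: cderiv_def dderiv_def)
  also have "\<dots> = - ((-1) ^ m * T (((\<lambda>\<phi>. pd (ex + j *\<^sub>R ey) \<phi>) ^^ m) (pd (ex + j *\<^sub>R ey) \<phi>)))"
    using Suc.IH[OF test_fun_pd[OF Suc.prems]] by simp
  finally have "(cderiv ex ey 1 (of_real j) ^^ Suc m) T \<phi>
     = - ((-1) ^ m * T (((\<lambda>\<phi>. pd (ex + j *\<^sub>R ey) \<phi>) ^^ m) (pd (ex + j *\<^sub>R ey) \<phi>)))" .
  moreover have "((\<lambda>\<phi>. pd (ex + j *\<^sub>R ey) \<phi>) ^^ Suc m) \<phi> = ((\<lambda>\<phi>. pd (ex + j *\<^sub>R ey) \<phi>) ^^ m) (pd (ex + j *\<^sub>R ey) \<phi>)"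
    by (simp only: funpow_Suc_right comp_apply)
  ultimately show ?case by (simp only: power_Suc mult_minus_left mult_1_left)
qed simp

lemma rad_pos: "x \<bullet> (ey - j *\<^sub>R ex) \<noteq> 0 \<Longrightarrow> 0 < rad x"
  by (auto simp: rad_def zc_def complex_eq_iff inner_diff_right)

text \<open>The functional \<open>x \<bullet> (ey - j *\<^sub>R ex)\<close> vanishes on the axis, so
  the slab removed by the cutoff contains the axis.\<close>

lemma test_fun_cutoff:
  assumes \<psi>: "\<psi> \<in> test_fun U"
  shows "(\<lambda>x. cutoff 0 ((real N)\<^sup>2) (ey - j *\<^sub>R ex) x * \<psi> x) \<in> test_fun U'"
proof -
  let ?v = "ey - j *\<^sub>R ex"
  obtain K where K: "compact K" "K \<subseteq> U" "\<And>x. x \<notin> K \<Longrightarrow> \<psi> x = 0"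
    using test_funE[OF \<psi>] by metis
  have cl: "closed {x. 1 \<le> (real N)\<^sup>2 * (x \<bullet> ?v)\<^sup>2}"
    by (intro closed_Collect_le continuous_intros)
  show ?thesis
  proof (rule test_funI_closed[of _ "K \<inter> {x. 1 \<le> (real N)\<^sup>2 * (x \<bullet> ?v)\<^sup>2}"])
    show "smooth (\<lambda>x. cutoff 0 ((real N)\<^sup>2) ?v x * \<psi> x)"
      by (intro smooth_mult smooth_cutoff test_fun_smooth[OF \<psi>])
    show "compact (K \<inter> {x. 1 \<le> (real N)\<^sup>2 * (x \<bullet> ?v)\<^sup>2})"
      using K(1) cl by (rule compact_Int_closed)
    show "K \<inter> {x. 1 \<le> (real N)\<^sup>2 * (x \<bullet> ?v)\<^sup>2} \<subseteq> U'"
    proof safe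
      fix x assume x: "x \<in> K" "1 \<le> (real N)\<^sup>2 * (x \<bullet> ?v)\<^sup>2"
      then have "x \<bullet> ?v \<noteq> 0" by (intro notI) simp
      then show "x \<in> U'" using x(1) K(2) rad_pos by (auto simp: U'_def)
    qed
  qed (auto simp: cutoff_def flat_def K(3))
qed

text \<open>Dominated convergence: the cutoffs are bounded by 1 and converge to 1 off a hyperplane,
  which is a null set.\<close>

lemma cutoff_integral_tendsto:
  assumes f: "f \<in> borel_measurable borel" "wnorm one_w f < \<infinity>" and \<psi>: "\<psi> \<in> test_fun U"
  shows "(\<lambda>N. LINT x|lborel. f x * (cutoff 0 ((real N)\<^sup>2) (ey - j *\<^sub>R ex) x * \<psi> x)) \<longlonglongrightarrow> (LINT x|lborel. f x * \<psi> x)"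
proof (rule integral_dominated_convergence)
  let ?v = "ey - j *\<^sub>R ex"
  note [measurable] = f(1) test_fun_measurable[OF \<psi>]
  have [measurable]: "cutoff 0 c ?v \<in> borel_measurable borel" for c
    by (intro borel_measurable_continuous_onI smooth_continuous smooth_cutoff)
  show "(\<lambda>x. f x * \<psi> x) \<in> borel_measurable lborel"
    "(\<lambda>x. f x * (cutoff 0 ((real N)\<^sup>2) ?v x * \<psi> x)) \<in> borel_measurable lborel" for N
    by measurable
  show "integrable lborel (\<lambda>x. cmod (f x * \<psi> x))"
    by (intro integrable_norm integrable_test_fun_mult[OF weight_one f \<psi>])
  have "?v \<bullet> ey = 1" by (simp add: inner_diff_left)
  then have "?v \<noteq> 0" by auto
  then have "negligible {x. ?v \<bullet> x = 0}" by (intro negligible_hyperplane) auto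
  then have ae: "AE x in lborel. ?v \<bullet> x \<noteq> 0"
    using AE_not_in[of "{x. ?v \<bullet> x = 0}" lebesgue] unfolding negligible_iff_null_sets AE_completion_iff by simp
  then show "AE x in lborel. (\<lambda>N. f x * (cutoff 0 ((real N)\<^sup>2) ?v x * \<psi> x)) \<longlonglongrightarrow> f x * \<psi> x"
  proof eventually_elim
    case (elim x)
    then have "(\<lambda>N. flat 0 ((real N)\<^sup>2 * (x \<bullet> ?v)\<^sup>2 - 1)) \<longlonglongrightarrow> 1"
      by (intro flat_tendsto) (simp add: inner_commute)
    then have "(\<lambda>N. f x * (complex_of_real (flat 0 ((real N)\<^sup>2 * (x \<bullet> ?v)\<^sup>2 - 1)) * \<psi> x)) \<longlonglongrightarrow> f x * (complex_of_real 1 * \<psi> x)"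
      by (intro tendsto_intros)
    then show ?case by (simp add: cutoff_def)
  qed
  show "AE x in lborel. cmod (f x * (cutoff 0 ((real N)\<^sup>2) ?v x * \<psi> x)) \<le> cmod (f x * \<psi> x)" for N
  proof (rule AE_I2)
    fix x
    have "cmod (cutoff 0 ((real N)\<^sup>2) ?v x) \<le> 1" by (simp add: cutoff_def flat_def)
    then have "cmod (f x) * (cmod (cutoff 0 ((real N)\<^sup>2) ?v x) * cmod (\<psi> x)) \<le> cmod (f x) * (1 * cmod (\<psi> x))"
      by (intro mult_left_mono mult_right_mono) auto
    then show "cmod (f x * (cutoff 0 ((real N)\<^sup>2) ?v x * \<psi> x)) \<le> cmod (f x * \<psi> x)"
      by (simp add: norm_mult)
  qed
qed

text \<open>A pure derivative in a direction orthogonal to \<open>v\<close> does not see a cutoff depending on \<open>x \<bullet> v\<close>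
  only. Such derivatives in sufficiently many directions determine all derivatives of order \<open>m\<close>.\<close>

lemma axis_removable:
  fixes f :: "nat \<Rightarrow> 'a \<Rightarrow> complex"
  assumes u: "u \<in> borel_measurable borel" "wnorm one_w u < \<infinity>"
    and T: "\<And>\<psi>. \<psi> \<in> test_fun U \<Longrightarrow> T \<psi> = (LINT x|lborel. u x * \<psi> x)"
    and f: "\<And>i. i \<le> m \<Longrightarrow> borel_rep one_w U' ((dderiv ex ^^ i) ((dderiv ey ^^ (m - i)) T)) (f i)"
    and "i \<le> m"
  shows "borel_rep one_w U ((dderiv ex ^^ i) ((dderiv ey ^^ (m - i)) T)) (f i)"
proof -
  let ?D = "\<lambda>i. (dderiv ex ^^ i) ((dderiv ey ^^ (m - i)) T)"
  have Tlin: "dlin U T" by (rule dlin_borel[OF weight_one u T])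
  have "?D i \<phi> = (LINT x|lborel. f i x * \<phi> x)" if \<phi>: "\<phi> \<in> test_fun U" for \<phi>
  proof -
    \<comment> \<open>The defect of \<open>f i\<close> as a representative across the axis, for the
      fixed test function \<open>\<phi>\<close>.\<close>
    define L where "L i = ?D i \<phi> - (LINT x|lborel. f i x * \<phi> x)" for i
    have zero: "(\<Sum>i\<le>m. of_nat (m choose i) * of_real j ^ (m - i) * L i) = 0" for j :: real
    proof -
      let ?v = "ey - j *\<^sub>R ex" and ?A = "(cderiv ex ey 1 (of_real j) ^^ m) T"
      let ?P = "\<lambda>\<phi>. ((\<lambda>\<phi>. pd (ex + j *\<^sub>R ey) \<phi>) ^^ m) \<phi>"
      let ?\<eta> = "\<lambda>N. cutoff 0 ((real N)\<^sup>2) ?v"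
      have A: "?A \<psi> = (\<Sum>i\<le>m. of_nat (m choose i) * of_real j ^ (m - i) * ?D i \<psi>)" if "smooth \<psi>" for \<psi>
        using cderiv_pow_pow[OF that, where a = m and b = 0 and \<alpha> = 1 and \<beta> = "of_real j"]
        by (simp add: hom_op_def coeff_linear_poly_power)
      have P_test: "?P \<phi> \<in> test_fun U"
        using \<phi> by (induction m) (auto intro: test_fun_pd)
      \<comment> \<open>The direction of differentiation is orthogonal to \<open>?v\<close>, so all
        derivatives fall on \<open>\<phi>\<close>. The limit in \<open>N\<close> then involves only
        \<open>u\<close> and never a derivative of the cutoff.\<close>
      have eq: "?A (\<lambda>x. ?\<eta> N x * \<phi> x) = (-1) ^ m * (LINT x|lborel. u x * (?\<eta> N x * ?P \<phi> x))" for N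
      proof -
        have orth: "(ex + j *\<^sub>R ey) \<bullet> ?v = 0" by (simp add: inner_add_left inner_diff_right)
        have sub: "U' \<subseteq> U" by (auto simp: U'_def)
        have "?A (\<lambda>x. ?\<eta> N x * \<phi> x) = (-1) ^ m * T (?P (\<lambda>x. ?\<eta> N x * \<phi> x))"
          by (rule cderiv_pow_dlin[OF Tlin test_fun_mono[OF test_fun_cutoff[OF \<phi>] sub]])
        also have "?P (\<lambda>x. ?\<eta> N x * \<phi> x) = (\<lambda>x. ?\<eta> N x * ?P \<phi> x)"
          by (rule pd_cutoff_mult_pow(1)[OF orth test_fun_smooth[OF \<phi>]])
        also have "T \<dots> = (LINT x|lborel. u x * (?\<eta> N x * ?P \<phi> x))"
          by (rule T[OF test_fun_mono[OF test_fun_cutoff[OF P_test] sub]])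
        finally show ?thesis .
      qed
      have "(\<lambda>N. (-1) ^ m * (LINT x|lborel. u x * (?\<eta> N x * ?P \<phi> x))) \<longlonglongrightarrow> (-1) ^ m * (LINT x|lborel. u x * ?P \<phi> x)"
        by (intro tendsto_mult tendsto_const cutoff_integral_tendsto u P_test)
      also have "(-1) ^ m * (LINT x|lborel. u x * ?P \<phi> x) = ?A \<phi>"
        using cderiv_pow_dlin[OF Tlin \<phi>] T[OF P_test] by simp
      finally have l1: "(\<lambda>N. ?A (\<lambda>x. ?\<eta> N x * \<phi> x)) \<longlonglongrightarrow> ?A \<phi>" unfolding eq .
      \<comment> \<open>The cut-off function is a test function on \<open>U'\<close>, where the
        \<open>f i\<close> are known to represent the derivatives.\<close>
      have A2: "?A (\<lambda>x. ?\<eta> N x * \<phi> x) = (\<Sum>i\<le>m. of_nat (m choose i) * of_real j ^ (m - i) * (LINT x|lborel. f i x * (?\<eta> N x * \<phi> x)))" for N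
        using f test_fun_cutoff[OF \<phi>, of N j]
        by (subst A) (auto intro!: sum.cong test_fun_smooth simp: borel_rep_def)
      have "(\<lambda>N. \<Sum>i\<le>m. of_nat (m choose i) * of_real j ^ (m - i) * (LINT x|lborel. f i x * (?\<eta> N x * \<phi> x)))
        \<longlonglongrightarrow> (\<Sum>i\<le>m. of_nat (m choose i) * of_real j ^ (m - i) * (LINT x|lborel. f i x * \<phi> x))"
        using f by (intro tendsto_sum tendsto_mult tendsto_const cutoff_integral_tendsto \<phi>) (auto simp: borel_rep_def)
      from LIMSEQ_unique[OF l1 this[folded A2]]
      have "?A \<phi> = (\<Sum>i\<le>m. of_nat (m choose i) * of_real j ^ (m - i) * (LINT x|lborel. f i x * \<phi> x))" .
      then show ?thesis
        unfolding A[OF test_fun_smooth[OF \<phi>]] L_def by (simp add: right_diff_distrib sum_subtractf)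
    qed
    \<comment> \<open>The relation \<open>zero\<close> is polynomial in \<open>j\<close>, with the
      defects times binomial coefficients as its coefficients. It has infinitely many roots, so
      every defect is zero.\<close>
    define Q where "Q = (\<Sum>i\<le>m. monom (of_nat (m choose i) * L i) (m - i))"
    have "poly Q (of_real j) = 0" for j
      using zero[of j] by (simp add: Q_def poly_sum poly_monom mult_ac)
    then have "range complex_of_real \<subseteq> {z. poly Q z = 0}" by auto
    moreover have "infinite (range complex_of_real)"
      by (simp add: finite_image_iff inj_on_def infinite_UNIV_char_0)
    ultimately have "Q = 0" using poly_roots_finite finite_subset by blast
    then have "coeff Q (m - i) = 0" by simp
    moreover have "coeff Q (m - i) = (\<Sum>i'\<le>m. if i' = i then of_nat (m choose i') * L i' else 0)"
      unfolding Q_def coeff_sum using \<open>i \<le> m\<close> by (intro sum.cong) auto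
    ultimately have "of_nat (m choose i) * L i = 0" using \<open>i \<le> m\<close> by simp
    then show ?thesis using \<open>i \<le> m\<close> by (simp add: L_def)
  qed
  then show ?thesis
    using f[OF \<open>i \<le> m\<close>] unfolding borel_rep_def by (auto simp: U'_def)
qed

end

section \<open>The equivalence\<close>

lemma distr_L2norm_sq_subset:
  assumes "open V" "open U" "V \<subseteq> U"
  shows "distr_L2norm_sq \<omega> V T \<le> distr_L2norm_sq \<omega> U T"
proof (rule distr_L2norm_sq_ge)
  fix f assume f: "borel_rep \<omega> U T f"
  then have fm[measurable]: "f \<in> borel_measurable borel" by (simp add: borel_rep_def)
  have [measurable]: "V \<in> sets borel" using assms by simp
  define g where "g x = (if x \<in> V then f x else 0)" for x
  have le: "wnorm \<omega> g \<le> wnorm \<omega> f"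
    unfolding wnorm_def by (intro nn_integral_mono) (auto simp: g_def)
  have "T \<phi> = (LINT x|lborel. g x * \<phi> x)" if \<phi>: "\<phi> \<in> test_fun V" for \<phi>
  proof -
    have eq: "(\<lambda>x. g x * \<phi> x) = (\<lambda>x. f x * \<phi> x)"
      using test_fun_zero_outside[OF \<phi>] by (auto simp: g_def fun_eq_iff)
    show ?thesis
      unfolding eq using f test_fun_mono[OF \<phi> assms(3)] by (simp add: borel_rep_def)
  qed
  moreover have "g \<in> borel_measurable borel" unfolding g_def by measurable
  ultimately have "borel_rep \<omega> V T g"
    using f le by (auto simp: borel_rep_def g_def)
  from distr_L2norm_sq_le[OF this] le show "distr_L2norm_sq \<omega> V T \<le> wnorm \<omega> f"
    using assms by (auto intro: order_trans)
qed (use assms in simp)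

text \<open>The symbol of \<open>a\<close> derivatives \<open>2\<partial>\<^sub>\<zeta>\<close> and
  \<open>m - a\<close> derivatives \<open>2\<partial>\<^sub>\<zeta>\<^sub>'\<close>, in the sense of
  \<open>hom_op\<close>.\<close>

definition zeta_poly :: "nat \<Rightarrow> nat \<Rightarrow> complex poly" where
  "zeta_poly m a = [:- \<i>, 1:] ^ a * [:\<i>, 1:] ^ (m - a)"

lemma hom_op_sum:
  "hom_op ex ey m (\<Sum>a\<in>A. smult (c a) (F a)) T \<phi> = (\<Sum>a\<in>A. c a * hom_op ex ey m (F a) T \<phi>)"
  unfolding hom_op_def coeff_sum sum_distrib_right sum_distrib_left
  by (subst sum.swap) (simp add: mult.assoc)

lemma hom_op_monom:
  assumes "i \<le> m"
  shows "hom_op ex ey m (monom 1 i) T = (dderiv ex ^^ i) ((dderiv ey ^^ (m - i)) T)"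
proof
  fix \<phi>
  have "hom_op ex ey m (monom 1 i) T \<phi>
      = (\<Sum>i'\<le>m. if i' = i then (dderiv ex ^^ i') ((dderiv ey ^^ (m - i')) T) \<phi> else 0)"
    unfolding hom_op_def by (intro sum.cong) auto
  then show "hom_op ex ey m (monom 1 i) T \<phi> = (dderiv ex ^^ i) ((dderiv ey ^^ (m - i)) T) \<phi>"
    using assms by simp
qed

text \<open>All requirements on the constant, stated outside the locales as a property of
  \<open>m\<close> and \<open>L\<close> alone: \<open>L\<close> can depend neither on
  \<open>k\<close> nor on the domain, and the same \<open>L\<close> serves both dimensions. The
  square of \<open>m + 1\<close> accounts for at most \<open>m + 1\<close> terms on either side of a
  comparison.\<close>

definition admissible_constant :: "nat \<Rightarrow> real \<Rightarrow> bool" where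
  "admissible_constant m L \<longleftrightarrow> 1 \<le> L \<and> (\<exists>K1 K2 K c.
     (\<forall>k. \<forall>i\<le>WX_top k m. bspan K1 {..m} (\<lambda>a. P_poly (real k) a (m - a)) (WX_poly k m i)) \<and>
     (\<forall>k. \<forall>a\<le>m. bspan K2 {..WX_top k m} (WX_poly k m) (P_poly (real k) a (m - a))) \<and>
     (\<forall>i\<le>m. monom 1 i = (\<Sum>a\<le>m. smult (c i a) (zeta_poly m a))) \<and>
     (\<forall>i\<le>m. \<forall>a\<le>m. cmod (c i a) \<le> K \<and> cmod (coeff (zeta_poly m a) i) \<le> K) \<and>
     (\<forall>x\<in>{K, K1, K2}. (real (Suc m))\<^sup>2 * (\<bar>x\<bar> + 1)\<^sup>2 \<le> L))"

lemma ex_admissible_constant: "\<exists>L. admissible_constant m L"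
proof -
  obtain K1 where K1: "\<forall>k. \<forall>i\<le>WX_top k m. bspan K1 {..m} (\<lambda>a. P_poly (real k) a (m - a)) (WX_poly k m i)"
    using WX_in_span_P[of m] by blast
  obtain K2 where K2: "\<forall>k. \<forall>a\<le>m. bspan K2 {..WX_top k m} (WX_poly k m) (P_poly (real k) a (m - a))"
    using P_in_span_WX[of m] by blast
  obtain c where c: "\<And>i. i \<le> m \<Longrightarrow> monom 1 i = (\<Sum>a\<le>m. smult (c i a) (zeta_poly m a))"
    using monom_in_span_powers[of _ m] unfolding zeta_poly_def by metis
  define h where "h i a = cmod (c i a) + cmod (coeff (zeta_poly m a) i)" for i a
  define K where "K = (\<Sum>i\<le>m. \<Sum>a\<le>m. h i a)"
  have hK: "h i a \<le> K" if "i \<le> m" "a \<le> m" for i a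
  proof -
    have "h i a \<le> (\<Sum>a\<le>m. h i a)" using that by (intro member_le_sum) (auto simp: h_def)
    also have "\<dots> \<le> K"
      unfolding K_def using that
      by (intro member_le_sum[of i "{..m}" "\<lambda>i. \<Sum>a\<le>m. h i a"]) (auto intro: sum_nonneg simp: h_def)
    finally show ?thesis .
  qed
  have K: "cmod (c i a) \<le> K \<and> cmod (coeff (zeta_poly m a) i) \<le> K" if "i \<le> m" "a \<le> m" for i a
    using hK[OF that] norm_ge_zero[of "c i a"] norm_ge_zero[of "coeff (zeta_poly m a) i"]
    unfolding h_def by linarith
  define g where "g x = (real (Suc m))\<^sup>2 * (\<bar>x\<bar> + 1)\<^sup>2" for x :: real
  have "0 \<le> g x" for x by (simp add: g_def)
  then have "\<forall>x\<in>{K, K1, K2}. g x \<le> 1 + g K + g K1 + g K2" "1 \<le> 1 + g K + g K1 + g K2"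
    by (auto simp: add_increasing add_increasing2)
  then show ?thesis
    unfolding admissible_constant_def g_def using K1 K2 c K by blast
qed

lemma rotate_polar:
  fixes r s t :: real
  shows "r * cos s * cos (t - s) - r * sin s * sin (t - s) = r * cos t"
    and "r * cos s * sin (t - s) + r * sin s * cos (t - s) = r * sin t"
proof -
  have trig: "cos t = cos s * cos (t - s) - sin s * sin (t - s)" "sin t = cos s * sin (t - s) + sin s * cos (t - s)"
    using cos_add[of s "t - s"] sin_add[of s "t - s"] by simp_all
  show "r * cos s * cos (t - s) - r * sin s * sin (t - s) = r * cos t"
    "r * cos s * sin (t - s) + r * sin s * cos (t - s) = r * sin t"
    unfolding trig by (simp_all only: right_diff_distrib distrib_left mult.assoc)
qed

context axisymmetric_domain
begin

text \<open>The preimage of a null set under \<open>mer\<close> is null by integration in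
  cylindrical coordinates, and so is the axis, since only positive radii enter the formula. Changing
  \<open>w\<close> on a null set therefore changes its lift on a null set only.\<close>

lemma AE_mer:
  assumes "AE p in lborel. p \<in> \<Omega> \<longrightarrow> P p"
  shows "AE x in lborel. x \<in> U \<longrightarrow> x \<in> U' \<and> P (mer x)"
proof -
  obtain N where N: "N \<in> null_sets lborel" and N_P: "\<And>p. p \<in> space lborel - N \<Longrightarrow> p \<in> \<Omega> \<longrightarrow> P p"
    using AE_E3[OF assms] by blast
  then have [measurable]: "N \<in> sets borel" by auto
  have [measurable]: "rad \<in> borel_measurable borel"
    by (intro borel_measurable_continuous_onI continuous_intros)
  define B where "B = {x. rad x = 0 \<or> mer x \<in> N}"
  have B[measurable]: "B \<in> sets borel" unfolding B_def by measurable
  have "emeasure lborel B = integral\<^sup>N lborel (indicator B)" by simp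
  also have "\<dots> = (\<integral>\<^sup>+p. \<integral>\<^sup>+t. ennreal (cyl_dens p t) * indicator B (pol t p) \<partial>lborel \<partial>lborel)"
    by (rule nn_integral_cyl) simp
  also have "\<dots> = (\<integral>\<^sup>+p. 0 \<partial>(lborel :: 'b measure))"
  proof (rule nn_integral_cong_AE)
    show "AE p in lborel. (\<integral>\<^sup>+t. ennreal (cyl_dens p t) * indicator B (pol t p) \<partial>lborel) = 0"
      using AE_not_in[OF N]
    proof eventually_elim
      case (elim p)
      have eq: "ennreal (cyl_dens p t) * indicator B (pol t p) = 0" for t
      proof (cases "0 < p \<bullet> e")
        case True
        then have "pol t p \<notin> B" using elim by (simp add: B_def rad_pol mer_pol)
        then show ?thesis by simp
      qed (simp add: cyl_dens_def)
      show ?case unfolding eq by simp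
    qed
  qed
  finally have "B \<in> null_sets lborel" using B by auto
  from AE_not_in[OF this] show ?thesis
  proof eventually_elim
    case (elim x)
    show ?case
    proof
      assume "x \<in> U"
      moreover have "rad x > 0" using elim by (auto simp: B_def rad_def)
      ultimately have "x \<in> U'" by (simp add: U'_def)
      moreover have "mer x \<notin> N" using elim by (simp add: B_def)
      ultimately show "x \<in> U' \<and> P (mer x)" using N_P mer_in_\<Omega> by auto
    qed
  qed
qed

lemma borel_representative:
  assumes "w \<in> L21_space (\<lambda>p. p \<bullet> e) \<Omega>"
  obtains v where "v \<in> borel_measurable borel" "\<And>p. p \<notin> \<Omega> \<Longrightarrow> v p = 0" "wnorm \<omega>\<^sub>r v < \<infinity>"
    "\<And>\<phi>. \<phi> \<in> borel_measurable borel \<Longrightarrow> distr_of \<Omega> w \<phi> = (LINT p|lborel. v p * \<phi> p)"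
    "\<And>\<phi> k. \<phi> \<in> borel_measurable borel \<Longrightarrow> distr_of U (lift k w) \<phi> = (LINT x|lborel. lift k v x * \<phi> x)"
proof -
  have w: "w \<in> borel_measurable (lebesgue_on \<Omega>)" "L2norm_sq \<omega>\<^sub>r \<Omega> w < \<infinity>"
    using assms by (auto simp: L21_space_def L2_space_def)
  obtain v where v: "v \<in> borel_measurable borel" "\<And>p. p \<notin> \<Omega> \<Longrightarrow> v p = 0"
      "AE p in lborel. p \<in> \<Omega> \<longrightarrow> v p = w p"
    using borel_version[OF w(1)] open_\<Omega> by auto
  show ?thesis
  proof
    show "wnorm \<omega>\<^sub>r v < \<infinity>" using w(2) L2norm_sq_version[OF v(2,3)] by simp
    show "distr_of \<Omega> w \<phi> = (LINT p|lborel. v p * \<phi> p)" if "\<phi> \<in> borel_measurable borel" for \<phi>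
      by (rule distr_of_version[OF v that])
    show "distr_of U (lift k w) \<phi> = (LINT x|lborel. lift k v x * \<phi> x)" if "\<phi> \<in> borel_measurable borel" for \<phi> k
    proof (rule distr_of_version[OF lift_measurable[OF v(1)] _ _ that])
      show "lift k v x = 0" if "x \<notin> U" for x
        using lift_zero[OF v(2)] that by (auto simp: U'_def)
      show "AE x in lborel. x \<in> U \<longrightarrow> lift k v x = lift k w x"
        using AE_mer[OF v(3)] by eventually_elim (auto simp: lift_def)
    qed
  qed (use v in auto)
qed

lemma cderiv_pow_cong_test:
  "(\<And>\<phi>. \<phi> \<in> test_fun V \<Longrightarrow> S \<phi> = T \<phi>) \<Longrightarrow> \<phi> \<in> test_fun V \<Longrightarrow>
    (cderiv ex ey \<alpha> \<beta> ^^ n) S \<phi> = (cderiv ex ey \<alpha> \<beta> ^^ n) T \<phi>"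
  by (induction n arbitrary: \<phi>) (auto intro: cderiv_cong_test)

lemma Hperp_sq_eq:
  "Hperp_sq ex ey V m u = (\<Sum>i\<le>m. distr_L2norm_sq one_w V ((dderiv ex ^^ i) ((dderiv ey ^^ (m - i)) (distr_of V u))))"
  unfolding Hperp_sq_def
  by (rule sum.reindex_bij_witness[of _ "\<lambda>i. (i, m - i)" fst]) auto

text \<open>A chain of comparisons: derivatives on \<open>U\<close>, derivatives on
  \<open>U'\<close>, the sum \<open>P\<close> of complex derivatives, and the sum \<open>WX\<close>.
  The first link has constant 1 in both directions, each of the other two costs a factor
  \<open>L\<close>.\<close>

lemma equivalence_bounds:
  assumes w: "w \<in> L21_space (\<lambda>p. p \<bullet> e) \<Omega>" and adm: "admissible_constant m L"
  shows "ennreal (1 / L\<^sup>2) * Hperp_sq ex ey U m (lift k w)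
      \<le> W_sq (\<lambda>p. p \<bullet> e) e \<Omega> m k w + X_sq (\<lambda>p. p \<bullet> e) e \<Omega> m k w"
    and "W_sq (\<lambda>p. p \<bullet> e) e \<Omega> m k w + X_sq (\<lambda>p. p \<bullet> e) e \<Omega> m k w
      \<le> ennreal (L\<^sup>2) * Hperp_sq ex ey U m (lift k w)"
proof -
  obtain K1 K2 K c where
    K1: "\<And>k i. i \<le> WX_top k m \<Longrightarrow> bspan K1 {..m} (\<lambda>a. P_poly (real k) a (m - a)) (WX_poly k m i)"
    and K2: "\<And>k a. a \<le> m \<Longrightarrow> bspan K2 {..WX_top k m} (WX_poly k m) (P_poly (real k) a (m - a))"
    and c: "\<And>i. i \<le> m \<Longrightarrow> monom 1 i = (\<Sum>a\<le>m. smult (c i a) (zeta_poly m a))"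
    and cK: "\<And>i a. i \<le> m \<Longrightarrow> a \<le> m \<Longrightarrow> cmod (c i a) \<le> K"
    and zK: "\<And>i a. i \<le> m \<Longrightarrow> a \<le> m \<Longrightarrow> cmod (coeff (zeta_poly m a) i) \<le> K"
    and L: "(real (Suc m))\<^sup>2 * (\<bar>K\<bar> + 1)\<^sup>2 \<le> L" "(real (Suc m))\<^sup>2 * (\<bar>K1\<bar> + 1)\<^sup>2 \<le> L"
      "(real (Suc m))\<^sup>2 * (\<bar>K2\<bar> + 1)\<^sup>2 \<le> L" "1 \<le> L"
    using adm unfolding admissible_constant_def by blast
  define T where "T = distr_of U (lift k w)"
  define S where "S = distr_of \<Omega> w"
  let ?D = "\<lambda>i. (dderiv ex ^^ i) ((dderiv ey ^^ (m - i)) T)"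
  let ?N = "\<lambda>V i. distr_L2norm_sq one_w V (?D i)"
  define P where "P = (\<Sum>a\<le>m. euler_norm m (P_poly (real_of_int k) a (m - a)) S)"
  define WX where "WX = (\<Sum>i\<le>WX_top (nat \<bar>k\<bar>) m. euler_norm m (WX_poly (nat \<bar>k\<bar>) m i) S)"
  obtain v where v: "v \<in> borel_measurable borel" "\<And>p. p \<notin> \<Omega> \<Longrightarrow> v p = 0" "wnorm \<omega>\<^sub>r v < \<infinity>"
    and Sv: "\<And>\<phi>. \<phi> \<in> borel_measurable borel \<Longrightarrow> distr_of \<Omega> w \<phi> = (LINT p|lborel. v p * \<phi> p)"
    and Tv: "\<And>\<phi> k. \<phi> \<in> borel_measurable borel \<Longrightarrow> distr_of U (lift k w) \<phi> = (LINT x|lborel. lift k v x * \<phi> x)"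
    by (rule borel_representative[OF w], rule that; blast)
  note Sv = Sv[folded S_def] and Tv = Tv[of _ k, folded T_def]
  have S: "dlin \<Omega> S"
    by (rule dlin_borel[OF weight_radius v(1,3)]) (simp add: Sv test_fun_measurable)
  have TS: "T \<phi> = dlift k S \<phi>" if \<phi>: "\<phi> \<in> test_fun U'" for \<phi>
    using integral_lift[OF v \<phi>] Tv[OF test_fun_measurable[OF \<phi>]]
      Sv[OF test_fun_measurable[OF test_fun_radius[OF test_fun_mode[OF \<phi>]]]] by (simp add: dlift_def)
  have WX: "W_sq (\<lambda>p. p \<bullet> e) e \<Omega> m k w + X_sq (\<lambda>p. p \<bullet> e) e \<Omega> m k w = WX"
    using W_X_sq_eq[of w m k] S by (simp add: WX_def S_def)
  have H: "Hperp_sq ex ey U m (lift k w) = (\<Sum>i\<le>m. ?N U i)"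
    by (simp add: Hperp_sq_eq T_def)
  have zeta: "distr_L2norm_sq one_w U' (hom_op ex ey m (zeta_poly m a) T)
      = euler_norm m (P_poly (real_of_int k) a (m - a)) S" if "a \<le> m" for a
  proof -
    have "hom_op ex ey m (zeta_poly m a) T \<phi>
      = dlift (k + int (m - a) - int a) (euler_op m (P_poly (real_of_int k) a (m - a)) S) \<phi>" if \<phi>: "\<phi> \<in> test_fun U'" for \<phi>
    proof -
      have "hom_op ex ey m (zeta_poly m a) T \<phi> = (cderiv ex ey 1 (- \<i>) ^^ a) ((cderiv ex ey 1 \<i> ^^ (m - a)) T) \<phi>"
        using \<open>a \<le> m\<close> cderiv_pow_pow[OF test_fun_smooth[OF \<phi>], where a = a and b = "m - a" and \<alpha> = 1 and \<beta> = "- \<i>" and \<gamma> = 1 and \<delta> = \<i>]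
        by (simp add: zeta_poly_def)
      also have "\<dots> = (cderiv ex ey 1 (- \<i>) ^^ a) ((cderiv ex ey 1 \<i> ^^ (m - a)) (dlift k S)) \<phi>"
        by (rule cderiv_pow_cong_test[OF cderiv_pow_cong_test[OF TS] \<phi>])
      also have "\<dots> = dlift (k + int (m - a) - int a) (euler_op m (P_poly (real_of_int k) a (m - a)) S) \<phi>"
        using cderiv_pow_dlift[OF S \<phi>, of a "m - a" k] \<open>a \<le> m\<close> by simp
      finally show ?thesis .
    qed
    then have "distr_L2norm_sq one_w U' (hom_op ex ey m (zeta_poly m a) T)
      = distr_L2norm_sq one_w U' (dlift (k + int (m - a) - int a) (euler_op m (P_poly (real_of_int k) a (m - a)) S))"
      by (rule distr_L2norm_sq_cong)
    then show ?thesis by (simp only: distr_norm_dlift euler_norm_def)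
  qed
  have N_P: "(\<Sum>i\<le>m. ?N U' i) \<le> ennreal L * P"
  proof -
    have "?N U' i \<le> ennreal (real (card {..m}) * (\<bar>K\<bar> + 1)\<^sup>2) * (\<Sum>a\<le>m. distr_L2norm_sq one_w U' (hom_op ex ey m (zeta_poly m a) T))"
      if "i \<le> m" for i
    proof (rule distr_L2norm_sq_sum_le[OF weight_one open_U'])
      show "?D i \<phi> = (\<Sum>a\<le>m. c i a * hom_op ex ey m (zeta_poly m a) T \<phi>)" for \<phi>
        by (simp only: hom_op_monom[OF that, symmetric] c[OF that] hom_op_sum)
    qed (use cK that in auto)
    then have "(\<Sum>i\<le>m. ?N U' i) \<le> (\<Sum>i\<le>m. ennreal (real (card {..m}) * (\<bar>K\<bar> + 1)\<^sup>2) * P)"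
      by (intro sum_mono) (simp add: P_def zeta)
    also have "\<dots> = ennreal ((real (Suc m))\<^sup>2 * (\<bar>K\<bar> + 1)\<^sup>2) * P"
      by (simp add: ennreal_of_nat_eq_real_of_nat power2_eq_square mult.assoc del: of_nat_Suc flip: ennreal_mult mult.assoc)
    also have "\<dots> \<le> ennreal L * P" using L by (intro mult_right_mono ennreal_leI) auto
    finally show ?thesis .
  qed
  have P_N: "P \<le> ennreal L * (\<Sum>i\<le>m. ?N U' i)"
  proof -
    have "distr_L2norm_sq one_w U' (hom_op ex ey m (zeta_poly m a) T) \<le> ennreal (real (card {..m}) * (\<bar>K\<bar> + 1)\<^sup>2) * (\<Sum>i\<le>m. ?N U' i)"
      if "a \<le> m" for a
    proof (rule distr_L2norm_sq_sum_le[OF weight_one open_U'])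
      show "hom_op ex ey m (zeta_poly m a) T \<phi> = (\<Sum>i\<le>m. coeff (zeta_poly m a) i * ?D i \<phi>)" for \<phi>
        by (simp add: hom_op_def)
    qed (use zK that in auto)
    then have "P \<le> (\<Sum>i\<le>m. ennreal (real (card {..m}) * (\<bar>K\<bar> + 1)\<^sup>2) * (\<Sum>i\<le>m. ?N U' i))"
      unfolding P_def by (intro sum_mono) (simp add: zeta)
    also have "\<dots> = ennreal ((real (Suc m))\<^sup>2 * (\<bar>K\<bar> + 1)\<^sup>2) * (\<Sum>i\<le>m. ?N U' i)"
      by (simp add: ennreal_of_nat_eq_real_of_nat power2_eq_square mult.assoc del: of_nat_Suc flip: ennreal_mult mult.assoc)
    also have "\<dots> \<le> ennreal L * (\<Sum>i\<le>m. ?N U' i)" using L by (intro mult_right_mono ennreal_leI) auto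
    finally show ?thesis .
  qed
  have top: "WX_top k' m \<le> m" for k' by (auto simp: WX_top_def)
  have WX_P: "WX \<le> ennreal L * P"
  proof -
    let ?k = "nat \<bar>k\<bar>"
    have "WX \<le> ennreal (real (card {..WX_top ?k m}) * (real (card {..m}) * (\<bar>K1\<bar> + 1)\<^sup>2)) * P"
      unfolding WX_def P_def sum_P_poly_abs by (rule euler_norm_sum_bspan) (simp_all only: finite_atMost K1 atMost_iff)
    also have "\<dots> \<le> ennreal L * P"
    proof (intro mult_right_mono ennreal_leI)
      have "real (card {..WX_top ?k m}) * (real (card {..m}) * (\<bar>K1\<bar> + 1)\<^sup>2)
         \<le> real (Suc m) * (real (Suc m) * (\<bar>K1\<bar> + 1)\<^sup>2)"
        using top by (intro mult_mono) auto
      also have "\<dots> \<le> L" using L(2) by (simp only: power2_eq_square mult.assoc)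
      finally show "real (card {..WX_top ?k m}) * (real (card {..m}) * (\<bar>K1\<bar> + 1)\<^sup>2) \<le> L" .
    qed simp
    finally show ?thesis .
  qed
  have P_WX: "P \<le> ennreal L * WX"
  proof -
    let ?k = "nat \<bar>k\<bar>"
    have "P \<le> ennreal (real (card {..m}) * (real (card {..WX_top ?k m}) * (\<bar>K2\<bar> + 1)\<^sup>2)) * WX"
      unfolding WX_def P_def sum_P_poly_abs by (rule euler_norm_sum_bspan) (simp_all only: finite_atMost K2 atMost_iff)
    also have "\<dots> \<le> ennreal L * WX"
    proof (intro mult_right_mono ennreal_leI)
      have "real (card {..m}) * (real (card {..WX_top ?k m}) * (\<bar>K2\<bar> + 1)\<^sup>2)
         \<le> real (Suc m) * (real (Suc m) * (\<bar>K2\<bar> + 1)\<^sup>2)"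
        using top by (intro mult_mono) auto
      also have "\<dots> \<le> L" using L(3) by (simp only: power2_eq_square mult.assoc)
      finally show "real (card {..m}) * (real (card {..WX_top ?k m}) * (\<bar>K2\<bar> + 1)\<^sup>2) \<le> L" .
    qed simp
    finally show ?thesis .
  qed
  \<comment> \<open>If some derivative on \<open>U'\<close> is not square integrable, the right-hand
    side is infinite. Otherwise all of them have representatives, as the removal of the axis
    requires.\<close>
  have N_U: "(\<Sum>i\<le>m. ?N U i) \<le> (\<Sum>i\<le>m. ?N U' i)"
  proof (cases "\<exists>i\<le>m. ?N U' i = \<infinity>")
    case True
    then have "(\<Sum>i\<le>m. ?N U' i) = \<infinity>" by auto
    then show ?thesis by (simp only: infinity_ennreal_def top_greatest)
  next
    case False
    have "\<exists>f. borel_rep one_w U' (?D i) f" if "i \<le> m" for i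
    proof (rule ccontr)
      assume "\<not> ?thesis"
      then have "\<infinity> \<le> ?N U' i"
        by (intro distr_L2norm_sq_ge) (use open_U' in auto)
      with False that show False by (auto simp: top_unique)
    qed
    then obtain f where f: "\<And>i. i \<le> m \<Longrightarrow> borel_rep one_w U' (?D i) (f i)" by metis
    have lift_fin: "wnorm one_w (lift k v) < \<infinity>" using wnorm_lift[OF v(1,2)] v(3) by simp
    have "?N U i \<le> ?N U' i" if i: "i \<le> m" for i
    proof (rule distr_L2norm_sq_ge)
      fix g assume g: "borel_rep one_w U' (?D i) g"
      \<comment> \<open>Removability takes all \<open>m + 1\<close> representatives at once. The one
        at \<open>i\<close> is the arbitrary competitor \<open>g\<close> in the infimum, the others
        stay fixed.\<close>
      have rep: "borel_rep one_w U' (?D i') ((f(i := g)) i')" if "i' \<le> m" for i'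
        using f[OF that] g by auto
      have "borel_rep one_w U (?D i) ((f(i := g)) i)"
      proof (rule axis_removable[where f = "f(i := g)", OF lift_measurable[OF v(1)] lift_fin _ _ i])
        show "T \<psi> = (LINT x|lborel. lift k v x * \<psi> x)" if "\<psi> \<in> test_fun U" for \<psi>
          by (rule Tv[OF test_fun_measurable[OF that]])
      qed (rule rep)
      then have "borel_rep one_w U (?D i) g" by simp
      then show "?N U i \<le> wnorm one_w g" by (rule distr_L2norm_sq_le) (use open_U in simp)
    qed (use open_U' in simp)
    then show ?thesis by (intro sum_mono) auto
  qed
  have U_N: "(\<Sum>i\<le>m. ?N U' i) \<le> (\<Sum>i\<le>m. ?N U i)"
    by (intro sum_mono distr_L2norm_sq_subset open_U' open_U) (auto simp: U'_def)
  have LL: "ennreal (L\<^sup>2) * x = ennreal L * (ennreal L * x)" for x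
    using L(4) by (simp add: ennreal_mult power2_eq_square mult.assoc)
  have "Hperp_sq ex ey U m (lift k w) \<le> ennreal (L\<^sup>2) * WX"
    unfolding H LL using order_trans[OF N_U order_trans[OF N_P mult_left_mono[OF P_WX]]] by simp
  then have "ennreal (1 / L\<^sup>2) * Hperp_sq ex ey U m (lift k w) \<le> ennreal (1 / L\<^sup>2) * (ennreal (L\<^sup>2) * WX)"
    by (rule mult_left_mono) (rule zero_le)
  also have "\<dots> = WX"
    using L(4) by (simp flip: mult.assoc ennreal_mult)
  finally show "ennreal (1 / L\<^sup>2) * Hperp_sq ex ey U m (lift k w)
      \<le> W_sq (\<lambda>p. p \<bullet> e) e \<Omega> m k w + X_sq (\<lambda>p. p \<bullet> e) e \<Omega> m k w"
    unfolding WX .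
  show "W_sq (\<lambda>p. p \<bullet> e) e \<Omega> m k w + X_sq (\<lambda>p. p \<bullet> e) e \<Omega> m k w
      \<le> ennreal (L\<^sup>2) * Hperp_sq ex ey U m (lift k w)"
    unfolding H WX LL
    using order_trans[OF WX_P mult_left_mono[OF order_trans[OF P_N mult_left_mono[OF U_N]]]] by simp
qed

end

section \<open>The planar and the spatial case\<close>

lemma cylindrical_2:
  "cylindrical (1, 0) (0, 1) (1 :: real) (\<lambda>_. 0) (\<lambda>_ :: real. (0, 0) :: real \<times> real)"
proof (rule cylindrical.intro)
  fix f :: "real \<times> real \<Rightarrow> ennreal" assume "f \<in> borel_measurable borel"
  from nn_integral_polar[OF this]
  show "integral\<^sup>N lborel f = (\<integral>\<^sup>+p. \<integral>\<^sup>+t. ennreal (p \<bullet> (1 :: real)) * indicator {0<..} (p \<bullet> 1) * indicator {0..2 * pi} t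
        * f ((p \<bullet> 1 * cos t) *\<^sub>R (1, 0) + (p \<bullet> 1 * sin t) *\<^sub>R (0, 1) + (0, 0)) \<partial>lborel \<partial>lborel)"
    by simp
qed (auto simp: Basis_prod_def zero_prod_def[symmetric] prod_eq_iff)

lemma cylindrical_3:
  "cylindrical (1, 0, 0) (0, 1, 0) (1 :: real, 0 :: real) (\<lambda>(x, y, z). (0, z))
    (\<lambda>(r, z). (0, 0, z) :: real \<times> real \<times> real)"
proof (rule cylindrical.intro)
  have "(\<lambda>(x, y, z). (0, z)) = (\<lambda>x :: real \<times> real \<times> real. (0 :: real, snd (snd x)))"
    by auto
  then show "bounded_linear (\<lambda>(x :: real, y :: real, z :: real). (0 :: real, z))"
    by (auto intro!: bounded_linear_Pair bounded_linear_zero bounded_linear_snd_comp bounded_linear_ident)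
  have "(\<lambda>(r, z). (0, 0, z)) = (\<lambda>p :: real \<times> real. (0 :: real, 0 :: real, snd p))"
    by auto
  then show "bounded_linear (\<lambda>(r :: real, z :: real). (0 :: real, 0 :: real, z))"
    by (auto intro!: bounded_linear_Pair bounded_linear_zero bounded_linear_snd)
  fix f :: "real \<times> real \<times> real \<Rightarrow> ennreal" assume f: "f \<in> borel_measurable borel"
  have [measurable]: "f \<in> borel_measurable (borel \<Otimes>\<^sub>M (borel \<Otimes>\<^sub>M borel))"
    using f by (simp add: borel_prod)
  have "(\<lambda>q. f (x, q)) \<in> borel_measurable (borel \<Otimes>\<^sub>M borel)" for x by measurable
  then have slice: "(\<lambda>q. f (x, q)) \<in> borel_measurable borel" for x by (simp add: borel_prod)
  have "(\<lambda>q. f (fst q, snd q, z)) \<in> borel_measurable (borel \<Otimes>\<^sub>M borel)" for z by measurable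
  then have slice': "(\<lambda>q. f (fst q, snd q, z)) \<in> borel_measurable borel" for z by (simp add: borel_prod)
  \<comment> \<open>Fubini brings \<open>z\<close> outside, and planar polar coordinates are applied
    in each slice of constant \<open>z\<close>.\<close>
  have "integral\<^sup>N lborel f = (\<integral>\<^sup>+x. \<integral>\<^sup>+q. f (x, q) \<partial>lborel \<partial>lborel)"
    using lborel.nn_integral_fst[of f lborel] f by (simp add: lborel_prod)
  also have "\<dots> = (\<integral>\<^sup>+x. \<integral>\<^sup>+z. \<integral>\<^sup>+y. f (x, y, z) \<partial>lborel \<partial>lborel \<partial>lborel)"
    using lborel_pair.nn_integral_snd[of "\<lambda>q. f (x, q)" for x] by (simp add: lborel_prod slice)
  also have "\<dots> = (\<integral>\<^sup>+z. \<integral>\<^sup>+x. \<integral>\<^sup>+y. f (x, y, z) \<partial>lborel \<partial>lborel \<partial>lborel)"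
    by (rule lborel_pair.Fubini') measurable
  also have "\<dots> = (\<integral>\<^sup>+z. integral\<^sup>N lborel (\<lambda>q. f (fst q, snd q, z)) \<partial>lborel)"
    using lborel.nn_integral_fst[of "\<lambda>q. f (fst q, snd q, z)" lborel for z] by (simp add: lborel_prod slice')
  also have "\<dots> = (\<integral>\<^sup>+z. \<integral>\<^sup>+r. \<integral>\<^sup>+t. ennreal r * indicator {0<..} r * indicator {0..2 * pi} t
      * f (r * cos t, r * sin t, z) \<partial>lborel \<partial>lborel \<partial>lborel)"
    by (simp add: nn_integral_polar[OF slice'])
  also have "\<dots> = (\<integral>\<^sup>+p. \<integral>\<^sup>+t. ennreal (fst p) * indicator {0<..} (fst p) * indicator {0..2 * pi} t
      * f (fst p * cos t, fst p * sin t, snd p) \<partial>lborel \<partial>lborel)"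
  proof -
    have "(\<lambda>p. \<integral>\<^sup>+t. ennreal (fst p) * indicator {0<..} (fst p) * indicator {0..2 * pi} t
      * f (fst p * cos t, fst p * sin t, snd p) \<partial>lborel) \<in> borel_measurable (lborel \<Otimes>\<^sub>M lborel)"
      by measurable
    from lborel_pair.nn_integral_snd[OF this] show ?thesis by (simp add: lborel_prod)
  qed
  finally show "integral\<^sup>N lborel f = (\<integral>\<^sup>+p. \<integral>\<^sup>+t. ennreal (p \<bullet> (1 :: real, 0 :: real)) * indicator {0<..} (p \<bullet> (1, 0)) * indicator {0..2 * pi} t
        * f ((p \<bullet> (1, 0) * cos t) *\<^sub>R (1, 0, 0) + (p \<bullet> (1, 0) * sin t) *\<^sub>R (0, 1, 0) + (case p of (r, z) \<Rightarrow> (0, 0, z))) \<partial>lborel \<partial>lborel)"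
    by (simp add: inner_prod_def inner_real_def case_prod_unfold)
qed (auto simp: Basis_prod_def inner_prod_def zero_prod_def prod_eq_iff)

theorem theorem4p4:
  shows
    "(\<forall>m::nat. \<exists>C::real. C \<ge> 1 \<and>
       (\<forall>(k::int) (U::(real \<times> real \<times> real) set) (w::real \<times> real \<Rightarrow> complex).
          is_domain U \<longrightarrow> axisymmetric3 U \<longrightarrow> w \<in> L21_space fst (meridian3 U) \<longrightarrow>
            ennreal (1 / C) * Hperpk3_sq U m k w
              \<le> W3_sq (meridian3 U) m k w + X3_sq (meridian3 U) m k w \<and>
            W3_sq (meridian3 U) m k w + X3_sq (meridian3 U) m k w
              \<le> ennreal C * Hperpk3_sq U m k w)) \<and>
     (\<forall>m::nat. \<exists>C::real. C \<ge> 1 \<and>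
       (\<forall>(k::int) (U::(real \<times> real) set) (w::real \<Rightarrow> complex).
          is_domain U \<longrightarrow> axisymmetric2 U \<longrightarrow> w \<in> L21_space (\<lambda>r. r) (meridian2 U) \<longrightarrow>
            ennreal (1 / C) * Hperpk2_sq U m k w
              \<le> W2_sq (meridian2 U) m k w + X2_sq (meridian2 U) m k w \<and>
            W2_sq (meridian2 U) m k w + X2_sq (meridian2 U) m k w
              \<le> ennreal C * Hperpk2_sq U m k w))"
proof (intro conjI allI)
  fix m :: nat
  obtain L where adm: "admissible_constant m L" using ex_admissible_constant by blast
  interpret cylindrical "(1, 0, 0) :: real \<times> real \<times> real" "(0, 1, 0)" "(1 :: real, 0 :: real)"
    "\<lambda>(x, y, z). (0, z)" "\<lambda>(r, z). (0, 0, z)"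
    by (rule cylindrical_3)
  have \<rho>: "(\<lambda>p. p \<bullet> (1 :: real, 0 :: real)) = fst" by (auto simp: inner_prod_def)
  have lift3: "lift k w = lift3 k w" for k w
    by (auto simp: lift_def lift3_def zc_def mer_def rad_def inner_prod_def fun_eq_iff cmod_def)
  have pol3: "pol t (r, z) = (r * cos t, r * sin t, z)" for t r z
    by (simp add: pol_def)
  show "\<exists>C::real. C \<ge> 1 \<and> (\<forall>k U w. is_domain U \<longrightarrow> axisymmetric3 U \<longrightarrow> w \<in> L21_space fst (meridian3 U) \<longrightarrow>
      ennreal (1 / C) * Hperpk3_sq U m k w \<le> W3_sq (meridian3 U) m k w + X3_sq (meridian3 U) m k w \<and>
      W3_sq (meridian3 U) m k w + X3_sq (meridian3 U) m k w \<le> ennreal C * Hperpk3_sq U m k w)"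
  proof (intro exI[of _ "L\<^sup>2"] conjI[of "1 \<le> L\<^sup>2"] allI impI)
    show "1 \<le> L\<^sup>2" using adm by (simp add: admissible_constant_def)
    fix k w and U :: "(real \<times> real \<times> real) set"
    assume U: "is_domain U" "axisymmetric3 U" and w: "w \<in> L21_space fst (meridian3 U)"
    interpret axisymmetric_domain "(1, 0, 0) :: real \<times> real \<times> real" "(0, 1, 0)" "(1 :: real, 0 :: real)"
      "\<lambda>(x, y, z). (0, z)" "\<lambda>(r, z). (0, 0, z)" U
    proof unfold_locales
      show "open U" using U by (simp add: is_domain_def)
      fix s t p assume a: "pol s p \<in> U"
      \<comment> \<open>Rotation by \<open>t - s\<close> carries \<open>pol s p\<close> to
        \<open>pol t p\<close>.\<close>
      have "(\<lambda>(x, y, z). (x * cos (t - s) - y * sin (t - s), x * sin (t - s) + y * cos (t - s), z)) (pol s p) \<in> U"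
        using U(2) a unfolding axisymmetric3_def by blast
      then show "pol t p \<in> U" by (cases p) (simp add: pol3 rotate_polar)
    qed
    have \<Omega>: "\<Omega> = meridian3 U"
      by (auto simp: \<Omega>_def meridian3_def pol3)
    show "ennreal (1 / L\<^sup>2) * Hperpk3_sq U m k w \<le> W3_sq (meridian3 U) m k w + X3_sq (meridian3 U) m k w \<and>
      W3_sq (meridian3 U) m k w + X3_sq (meridian3 U) m k w \<le> ennreal (L\<^sup>2) * Hperpk3_sq U m k w"
      using equivalence_bounds[OF _ adm, of w k] w unfolding \<Omega> \<rho> lift3 Hperpk3_sq_def by simp
  qed
next
  fix m :: nat
  obtain L where adm: "admissible_constant m L" using ex_admissible_constant by blast
  interpret cylindrical "(1, 0) :: real \<times> real" "(0, 1)" "1 :: real"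
    "\<lambda>_. 0" "\<lambda>_. (0, 0)"
    by (rule cylindrical_2)
  have \<rho>: "(\<lambda>p. p \<bullet> (1 :: real)) = (\<lambda>r. r)" by auto
  have lift2: "lift k w = lift2 k w" for k w
    by (auto simp: lift_def lift2_def zc_def mer_def rad_def inner_prod_def fun_eq_iff cmod_def)
  have pol2: "pol t r = (r * cos t, r * sin t)" for t r
    by (simp add: pol_def)
  show "\<exists>C::real. C \<ge> 1 \<and> (\<forall>k U w. is_domain U \<longrightarrow> axisymmetric2 U \<longrightarrow> w \<in> L21_space (\<lambda>r. r) (meridian2 U) \<longrightarrow>
      ennreal (1 / C) * Hperpk2_sq U m k w \<le> W2_sq (meridian2 U) m k w + X2_sq (meridian2 U) m k w \<and>
      W2_sq (meridian2 U) m k w + X2_sq (meridian2 U) m k w \<le> ennreal C * Hperpk2_sq U m k w)"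
  proof (intro exI[of _ "L\<^sup>2"] conjI[of "1 \<le> L\<^sup>2"] allI impI)
    show "1 \<le> L\<^sup>2" using adm by (simp add: admissible_constant_def)
    fix k w and U :: "(real \<times> real) set"
    assume U: "is_domain U" "axisymmetric2 U" and w: "w \<in> L21_space (\<lambda>r. r) (meridian2 U)"
    interpret axisymmetric_domain "(1, 0) :: real \<times> real" "(0, 1)" "1 :: real"
      "\<lambda>_. 0" "\<lambda>_. (0, 0)" U
    proof unfold_locales
      show "open U" using U by (simp add: is_domain_def)
      fix s t p assume a: "pol s p \<in> U"
      have "(\<lambda>(x, y). (x * cos (t - s) - y * sin (t - s), x * sin (t - s) + y * cos (t - s))) (pol s p) \<in> U"
        using U(2) a unfolding axisymmetric2_def by blast
      then show "pol t p \<in> U" by (simp add: pol2 rotate_polar)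
    qed
    have \<Omega>: "\<Omega> = meridian2 U"
      by (auto simp: \<Omega>_def meridian2_def pol2)
    show "ennreal (1 / L\<^sup>2) * Hperpk2_sq U m k w \<le> W2_sq (meridian2 U) m k w + X2_sq (meridian2 U) m k w \<and>
      W2_sq (meridian2 U) m k w + X2_sq (meridian2 U) m k w \<le> ennreal (L\<^sup>2) * Hperpk2_sq U m k w"
      using equivalence_bounds[OF _ adm, of w k] w unfolding \<Omega> \<rho> lift2 Hperpk2_sq_def by simp
  qed
qed

end
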